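(* Let $P\subseteq\mathbb{R}^2$ be a convex heptagon in general position. Then every minimum size extension $Q$ of $P$ has a vertex that is not projected onto a vertex of $P$.
   Context: A polytope $Q\subseteq\mathbb{R}^n$ is an extension of a polytope $P\subseteq\mathbb{R}^d$ if the orthogonal projection of $Q$ onto the first $d$ coordinates equals $P$. The size of a polytope is its number of facets. The extension complexity of $P$ is the minimum size of an extension of $P$, and a minimum size extension of $P$ is an extension whose size equals the extension complexity of $P$. "Projected" refers to this orthogonal projection onto the first $d$ coordinates. A convex heptagon $P$ (a convex polygon with exactly seven vertices) is in general position if: (1) there are no four pairwise distinct vertices $u_1,\dots,u_4$ of $P$ such that the lines $\overline{u_1u_2}$ and $\overline{u_3u_4}$ are parallel; (2) there are no six pairwise distinct vertices $u_1,\dots,u_6$ of $P$ such that the lines $\overline{u_1u_2}$, $\overline{u_3u_4}$, $\overline{u_5u_6}$ have a point common to all three; (3) there are no seven pairwise distinct vertices $u_1,\dots,u_7$ of $P$ such that the intersection points $\overline{u_1u_2}\cap\overline{u_3u_4}$, $\overline{u_2u_5}\cap\overline{u_4u_6}$ and $\overline{u_3u_7}\cap\overline{u_1u_5}$ lie on a common line. Here $\overline{ab}$ denotes the line through $a$ and $b$. *)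

theory Defs
  imports "HOL-Analysis.Analysis" "HOL-Analysis.Finite_Function_Topology"
begin

text \<open>
  The extension complexity of a polytope is a minimum over extensions in all dimensions \<open>n\<close>,
  so \<open>n\<close> cannot be an index type. Points are therefore finitely supported
  real sequences, and \<open>\<real>\<^sup>n\<close> is the subspace of the sequences supported on \<open>{..<n}\<close>,
  with coordinates numbered from \<open>0\<close>.
\<close>

type_synonym point = "nat \<Rightarrow>\<^sub>0 real"

definition Rn :: "nat \<Rightarrow> point set" where
  "Rn n = {x. Poly_Mapping.keys x \<subseteq> {..<n}}"

definition proj :: "nat \<Rightarrow> point \<Rightarrow> point" where
  "proj d x = (\<Sum>i<d. Poly_Mapping.single i (Poly_Mapping.lookup x i))"

lemma lookup_proj:
  "Poly_Mapping.lookup (proj d x) i = (if i < d then Poly_Mapping.lookup x i else 0)"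
  by (simp add: proj_def lookup_sum lookup_single when_def)

definition polytope_in :: "nat \<Rightarrow> point set \<Rightarrow> bool" where
  "polytope_in n P \<longleftrightarrow> polytope P \<and> P \<subseteq> Rn n"

definition vertices :: "'a::real_vector set \<Rightarrow> 'a set" where
  "vertices P = {v. v extreme_point_of P}"

text \<open>
  The library's \<^const>\<open>aff_dim\<close> and \<^const>\<open>facet_of\<close> are restricted to Euclidean spaces, so they are
  restated here for arbitrary real vector spaces. Finiteness of \<open>B\<close> is not automatic there,
  and \<open>card\<close> of an infinite set is \<open>0\<close>.
\<close>

definition has_aff_dim :: "'a::real_vector set \<Rightarrow> int \<Rightarrow> bool" where
  "has_aff_dim S k \<longleftrightarrow>
     (\<exists>B. finite B \<and> affine hull B = affine hull S \<and> \<not> affine_dependent B \<and> int (card B) = k + 1)"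

definition is_facet :: "'a::real_vector set \<Rightarrow> 'a set \<Rightarrow> bool" where
  "is_facet F S \<longleftrightarrow>
     F face_of S \<and> F \<noteq> {} \<and> (\<exists>k. has_aff_dim S k \<and> has_aff_dim F (k - 1))"

lemma has_aff_dim_iff_aff_dim:
  fixes S :: "'a::euclidean_space set"
  shows "has_aff_dim S k \<longleftrightarrow> aff_dim S = k"
proof
  assume "has_aff_dim S k"
  then obtain B where "affine hull B = affine hull S" "\<not> affine_dependent B"
    and card: "int (card B) = k + 1"
    by (auto simp: has_aff_dim_def)
  then have "int (card B) = aff_dim S + 1"
    using aff_dim_unique by blast
  then show "aff_dim S = k"
    using card by simp
next
  assume "aff_dim S = k"
  moreover obtain B where "affine hull B = affine hull S" "\<not> affine_dependent B"
    "int (card B) = aff_dim S + 1"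
    using aff_dim_basis_exists[of S] by auto
  ultimately show "has_aff_dim S k"
    unfolding has_aff_dim_def using aff_independent_finite by blast
qed

lemma is_facet_iff_facet_of:
  fixes S :: "'a::euclidean_space set"
  shows "is_facet F S \<longleftrightarrow> F facet_of S"
  by (auto simp: is_facet_def facet_of_def has_aff_dim_iff_aff_dim)

definition polytope_size :: "'a::real_vector set \<Rightarrow> nat" where
  "polytope_size P = card {F. is_facet F P}"

definition is_extension :: "nat \<Rightarrow> point set \<Rightarrow> nat \<Rightarrow> point set \<Rightarrow> bool" where
  "is_extension d P n Q \<longleftrightarrow>
     d \<le> n \<and> polytope_in d P \<and> polytope_in n Q \<and> proj d ` Q = P"

definition extension_complexity :: "nat \<Rightarrow> point set \<Rightarrow> nat" where
  "extension_complexity d P = (LEAST s. \<exists>n Q. is_extension d P n Q \<and> polytope_size Q = s)"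

definition min_size_extension :: "nat \<Rightarrow> point set \<Rightarrow> nat \<Rightarrow> point set \<Rightarrow> bool" where
  "min_size_extension d P n Q \<longleftrightarrow>
     is_extension d P n Q \<and> polytope_size Q = extension_complexity d P"

definition convex_heptagon :: "point set \<Rightarrow> bool" where
  "convex_heptagon P \<longleftrightarrow> polytope_in 2 P \<and> card (vertices P) = 7"

definition line :: "'a::real_vector \<Rightarrow> 'a \<Rightarrow> 'a set" where
  "line a b = affine hull {a, b}"

definition general_position :: "'a::real_vector set \<Rightarrow> bool" where
  "general_position P \<longleftrightarrow>
     (\<nexists>u1 u2 u3 u4.
        {u1, u2, u3, u4} \<subseteq> vertices P \<and> distinct [u1, u2, u3, u4] \<and>
        affine_parallel (line u1 u2) (line u3 u4)) \<and>
     (\<nexists>u1 u2 u3 u4 u5 u6.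
        {u1, u2, u3, u4, u5, u6} \<subseteq> vertices P \<and> distinct [u1, u2, u3, u4, u5, u6] \<and>
        line u1 u2 \<inter> line u3 u4 \<inter> line u5 u6 \<noteq> {}) \<and>
     (\<nexists>u1 u2 u3 u4 u5 u6 u7.
        {u1, u2, u3, u4, u5, u6, u7} \<subseteq> vertices P \<and>
        distinct [u1, u2, u3, u4, u5, u6, u7] \<and>
        (\<exists>p q r. line u1 u2 \<inter> line u3 u4 = {p} \<and>
                 line u2 u5 \<inter> line u4 u6 = {q} \<and>
                 line u3 u7 \<inter> line u1 u5 = {r} \<and>
                 collinear {p, q, r}))"

end

theory Submission
  imports Defs
begin

text \<open>
  Points of the plane are vectors \<open>(1, x, y)\<close>, the vertices \<open>v\<^sub>0, \<dots>, v\<^sub>6\<close> are numbered counterclockwise, and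
  orientations and incidences are signs of the brackets \<open>[abc] = det (a, b, c)\<close>.

  Some three-dimensional polytope with six facets projects onto \<open>P\<close>: lift two vertices that are separated by
  two others and keep the remaining five at height 0. Two bracket inequalities decide whether a given cyclic
  shift of the labels works. If none did, all shifts would violate the same inequality, and the
  product of the seven violations would contradict the Pluecker relations. Hence \<open>Q\<close> has at most six facets.

  Suppose that all vertices of \<open>Q\<close> lie over vertices of \<open>P\<close>. The facet functionals identify
  the cone over \<open>Q\<close> with \<open>U \<inter> \<real>\<^sup>6\<^sub>\<ge>\<^sub>0\<close> for a subspace \<open>U\<close>. If \<open>U\<close> is a hyperplane \<open>c\<^sup>\<bottom>\<close>, its extreme rays are the axes with
  \<open>c\<^sub>j = 0\<close> and one ray for each pair of coordinates with opposite signs of \<open>c\<close>; the vertices then contain a grid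
  whose rows span concurrent lines. If \<open>U\<close> is smaller, the kernel of the projection on \<open>U\<close> is spanned
  by one vector, whose signs divide the facets into lower and upper ones. Every side of \<open>P\<close> lies under
  a lower facet and over an upper one that are both tight at its two end points, distinct facets share at most two vertices, and
  lower (upper) facets do not cross. Up to six facets leave only finitely many incidence patterns, and each of
  them violates one of these constraints or condition (2) or (3).
\<close>

section \<open>Finite patterns of incidences\<close>

text \<open>Treating the plane projectively turns lines into cross products and conditions (2) and
  (3) into nonvanishing brackets; condition (1) enters by making the intersection points finite. The
  dimension of \<open>Q\<close> is not bounded in advance, so the cases are separated by the kernel
  of the projection instead. A kernel of dimension two or more, together with lifts of three
  independent vertices, leaves at most one linear equation in six slack coordinates; otherwise one
  vector, possibly 0, spans the kernel. In that case distinct sides need distinct pairs of a lower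
  and an upper facet, and seven pairs from six facets force the splits 3 + 3 or 2 + 4. Absence of
  hidden vertices acts twice: a point over a side splits into extreme rays over the two ends, so
  sides lift uniquely and both kinds of facets are tight there; and three facets of one sign cannot
  pairwise share private vertices. The concurrency and collinearity conditions enter because the
  planes of three facets meet pairwise in lines whose projections are linearly dependent.\<close>

text \<open>A set of vertices of the heptagon is a list of seven bits. The definitions up to \<open>all_bisected\<close> are evaluated
  by \<open>code_simp\<close>; they use \<open>Suc\<close> and \<open>if\<close> instead of numerals and connectives because the simplifier
  evaluates only the condition of an \<open>if\<close> before choosing a branch.\<close>

fun at_least :: "nat \<Rightarrow> bool list \<Rightarrow> bool" where
  "at_least 0 bs = True"
| "at_least (Suc n) [] = False"
| "at_least (Suc n) (b # bs) = (if b then at_least n bs else at_least (Suc n) bs)"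

fun meet :: "bool list \<Rightarrow> bool list \<Rightarrow> bool list" where
  "meet (a # as) (b # bs) = (if a then b else False) # meet as bs"
| "meet _ _ = []"

fun majority :: "bool list \<Rightarrow> bool list \<Rightarrow> bool list \<Rightarrow> bool list" where
  "majority (a # as) (b # bs) (c # cs) = (if a then if b then True else c else if b then c else False) # majority as bs cs"
| "majority _ _ _ = []"

text \<open>Taking the earliest possible position at every turn and then swapping the lists decides
  in one pass whether a strictly increasing alternating choice of \<open>n\<close> positions
  exists.\<close>

fun alternates :: "nat \<Rightarrow> bool list \<Rightarrow> bool list \<Rightarrow> bool" where
  "alternates 0 as bs = True"
| "alternates (Suc n) (a # as) (b # bs) = (if a then alternates n bs as else alternates (Suc n) as bs)"
| "alternates (Suc n) _ _ = False"

text \<open>The least common index that the third set lacks represents the shared vertex. Any choice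
  would do in \<open>extend\<close>, because the constraint behind it refutes every such triple of
  vertices.\<close>

fun pick :: "bool list \<Rightarrow> bool list \<Rightarrow> bool list \<Rightarrow> bool list option" where
  "pick (a # as) (b # bs) (c # cs) =
     (if (if a then if b then \<not> c else False else False) then Some (True # cs)
      else map_option ((#) c) (pick as bs cs))"
| "pick _ _ _ = None"

fun precedes :: "bool list \<Rightarrow> bool list \<Rightarrow> bool" where
  "precedes (a # as) (b # bs) = (if a then if b then precedes as bs else False else if b then True else precedes as bs)"
| "precedes _ _ = False"

fun same_bits :: "bool list \<Rightarrow> bool list \<Rightarrow> bool" where
  "same_bits (a # as) (b # bs) = (if a then if b then same_bits as bs else False else if b then False else same_bits as bs)"
| "same_bits [] [] = True"
| "same_bits _ _ = False"

fun sames :: "bool list list \<Rightarrow> bool list list \<Rightarrow> bool" where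
  "sames [] [] = True"
| "sames (x # xs) (y # ys) = (if same_bits x y then sames xs ys else False)"
| "sames _ _ = False"

fun listed :: "bool list list \<Rightarrow> bool list list list \<Rightarrow> bool" where
  "listed x [] = False"
| "listed x (y # ys) = (if sames x y then True else listed x ys)"

text \<open>Lists of labels assign to each side of the heptagon a facet of one sign that is tight
  along that side; side \<open>i\<close> joins the vertices \<open>i\<close> and \<open>i + 1\<close>.\<close>

datatype lab = L0 | L1 | L2

text \<open>A vertex ends one side and starts the next, so \<open>p\<close> carries the label of the
  preceding side. Calls start with the last label because the boundary is cyclic.\<close>

fun region :: "lab \<Rightarrow> lab \<Rightarrow> lab list \<Rightarrow> bool list" where
  "region k p [] = []"
| "region k p (l # ls) = (l = k \<or> p = k) # region k l ls"

definition regions :: "lab list \<Rightarrow> bool list list" where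
  "regions ls = (let p = last ls in [region L0 p ls, region L1 p ls, region L2 p ls])"

text \<open>What distinct facets of the same sign cannot do: share three vertices, or contain two
  crossing chords.\<close>

definition clash :: "bool list \<Rightarrow> bool list \<Rightarrow> bool" where
  "clash A B = (if at_least (Suc (Suc (Suc 0))) (meet A B) then True
     else if alternates (Suc (Suc (Suc (Suc 0)))) A B then True
     else alternates (Suc (Suc (Suc (Suc 0)))) B A)"

fun clashes :: "bool list list \<Rightarrow> bool" where
  "clashes [A, B, C] = (if clash A B then True else if clash A C then True else clash B C)"
| "clashes _ = False"

text \<open>Three facets of the same sign that pairwise share a vertex outside the third would leave a vertex of \<open>Q\<close>
  over an interior point of \<open>P\<close>, so one of the three shared vertices belongs to all of them.\<close>

fun extend :: "bool list list \<Rightarrow> bool list list list" where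
  "extend [A, B, C] = (case pick A B C of None \<Rightarrow> [[A, B, C]] | Some C' \<Rightarrow>
     (case pick B C A of None \<Rightarrow> [[A, B, C]] | Some A' \<Rightarrow>
     (case pick A C B of None \<Rightarrow> [[A, B, C]] | Some B' \<Rightarrow> [[A, B, C'], [A', B, C], [A, B', C]])))"
| "extend t = [t]"

text \<open>Side 0 distinguishes the first region, but \<open>L1\<close> and \<open>L2\<close> are
  interchangeable; the table keeps only one order of the other two regions.\<close>

fun arrange :: "bool list list \<Rightarrow> bool list list" where
  "arrange [A, B, C] = (if precedes B C then [A, C, B] else [A, B, C])"
| "arrange t = t"

text \<open>The sides along one facet have distinct partners of the opposite sign, so with three
  facets of each sign no label occurs four times.\<close>

definition overfull :: "lab list \<Rightarrow> bool" where
  "overfull ls = (if at_least (Suc (Suc (Suc (Suc 0)))) (map (\<lambda>l. l = L0) ls) then True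
     else if at_least (Suc (Suc (Suc (Suc 0)))) (map (\<lambda>l. l = L1) ls) then True
     else at_least (Suc (Suc (Suc (Suc 0)))) (map (\<lambda>l. l = L2) ls))"

fun words :: "lab list \<Rightarrow> nat \<Rightarrow> lab list list" where
  "words ks 0 = [[]]"
| "words ks (Suc n) = concat (map (\<lambda>l. map (\<lambda>k. k # l) ks) (words ks n))"

text \<open>The table is the outcome of an exhaustive search; \<open>all_dissected\<close> confirms its completeness.
  The first region contains side 0.\<close>

definition dissections :: "bool list list list" where "dissections = [[[True,True,True,True,False,False,False], [True,False,False,True,False,False,True], [False,False,False,True,True,True,True]],
  [[True,True,True,True,False,False,True], [True,False,False,False,False,False,True], [False,False,False,True,True,True,True]],
  [[True,True,True,True,False,False,False], [True,False,False,True,True,True,True], [True,False,False,False,False,False,True]],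
  [[True,True,True,True,False,False,False], [True,False,False,True,True,True,True], [False,False,False,False,False,True,True]],
  [[True,True,True,True,False,False,False], [True,False,False,True,False,True,True], [False,False,False,True,True,True,False]],
  [[True,True,True,True,False,True,False], [True,False,False,False,False,True,True], [False,False,False,True,True,True,False]],
  [[True,True,True,True,False,False,False], [True,False,False,True,True,True,False], [True,False,False,False,False,True,True]],
  [[True,True,True,True,False,False,False], [True,False,False,True,True,True,True], [False,False,False,False,True,True,False]],
  [[True,True,True,True,False,False,False], [True,False,False,True,True,False,True], [False,False,False,False,True,True,True]],
  [[True,True,True,True,False,False,False], [True,False,False,True,True,True,True], [False,False,False,True,True,False,False]],
  [[True,True,True,True,True,False,False], [True,False,False,False,True,True,True], [False,False,False,True,True,False,False]],
  [[True,True,True,True,False,False,False], [True,False,False,True,True,False,False], [True,False,False,False,True,True,True]],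
  [[True,True,True,True,True,False,False], [True,False,False,False,True,True,True], [False,False,True,True,False,False,False]],
  [[True,True,True,False,True,True,False], [True,False,False,False,False,True,True], [False,False,True,True,True,False,False]],
  [[True,True,True,False,False,True,True], [True,False,False,False,False,False,True], [False,False,True,True,True,True,False]],
  [[True,True,True,False,False,False,True], [False,False,True,True,True,True,False], [False,False,True,False,False,True,True]],
  [[True,True,True,False,False,True,True], [False,False,True,True,True,True,False], [False,False,False,False,False,True,True]],
  [[True,True,True,False,False,False,True], [False,False,True,True,True,True,True], [False,False,False,False,False,True,True]],
  [[True,True,True,False,False,False,False], [True,False,True,False,False,True,True], [False,False,True,True,True,True,False]],
  [[True,True,True,False,False,True,False], [True,False,False,False,False,True,True], [False,False,True,True,True,True,False]],
  [[True,True,True,False,False,False,False], [True,False,True,True,True,True,False], [True,False,False,False,False,True,True]],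
  [[True,True,True,False,False,False,True], [False,False,True,True,True,True,True], [False,False,False,False,True,True,False]],
  [[True,True,True,False,False,False,True], [False,False,True,True,True,False,False], [False,False,True,False,True,True,True]],
  [[True,True,True,False,True,False,True], [False,False,True,True,True,False,False], [False,False,False,False,True,True,True]],
  [[True,True,True,False,False,False,True], [False,False,True,True,True,False,True], [False,False,False,False,True,True,True]],
  [[True,True,True,False,False,False,False], [True,False,True,True,True,False,True], [False,False,False,False,True,True,True]],
  [[True,True,True,False,False,False,False], [True,False,True,False,True,True,True], [False,False,True,True,True,False,False]],
  [[True,True,True,False,True,False,False], [True,False,False,False,True,True,True], [False,False,True,True,True,False,False]],
  [[True,True,True,False,False,False,False], [True,False,True,True,True,False,False], [True,False,False,False,True,True,True]],
  [[True,True,True,False,False,False,True], [False,False,True,True,True,True,True], [False,False,False,True,True,False,False]],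
  [[True,True,True,False,False,False,True], [False,False,True,True,False,True,True], [False,False,False,True,True,True,False]],
  [[True,True,True,False,False,False,False], [True,False,True,True,False,True,True], [False,False,False,True,True,True,False]],
  [[True,True,True,False,False,False,True], [False,False,True,True,True,True,True], [False,False,True,True,False,False,False]],
  [[True,True,True,True,False,False,True], [False,False,True,True,False,False,False], [False,False,False,True,True,True,True]],
  [[True,True,True,False,False,False,True], [False,False,True,True,False,False,True], [False,False,False,True,True,True,True]],
  [[True,True,True,False,False,False,False], [True,False,True,True,False,False,True], [False,False,False,True,True,True,True]],
  [[True,True,True,True,True,False,False], [True,False,False,False,True,True,True], [False,True,True,False,False,False,False]],
  [[True,True,True,True,False,False,True], [False,True,True,False,False,False,False], [False,False,False,True,True,True,True]],
  [[True,True,False,True,True,True,False], [True,False,False,False,False,True,True], [False,True,True,True,False,False,False]],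
  [[True,True,False,True,True,False,True], [False,True,True,True,False,False,False], [False,False,False,False,True,True,True]],
  [[True,True,False,True,True,False,False], [True,False,False,False,True,True,True], [False,True,True,True,False,False,False]],
  [[True,True,False,False,True,True,True], [True,False,False,False,False,False,True], [False,True,True,True,True,False,False]],
  [[True,True,False,False,True,True,True], [False,True,True,True,True,False,False], [False,False,False,False,False,True,True]],
  [[True,True,False,False,True,True,False], [True,False,False,False,False,True,True], [False,True,True,True,True,False,False]],
  [[True,True,False,False,False,True,True], [False,True,True,True,True,False,False], [False,True,False,False,True,True,False]],
  [[True,True,False,False,True,True,True], [False,True,True,True,True,False,False], [False,False,False,False,True,True,False]],
  [[True,True,False,False,False,True,True], [False,True,True,True,True,True,False], [False,False,False,False,True,True,False]],
  [[True,True,False,False,False,False,True], [False,True,True,True,True,False,False], [False,True,False,False,True,True,True]],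
  [[True,True,False,False,True,False,True], [False,True,True,True,True,False,False], [False,False,False,False,True,True,True]],
  [[True,True,False,False,False,False,True], [False,True,True,True,True,False,True], [False,False,False,False,True,True,True]],
  [[True,True,False,False,False,False,False], [True,True,False,False,True,True,True], [False,True,True,True,True,False,False]],
  [[True,True,False,False,True,False,False], [True,False,False,False,True,True,True], [False,True,True,True,True,False,False]],
  [[True,True,False,False,False,False,False], [True,True,True,True,True,False,False], [True,False,False,False,True,True,True]],
  [[True,True,False,False,False,True,True], [False,True,True,True,True,True,False], [False,False,False,True,True,False,False]],
  [[True,True,False,False,False,True,True], [False,True,True,True,False,False,False], [False,True,False,True,True,True,False]],
  [[True,True,False,True,False,True,True], [False,True,True,True,False,False,False], [False,False,False,True,True,True,False]],
  [[True,True,False,False,False,True,True], [False,True,True,True,False,True,False], [False,False,False,True,True,True,False]],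
  [[True,True,False,False,False,False,True], [False,True,True,True,False,True,True], [False,False,False,True,True,True,False]],
  [[True,True,False,False,False,False,True], [False,True,True,True,False,False,False], [False,True,False,True,True,True,True]],
  [[True,True,False,True,False,False,True], [False,True,True,True,False,False,False], [False,False,False,True,True,True,True]],
  [[True,True,False,False,False,False,True], [False,True,True,True,False,False,True], [False,False,False,True,True,True,True]],
  [[True,True,False,False,False,False,False], [True,True,True,True,False,False,True], [False,False,False,True,True,True,True]],
  [[True,True,False,False,False,True,True], [False,True,True,True,True,True,False], [False,False,True,True,False,False,False]],
  [[True,True,False,False,False,True,True], [False,True,True,False,True,True,False], [False,False,True,True,True,False,False]],
  [[True,True,False,False,False,False,True], [False,True,True,False,True,True,True], [False,False,True,True,True,False,False]],
  [[True,True,False,False,False,True,True], [False,True,True,True,True,True,False], [False,True,True,False,False,False,False]],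
  [[True,True,True,False,False,True,True], [False,True,True,False,False,False,False], [False,False,True,True,True,True,False]],
  [[True,True,False,False,False,True,True], [False,True,True,False,False,True,False], [False,False,True,True,True,True,False]],
  [[True,True,False,False,False,False,True], [False,True,True,False,False,True,True], [False,False,True,True,True,True,False]],
  [[True,True,False,False,False,False,False], [True,True,True,False,False,True,True], [False,False,True,True,True,True,False]]]"

definition dissected :: "lab list \<Rightarrow> bool" where
  "dissected ls = (if overfull ls then True else if clashes (regions ls) then True
     else list_all (\<lambda>t. if clashes t then True else listed (arrange t) dissections) (extend (regions ls)))"

text \<open>Naming the facet of side 0 \<open>L0\<close> leaves the six other labels free, that is
  729 words.\<close>

lemma all_dissected: "list_all (\<lambda>l. dissected (L0 # l)) (words [L0, L1, L2] (Suc (Suc (Suc (Suc (Suc (Suc 0)))))))"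
  by code_simp

text \<open>Two facets share at most two vertices, so six positions lying in at least two of the
  sets form three disjoint pairs. Their lines are the projections of the pairwise intersections of
  three planes and would concur.\<close>

definition triad :: "bool list \<Rightarrow> bool list \<Rightarrow> bool list \<Rightarrow> bool" where
  "triad A B C = at_least (Suc (Suc (Suc (Suc (Suc (Suc 0)))))) (majority A B C)"

definition overlap :: "bool list list \<Rightarrow> bool list list \<Rightarrow> bool" where
  "overlap s t = list_ex (\<lambda>X. list_ex (\<lambda>Y. at_least (Suc (Suc (Suc 0))) (meet X Y)) t) s"

fun concur :: "bool list list \<Rightarrow> bool list list \<Rightarrow> bool" where
  "concur [A, B, C] t =
     list_ex (\<lambda>X. if triad X A B then True else if triad X A C then True else triad X B C) t"
| "concur _ _ = False"

text \<open>The conditions provide distinct \<open>u\<^sub>1, \<dots>, u\<^sub>7\<close> such that the facets \<open>a\<close> and \<open>b\<close> meet \<open>c\<close> over the lines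
  \<open>u\<^sub>1u\<^sub>2\<close> and \<open>u\<^sub>3u\<^sub>4\<close>, meet \<open>d\<close> over \<open>u\<^sub>2u\<^sub>5\<close> and \<open>u\<^sub>4u\<^sub>6\<close>, and meet \<open>e\<close> over \<open>u\<^sub>1u\<^sub>5\<close> and \<open>u\<^sub>3u\<^sub>7\<close>.
  The three points of condition (3) then lie on the projection of the line common to \<open>a\<close> and \<open>b\<close>.\<close>

definition align :: "bool list \<Rightarrow> bool list \<Rightarrow> bool list \<Rightarrow> bool list \<Rightarrow> bool list \<Rightarrow> bool" where
  "align a b c d e =
    (if at_least (Suc 0) (meet a (meet c e)) then if at_least (Suc 0) (meet a (meet c d)) then
     if at_least (Suc 0) (meet a (meet d e)) then if at_least (Suc 0) (meet b (meet c e)) then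
     if at_least (Suc 0) (meet b (meet c d)) then if at_least (Suc (Suc 0)) (meet b d) then
     if at_least (Suc (Suc 0)) (meet b e) then
     if at_least (Suc 0) (meet a (meet c (meet d e))) then False else
     if at_least (Suc 0) (meet b (meet d e)) then False else
     if at_least (Suc 0) (meet a b) then False else True
     else False else False else False else False else False else False else False)"

fun orders :: "bool list list \<Rightarrow> bool list list list" where
  "orders [A, B, C] = [[A,B,C], [A,C,B], [B,A,C], [B,C,A], [C,A,B], [C,B,A]]"
| "orders _ = []"

text \<open>Three of the five planes come from the first triple and two from the second, in four
  distributions of the roles; \<open>orders\<close> permutes the members within each triple.\<close>

fun aligns :: "bool list list \<Rightarrow> bool list list \<Rightarrow> bool" where
  "aligns [a, x, y] [b, z, w] = (if align a b z x y then True else if align a b x z y then True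
     else if align a x y b z then True else align a x b y z)"
| "aligns _ _ = False"

definition collin :: "bool list list \<Rightarrow> bool list list \<Rightarrow> bool" where
  "collin s t = list_ex (\<lambda>p. list_ex (\<lambda>q. aligns p q) (orders t)) (orders s)"

definition excluded :: "bool list list \<Rightarrow> bool list list \<Rightarrow> bool" where
  "excluded s t = (if overlap s t then True else if concur s t then True else if concur t s then True
     else if collin s t then True else collin t s)"

lemma all_excluded: "list_all (\<lambda>s. list_all (\<lambda>t. excluded s t) dissections) dissections"
  by code_simp

definition blocked :: "bool list \<Rightarrow> bool list \<Rightarrow> bool list \<Rightarrow> bool" where
  "blocked A B C = (if at_least (Suc (Suc (Suc 0))) (meet A C) then True
    else if at_least (Suc (Suc (Suc 0))) (meet B C) then True else triad A B C)"

fun join :: "bool list \<Rightarrow> bool list \<Rightarrow> bool list" where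
  "join (a # as) (b # bs) = (if a then True else b) # join as bs"
| "join _ _ = []"

definition sides :: "bool list list" where
  "sides = [[True,True,False,False,False,False,False], [False,True,True,False,False,False,False],
    [False,False,True,True,False,False,False], [False,False,False,True,True,False,False],
    [False,False,False,False,True,True,False], [False,False,False,False,False,True,True],
    [True,False,False,False,False,False,True]]"

text \<open>The case of two facets against four. If four sides have label \<open>L0\<close>, their
  partners exhaust the four opposite facets. The partner of any \<open>L1\<close> side therefore
  also serves some \<open>L0\<close> side and contains the ends of both. The test looks for one
  \<open>L1\<close> side for which every candidate \<open>L0\<close> side is impossible; words with
  another number of \<open>L0\<close> sides pass vacuously.\<close>

definition bisected :: "lab list \<Rightarrow> bool" where
  "bisected ls = (let A = region L0 (last ls) ls; B = region L1 (last ls) ls in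
     if at_least (Suc (Suc (Suc (Suc (Suc 0))))) (map (\<lambda>l. l = L0) ls) then True
     else if at_least (Suc (Suc (Suc (Suc 0)))) (map (\<lambda>l. l = L0) ls) then
       if at_least (Suc (Suc (Suc 0))) (meet A B) then True
       else list_ex (\<lambda>(l, E). if l = L1 then
              list_all (\<lambda>(k, F). if k = L0 then blocked A B (join E F) else True) (zip ls sides)
            else False) (zip ls sides)
     else True)"

lemma all_bisected: "list_all bisected (words [L0, L1] (Suc (Suc (Suc (Suc (Suc (Suc (Suc 0))))))))"
  by code_simp

section \<open>Sets denoted by the bit lists, and correctness of the evaluated tests\<close>

definition marks :: "bool list \<Rightarrow> nat set" where
  "marks R = {i. i < length R \<and> R ! i}"

lemma marks_Nil [simp]: "marks [] = {}"
  by (simp add: marks_def)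

lemma marks_Cons: "marks (b # bs) = (if b then insert 0 (Suc ` marks bs) else Suc ` marks bs)"
  by (auto simp: marks_def nth_Cons' image_iff gr0_conv_Suc less_Suc_eq_0_disj split: if_splits)

lemma finite_marks [simp]: "finite (marks R)"
  by (simp add: marks_def)

lemma at_least_iff: "at_least n R \<longleftrightarrow> n \<le> card (marks R)"
proof (induction n R rule: at_least.induct)
  case (3 n b bs)
  then show ?case by (simp add: marks_Cons card_image card_insert_if)
qed auto

lemma marks_meet: "marks (meet A B) = marks A \<inter> marks B"
  by (induction A B rule: meet.induct) (auto simp: marks_Cons)

lemma marks_join: "marks (join A B) \<subseteq> marks A \<union> marks B"
  by (induction A B rule: join.induct) (auto simp: marks_Cons)

lemma marks_majority: "marks (majority A B C) \<subseteq> marks A \<inter> marks B \<union> marks A \<inter> marks C \<union> marks B \<inter> marks C"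
  by (induction A B C rule: majority.induct) (auto simp: marks_Cons)

lemma marks_pick:
  "pick A B C = Some C' \<Longrightarrow> \<exists>i. i \<in> marks A \<and> i \<in> marks B \<and> i \<notin> marks C \<and> marks C' = insert i (marks C)"
proof (induction A B C arbitrary: C' rule: pick.induct)
  case (1 a as b bs c cs)
  show ?case
  proof (cases "a \<and> b \<and> \<not> c")
    case True
    with "1.prems" show ?thesis by (intro exI[of _ 0]) (auto simp: marks_Cons)
  next
    case False
    with "1.prems" obtain D where D: "pick as bs cs = Some D" "C' = c # D"
      by (auto split: if_splits)
    have ng: "\<not> (if a then if b then \<not> c else False else False)" using False by simp
    from "1.IH"[OF ng D(1)] obtain i where i: "i \<in> marks as" "i \<in> marks bs" "i \<notin> marks cs" "marks D = insert i (marks cs)"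
      by blast
    then show ?thesis by (intro exI[of _ "Suc i"]) (auto simp: D marks_Cons)
  qed
qed auto

lemma alternates_Suc_marks:
  "alternates (Suc n) A B \<Longrightarrow> \<exists>i. i \<in> marks A \<and> alternates n (drop (Suc i) B) (drop (Suc i) A)"
proof (induction A arbitrary: B)
  case (Cons a A)
  then obtain b B' where B: "B = b # B'" by (cases B) auto
  show ?case
  proof (cases a)
    case True with Cons B show ?thesis by (intro exI[of _ 0]) (auto simp: marks_Cons)
  next
    case False
    with Cons B obtain i where "i \<in> marks A" "alternates n (drop (Suc i) B') (drop (Suc i) A)" by auto
    with B show ?thesis by (intro exI[of _ "Suc i"]) (auto simp: marks_Cons)
  qed
qed simp

lemma marks_drop: "i \<in> marks (drop k A) \<longleftrightarrow> k + i \<in> marks A"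
  by (auto simp: marks_def)

lemma alternating_marks:
  assumes "alternates (Suc (Suc (Suc (Suc 0)))) A B"
  obtains u x w y where "u < x" "x < w" "w < y" "u \<in> marks A" "x \<in> marks B" "w \<in> marks A" "y \<in> marks B"
proof -
  from alternates_Suc_marks[OF assms] obtain u where
    u: "u \<in> marks A" "alternates (Suc (Suc (Suc 0))) (drop (Suc u) B) (drop (Suc u) A)" by blast
  from alternates_Suc_marks[OF u(2)] obtain x where
    x: "Suc u + x \<in> marks B" "alternates (Suc (Suc 0)) (drop (Suc u + Suc x) A) (drop (Suc u + Suc x) B)"
    by (auto simp: marks_drop add.commute simp del: drop_Suc)
  from alternates_Suc_marks[OF x(2)] obtain w where
    w: "Suc u + Suc x + w \<in> marks A" "alternates (Suc 0) (drop (Suc u + Suc x + Suc w) B) (drop (Suc u + Suc x + Suc w) A)"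
    by (auto simp: marks_drop add.commute add.left_commute)
  from alternates_Suc_marks[OF w(2)] obtain y where "Suc u + Suc x + Suc w + y \<in> marks B"
    by (auto simp: marks_drop)
  then show ?thesis
    by (intro that[of u "Suc u + x" "Suc u + Suc x + w" "Suc u + Suc x + Suc w + y"]) (use u(1) x(1) w(1) in auto)
qed

lemma same_bits_iff: "same_bits A B \<longleftrightarrow> A = B"
  by (induction A B rule: same_bits.induct) auto

lemma sames_iff: "sames A B \<longleftrightarrow> A = B"
  by (induction A B rule: sames.induct) (auto simp: same_bits_iff)

lemma listed_iff: "listed x xs \<longleftrightarrow> x \<in> set xs"
  by (induction x xs rule: listed.induct) (auto simp: sames_iff)

lemma set_words: "set (words ks n) = {ls. length ls = n \<and> set ls \<subseteq> set ks}"
proof (induction n)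
  case (Suc n)
  show ?case
  proof (intro set_eqI iffI)
    fix ls assume "ls \<in> {ls. length ls = Suc n \<and> set ls \<subseteq> set ks}"
    then show "ls \<in> set (words ks (Suc n))"
      by (cases ls) (auto simp: Suc)
  qed (auto simp: Suc)
qed auto

lemma length_region [simp]: "length (region k p ls) = length ls"
  by (induction k p ls rule: region.induct) auto

lemma region_nth:
  "i < length ls \<Longrightarrow> region k p ls ! i \<longleftrightarrow> ls ! i = k \<or> (if i = 0 then p else ls ! (i - 1)) = k"
  by (induction k p ls arbitrary: i rule: region.induct) (auto simp: nth_Cons')

definition next7 :: "nat \<Rightarrow> nat" where
  "next7 i = (if i = 6 then 0 else Suc i)"

lemma marks_region:
  assumes "length ls = 7"
    and "\<And>i. i < 7 \<Longrightarrow> ls ! i = k \<Longrightarrow> i \<in> X \<and> next7 i \<in> X"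
  shows "marks (region k (last ls) ls) \<subseteq> X"
proof
  fix i assume "i \<in> marks (region k (last ls) ls)"
  then have i: "i < 7" "ls ! i = k \<or> (if i = 0 then last ls else ls ! (i - 1)) = k"
    using assms(1) by (auto simp: marks_def region_nth)
  have "last ls = ls ! 6" using assms(1) by (simp add: last_conv_nth flip: length_greater_0_conv)
  with i have "ls ! i = k \<or> (if i = 0 then ls ! 6 else ls ! (i - 1)) = k" by (cases "i = 0") auto
  then consider "ls ! i = k" | "i = 0" "ls ! 6 = k" | "i \<noteq> 0" "ls ! (i - 1) = k"
    by (cases "i = 0") auto
  then show "i \<in> X"
  proof cases
    case 3
    with assms(2)[of "i - 1"] i(1) have "next7 (i - 1) \<in> X" by simp
    with 3 i(1) show ?thesis by (auto simp: next7_def split: if_splits)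
  qed (use assms(2)[of i] assms(2)[of 6] i(1) in \<open>auto simp: next7_def\<close>)
qed

text \<open>\<open>N a\<close> stands for the vertices over which facet \<open>a\<close> is tight,
  \<open>J\<close> and \<open>K\<close> for the facets of the two signs. The assumption
  \<open>star\<close> expresses that there is no hidden vertex, \<open>three\<close> comes from
  condition (2) and \<open>pappus\<close> from condition (3).\<close>

locale heptagon_incidence =
  fixes N :: "'a \<Rightarrow> nat set" and J K :: "'a set"
  assumes finite_J: "finite J" and finite_K: "finite K" and disj: "J \<inter> K = {}"
    and size: "card J + card K \<le> 6"
    and N_less: "\<And>a i. i \<in> N a \<Longrightarrow> i < 7"
    and side: "\<And>i. i < 7 \<Longrightarrow> \<exists>a\<in>J. \<exists>b\<in>K. {i, next7 i} \<subseteq> N a \<inter> N b"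
    and two: "\<And>a b. a \<in> J \<union> K \<Longrightarrow> b \<in> J \<union> K \<Longrightarrow> a \<noteq> b \<Longrightarrow> card (N a \<inter> N b) \<le> 2"
    and cross: "\<And>a b u x w y. {a, b} \<subseteq> J \<or> {a, b} \<subseteq> K \<Longrightarrow> a \<noteq> b \<Longrightarrow> u < x \<Longrightarrow> x < w \<Longrightarrow> w < y \<Longrightarrow>
      {u, w} \<subseteq> N a \<Longrightarrow> {x, y} \<subseteq> N b \<Longrightarrow> False"
    and star: "\<And>a b c u v w. {a, b, c} = J \<or> {a, b, c} = K \<Longrightarrow> distinct [a, b, c] \<Longrightarrow>
      u \<in> N a \<inter> N b - N c \<Longrightarrow> v \<in> N b \<inter> N c - N a \<Longrightarrow> w \<in> N a \<inter> N c - N b \<Longrightarrow> False"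
    and three: "\<And>a b c. {a, b, c} \<subseteq> J \<union> K \<Longrightarrow> distinct [a, b, c] \<Longrightarrow>
      card (N a \<inter> N b \<union> N a \<inter> N c \<union> N b \<inter> N c) < 6"
    and pappus: "\<And>a b c d e u1 u2 u3 u4 u5 u6 u7. {a, b, c, d, e} \<subseteq> J \<union> K \<Longrightarrow> distinct [a, b, c, d, e] \<Longrightarrow>
      distinct [u1, u2, u3, u4, u5, u6, u7] \<Longrightarrow> {u1, u2, u5} \<subseteq> N a \<Longrightarrow> {u3, u4, u6, u7} \<subseteq> N b \<Longrightarrow>
      {u1, u2, u3, u4} \<subseteq> N c \<Longrightarrow> {u2, u5, u4, u6} \<subseteq> N d \<Longrightarrow> {u3, u7, u1, u5} \<subseteq> N e \<Longrightarrow> False"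
begin

lemma swapped: "heptagon_incidence N K J"
proof
  show "finite K" "finite J" "K \<inter> J = {}" by (use finite_K finite_J disj in auto)
  show "i < 7" if "i \<in> N a" for i a using N_less that .
  show "\<exists>a\<in>K. \<exists>b\<in>J. {i, next7 i} \<subseteq> N a \<inter> N b" if "i < 7" for i
    using side[OF that] by blast
  show "card K + card J \<le> 6" using size by simp
  show "card (N a \<inter> N b) \<le> 2" if "a \<in> K \<union> J" "b \<in> K \<union> J" "a \<noteq> b" for a b
    using two that by blast
  show False if "{a, b} \<subseteq> K \<or> {a, b} \<subseteq> J" "a \<noteq> b" "u < x" "x < w" "w < y"
      "{u, w} \<subseteq> N a" "{x, y} \<subseteq> N b" for a b u x w y
    using cross[OF _ that(2-7)] that(1) by blast
  show False if "{a, b, c} = K \<or> {a, b, c} = J" "distinct [a, b, c]"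
      "u \<in> N a \<inter> N b - N c" "v \<in> N b \<inter> N c - N a" "w \<in> N a \<inter> N c - N b" for a b c u v w
    using star[OF _ that(2-5)] that(1) by blast
  show "card (N a \<inter> N b \<union> N a \<inter> N c \<union> N b \<inter> N c) < 6" if "{a, b, c} \<subseteq> K \<union> J" "distinct [a, b, c]" for a b c
    using three[OF _ that(2)] that(1) by blast
  show False if "{a, b, c, d, e} \<subseteq> K \<union> J" "distinct [a, b, c, d, e]"
      "distinct [u1, u2, u3, u4, u5, u6, u7]" "{u1, u2, u5} \<subseteq> N a" "{u3, u4, u6, u7} \<subseteq> N b"
      "{u1, u2, u3, u4} \<subseteq> N c" "{u2, u5, u4, u6} \<subseteq> N d" "{u3, u7, u1, u5} \<subseteq> N e"
    for a b c d e u1 u2 u3 u4 u5 u6 u7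
    using pappus[OF _ that(2-8)] that(1) by (simp add: Un_commute)
qed

text \<open>A pattern bounds the vertex sets from below, since a facet may be tight at more vertices
  than its sides force. Refutations by patterns must therefore never infer absence from
  \<open>N\<close> from a missing bit.\<close>

definition fits :: "bool list list \<Rightarrow> 'a list \<Rightarrow> bool" where
  "fits t as \<longleftrightarrow> distinct as \<and> list_all2 (\<lambda>R a. marks R \<subseteq> N a) t as"

lemma fits_member: "fits t as \<Longrightarrow> X \<in> set t \<Longrightarrow> \<exists>a\<in>set as. marks X \<subseteq> N a"
  unfolding fits_def by (metis in_set_conv_nth list_all2_conv_all_nth)

lemma clash_False:
  assumes "clash A B" "marks A \<subseteq> N a" "marks B \<subseteq> N b" "a \<noteq> b" "{a, b} \<subseteq> J \<or> {a, b} \<subseteq> K"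
  shows False
proof -
  consider "3 \<le> card (marks A \<inter> marks B)"
    | "alternates (Suc (Suc (Suc (Suc 0)))) A B" | "alternates (Suc (Suc (Suc (Suc 0)))) B A"
    using assms(1) by (auto simp: clash_def at_least_iff marks_meet numeral_3_eq_3 split: if_splits)
  then show False
  proof cases
    case 1
    have "finite (N a)" using N_less by (meson finite_nat_set_iff_bounded)
    then have "card (marks A \<inter> marks B) \<le> card (N a \<inter> N b)"
      using assms by (intro card_mono) auto
    with 1 two[of a b] assms show False by auto
  next
    case 2
    then obtain u x w y where "u < x" "x < w" "w < y"
        "u \<in> marks A" "x \<in> marks B" "w \<in> marks A" "y \<in> marks B"
      by (rule alternating_marks)
    then show False
      by (intro cross[of a b u x w y]) (use assms in auto)
  next
    case 3
    then obtain u x w y where "u < x" "x < w" "w < y"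
        "u \<in> marks B" "x \<in> marks A" "w \<in> marks B" "y \<in> marks A"
      by (rule alternating_marks)
    then show False
      by (intro cross[of b a u x w y]) (use assms in auto)
  qed
qed

lemma clashes_False:
  assumes "clashes t" "fits t [a, b, c]" "{a, b, c} \<subseteq> J \<or> {a, b, c} \<subseteq> K"
  shows False
proof -
  from assms(2) obtain A B C where t: "t = [A, B, C]"
    by (auto simp: fits_def list_all2_Cons2)
  have "clash A B \<or> clash A C \<or> clash B C"
    using assms(1) by (auto simp: t split: if_splits)
  then show False
    using assms(2,3) clash_False[of A B a b] clash_False[of A C a c] clash_False[of B C b c]
    by (auto simp: fits_def t)
qed

lemma extend_fits:
  assumes "fits t [a, b, c]" "J = {a, b, c}"
  shows "\<exists>t'\<in>set (extend t). fits t' [a, b, c]"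
proof -
  from assms(1) obtain A B C where t: "t = [A, B, C]"
    by (auto simp: fits_def list_all2_Cons2)
  note f = assms(1)[unfolded t fits_def, simplified]
  show ?thesis
  proof (cases "pick A B C = None \<or> pick B C A = None \<or> pick A C B = None")
    case True
    then show ?thesis using assms(1) by (auto simp: t split: option.splits)
  next
    case False
    then obtain A' B' C' where p: "pick A B C = Some C'" "pick B C A = Some A'" "pick A C B = Some B'"
      by auto
    from marks_pick[OF p(1)] obtain u where
      u: "u \<in> marks A" "u \<in> marks B" "marks C' = insert u (marks C)" by auto
    from marks_pick[OF p(2)] obtain v where
      v: "v \<in> marks B" "v \<in> marks C" "marks A' = insert v (marks A)" by auto
    from marks_pick[OF p(3)] obtain w where
      w: "w \<in> marks A" "w \<in> marks C" "marks B' = insert w (marks B)" by auto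
    have "u \<in> N a \<inter> N b" "v \<in> N b \<inter> N c" "w \<in> N a \<inter> N c"
      using f u v w by auto
    \<comment> \<open>The missing bits say nothing about \<open>N\<close>; it is \<open>star\<close>
      that puts one of the three shared vertices into the third set.\<close>
    then have "u \<in> N c \<or> v \<in> N a \<or> w \<in> N b"
      using star[of a b c u v w] f assms(2) by auto
    then show ?thesis
      using f u v w by (auto simp: t p fits_def)
  qed
qed

lemma arrange_fits:
  assumes "fits t [a, b, c]"
  shows "\<exists>as. fits (arrange t) as \<and> set as = {a, b, c}"
proof -
  from assms obtain A B C where t: "t = [A, B, C]"
    by (auto simp: fits_def list_all2_Cons2)
  show ?thesis
    by (cases "precedes B C") (use assms in \<open>auto simp: fits_def t intro: exI[of _ "[a, c, b]"] exI[of _ "[a, b, c]"]\<close>)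
qed

text \<open>Two different sides have at least three end points together, whereas two facets share at
  most two vertices; hence no pair of facets serves two sides.\<close>

lemma sides_exist:
  "\<exists>f g. (\<forall>i<7. f i \<in> J) \<and> (\<forall>i<7. g i \<in> K) \<and> (\<forall>i<7. {i, next7 i} \<subseteq> N (f i) \<inter> N (g i)) \<and>
    inj_on (\<lambda>i. (f i, g i)) {..<7}"
proof -
  from side obtain f g where
    fg: "\<And>i. i < 7 \<Longrightarrow> f i \<in> J \<and> g i \<in> K \<and> {i, next7 i} \<subseteq> N (f i) \<inter> N (g i)"
    by metis
  have "inj_on (\<lambda>i. (f i, g i)) {..<7}"
  proof (rule inj_onI)
    fix i j assume ij: "i \<in> {..<7}" "j \<in> {..<7}" "(f i, g i) = (f j, g j)"
    show "i = j"
    proof (rule ccontr)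
      assume "i \<noteq> j"
      have "{i, next7 i, j, next7 j} \<subseteq> N (f i) \<inter> N (g i)"
        using fg[of i] fg[of j] ij by auto
      moreover have "finite (N (f i) \<inter> N (g i))"
        using N_less by (meson finite_Int finite_nat_set_iff_bounded)
      ultimately have "card {i, next7 i, j, next7 j} \<le> card (N (f i) \<inter> N (g i))"
        by (intro card_mono)
      moreover have "f i \<in> J" "g i \<in> K" using fg[of i] ij by auto
      then have "card (N (f i) \<inter> N (g i)) \<le> 2"
        using disj by (intro two) auto
      moreover have "3 \<le> card {i, next7 i, j, next7 j}"
        using \<open>i \<noteq> j\<close> ij by (auto simp: next7_def card_insert_if)
      ultimately show False by linarith
    qed
  qed
  with fg show ?thesis by (intro exI[of _ f] exI[of _ g]) auto
qed

text \<open>With at most six facets in total, this leaves only 3 + 3, 2 + 4 and 4 + 2.\<close>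

lemma card_prod_ge: "7 \<le> card J * card K"
proof -
  obtain f g where fg: "\<And>i. i < 7 \<Longrightarrow> f i \<in> J" "\<And>i. i < 7 \<Longrightarrow> g i \<in> K"
    "inj_on (\<lambda>i. (f i, g i)) {..<7::nat}" using sides_exist by blast
  have "card {..<7::nat} \<le> card (J \<times> K)"
    by (rule card_inj_on_le[OF fg(3)]) (use fg finite_J finite_K in auto)
  then show ?thesis by (simp add: card_cartesian_product)
qed

lemma card_fibre_le:
  assumes "\<And>i. i < 7 \<Longrightarrow> g i \<in> K" "inj_on (\<lambda>i. (f i, g i)) {..<7::nat}"
  shows "card {i. i < 7 \<and> f i = a} \<le> card K"
proof (rule card_inj_on_le)
  show "inj_on g {i. i < 7 \<and> f i = a}"
    using assms(2) by (auto simp: inj_on_def)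
qed (use assms finite_K in auto)

lemma marks_map: "marks (map P ls) = {i. i < length ls \<and> P (ls ! i)}"
  by (auto simp: marks_def)

lemma fits_dissection:
  assumes "card J = 3" "card K = 3"
  shows "\<exists>t\<in>set dissections. \<exists>as. fits t as \<and> set as = J"
proof -
  obtain f g where fg: "\<And>i. i < 7 \<Longrightarrow> f i \<in> J" "\<And>i. i < 7 \<Longrightarrow> g i \<in> K"
    "\<And>i. i < 7 \<Longrightarrow> {i, next7 i} \<subseteq> N (f i) \<inter> N (g i)" "inj_on (\<lambda>i. (f i, g i)) {..<7}"
    using sides_exist by blast
  \<comment> \<open>The facet chosen for side 0 receives label \<open>L0\<close>, as the table
    requires.\<close>
  define a where "a = f 0"
  have "a \<in> J" using fg(1)[of 0] by (simp add: a_def)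
  then have "card (J - {a}) = 2" using assms by simp
  then obtain b c where bc: "J - {a} = {b, c}" "b \<noteq> c" by (meson card_2_iff)
  then have J: "J = {a, b, c}" and dist: "distinct [a, b, c]" using \<open>a \<in> J\<close> by auto
  define lb where "lb x = (if x = a then L0 else if x = b then L1 else L2)" for x
  define ls where "ls = map (\<lambda>i. lb (f i)) [0..<7]"
  have len: "length ls = 7" and nth: "\<And>i. i < 7 \<Longrightarrow> ls ! i = lb (f i)"
    by (auto simp: ls_def)
  have lb: "lb x = L0 \<longleftrightarrow> x = a" "x \<in> J \<Longrightarrow> lb x = L1 \<longleftrightarrow> x = b" "x \<in> J \<Longrightarrow> lb x = L2 \<longleftrightarrow> x = c" for x
    using J dist by (auto simp: lb_def)
  have lb_inj: "lb x = lb y \<longleftrightarrow> x = y" if "x \<in> J" "y \<in> J" for x y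
    using that J dist by (auto simp: lb_def)
  have lbs: "lb a = L0" "lb b = L1" "lb c = L2" using dist by (auto simp: lb_def)
  have "ls ! 0 = L0" by (simp add: nth lb a_def)
  then obtain ls' where ls': "ls = L0 # ls'" "length ls' = 6"
    using len by (cases ls) auto
  have "ls' \<in> set (words [L0, L1, L2] (Suc (Suc (Suc (Suc (Suc (Suc 0)))))))"
    unfolding set_words mem_Collect_eq using ls'(2) lab.exhaust by (auto simp del: words.simps)
  then have dis: "dissected ls"
    using all_dissected unfolding list_all_iff ls'(1) by blast
  have "card {i. i < 7 \<and> ls ! i = lb x} \<le> 3" if "x \<in> J" for x
  proof -
    have "{i. i < 7 \<and> ls ! i = lb x} = {i. i < 7 \<and> f i = x}"
      using that fg(1) by (auto simp: nth lb_inj)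
    then show ?thesis using card_fibre_le[OF fg(2,4), of x] assms by simp
  qed
  from this[of a] this[of b] this[of c]
  have "card {i. i < 7 \<and> ls ! i = L0} \<le> 3" "card {i. i < 7 \<and> ls ! i = L1} \<le> 3"
    "card {i. i < 7 \<and> ls ! i = L2} \<le> 3"
    using J by (simp_all add: lbs)
  then have "\<not> overfull ls"
    by (simp add: overfull_def at_least_iff marks_map len)
  moreover have fit: "fits (regions ls) [a, b, c]"
  proof -
    have "marks (region (lb x) (last ls) ls) \<subseteq> N x" if "x \<in> J" for x
    proof (rule marks_region[OF len])
      fix i assume i: "i < 7" "ls ! i = lb x"
      then have "f i = x" using that fg(1)[of i] by (simp add: nth lb_inj)
      then show "i \<in> N x \<and> next7 i \<in> N x" using fg(3)[of i] i by auto
    qed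
    from this[of a] this[of b] this[of c] show ?thesis
      using J dist by (simp add: fits_def regions_def Let_def lbs)
  qed
  ultimately have all: "list_all (\<lambda>t. if clashes t then True else listed (arrange t) dissections) (extend (regions ls))"
    using dis clashes_False[of "regions ls" a b c] J by (metis dissected_def subset_refl)
  obtain t where t: "t \<in> set (extend (regions ls))" "fits t [a, b, c]"
    using extend_fits[OF fit J] by blast
  have "\<not> clashes t" using clashes_False[OF _ t(2)] J by auto
  then have "arrange t \<in> set dissections"
    using all t(1) by (auto simp: list_all_iff listed_iff)
  then show ?thesis using arrange_fits[OF t(2)] J by metis
qed

lemma finite_N: "finite (N a)"
  using N_less by (meson finite_nat_set_iff_bounded)

lemma overlap_False:
  assumes "overlap s t" "fits s as" "fits t bs" "set as \<subseteq> J" "set bs \<subseteq> K"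
  shows False
proof -
  from assms(1) obtain X Y where XY: "X \<in> set s" "Y \<in> set t" "3 \<le> card (marks X \<inter> marks Y)"
    by (auto simp: overlap_def list_ex_iff at_least_iff marks_meet numeral_3_eq_3)
  from fits_member[OF assms(2) XY(1)] obtain a where a: "a \<in> set as" "marks X \<subseteq> N a" by blast
  from fits_member[OF assms(3) XY(2)] obtain b where b: "b \<in> set bs" "marks Y \<subseteq> N b" by blast
  have "card (marks X \<inter> marks Y) \<le> card (N a \<inter> N b)"
    using a b by (intro card_mono) (auto simp: finite_N)
  with XY(3) two[of a b] a b assms(4,5) disj show False by fastforce
qed

lemma triad_False:
  assumes "triad A B C" "marks A \<subseteq> N a" "marks B \<subseteq> N b" "marks C \<subseteq> N c"
    "distinct [a, b, c]" "{a, b, c} \<subseteq> J \<union> K"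
  shows False
proof -
  have "6 \<le> card (marks (majority A B C))"
    using assms(1) by (simp add: triad_def at_least_iff)
  also have "\<dots> \<le> card (N a \<inter> N b \<union> N a \<inter> N c \<union> N b \<inter> N c)"
    using marks_majority[of A B C] assms(2-4) by (intro card_mono) (auto simp: finite_N)
  also have "\<dots> < 6" using three assms(5,6) by blast
  finally show False by simp
qed

lemma concur_False:
  assumes "concur s t" "fits s as" "fits t bs" "set as \<union> set bs \<subseteq> J \<union> K" "set as \<inter> set bs = {}"
  shows False
proof -
  from assms(1) obtain A B C where s: "s = [A, B, C]"
    by (cases "(s, t)" rule: concur.cases) auto
  from assms(2) obtain a b c where as: "as = [a, b, c]"
    by (auto simp: s fits_def list_all2_Cons1)
  from assms(1) obtain X where X: "X \<in> set t" "triad X A B \<or> triad X A C \<or> triad X B C"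
    by (auto simp: s list_ex_iff split: if_splits)
  from fits_member[OF assms(3) X(1)] obtain x where x: "x \<in> set bs" "marks X \<subseteq> N x" by blast
  have "x \<in> J \<union> K" "x \<notin> set as" using assms(4,5) x by auto
  then show False
    using X(2) triad_False[of X A B x a b] triad_False[of X A C x a c] triad_False[of X B C x b c]
      assms(2,4) x(2) by (auto simp: fits_def s as)
qed

lemma align_False:
  assumes "align A B C D E" "marks A \<subseteq> N a" "marks B \<subseteq> N b" "marks C \<subseteq> N c" "marks D \<subseteq> N d" "marks E \<subseteq> N e"
    "distinct [a, b, c, d, e]" "{a, b, c, d, e} \<subseteq> J \<union> K"
  shows False
proof -
  note al = assms(1)[unfolded align_def at_least_iff marks_meet]
  have ne: "\<exists>x. x \<in> S" if "Suc 0 \<le> card S" for S :: "nat set"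
    using that by (metis card.empty ex_in_conv not_one_le_zero One_nat_def)
  have ne2: "\<exists>x. x \<in> S \<and> x \<noteq> y" if "Suc (Suc 0) \<le> card S" for S :: "nat set" and y
  proof (rule ccontr)
    assume "\<not> ?thesis"
    then have "S \<subseteq> {y}" by auto
    then have "card S \<le> 1" by (metis card_mono finite.emptyI finite_insert is_singletonI is_singleton_altdef)
    with that show False by simp
  qed
  have em: "S = {}" if "\<not> Suc 0 \<le> card S" "finite S" for S :: "nat set"
    using that by (auto simp: card_gt_0_iff Suc_le_eq)
  obtain u1 where u1: "u1 \<in> marks A" "u1 \<in> marks C" "u1 \<in> marks E" using al ne[of "marks A \<inter> (marks C \<inter> marks E)"] by (auto split: if_splits)
  obtain u2 where u2: "u2 \<in> marks A" "u2 \<in> marks C" "u2 \<in> marks D" using al ne[of "marks A \<inter> (marks C \<inter> marks D)"] by (auto split: if_splits)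
  obtain u5 where u5: "u5 \<in> marks A" "u5 \<in> marks D" "u5 \<in> marks E" using al ne[of "marks A \<inter> (marks D \<inter> marks E)"] by (auto split: if_splits)
  obtain u3 where u3: "u3 \<in> marks B" "u3 \<in> marks C" "u3 \<in> marks E" using al ne[of "marks B \<inter> (marks C \<inter> marks E)"] by (auto split: if_splits)
  obtain u4 where u4: "u4 \<in> marks B" "u4 \<in> marks C" "u4 \<in> marks D" using al ne[of "marks B \<inter> (marks C \<inter> marks D)"] by (auto split: if_splits)
  obtain u6 where u6: "u6 \<in> marks B" "u6 \<in> marks D" "u6 \<noteq> u4" using al ne2[of "marks B \<inter> marks D"] by (auto split: if_splits)
  obtain u7 where u7: "u7 \<in> marks B" "u7 \<in> marks E" "u7 \<noteq> u3" using al ne2[of "marks B \<inter> marks E"] by (auto split: if_splits)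
  \<comment> \<open>The three emptiness conditions of \<open>align\<close> separate the chosen
    vertices: the first within \<open>a\<close>, the second within \<open>b\<close>, the third
    between them.\<close>
  have e1: "marks A \<inter> (marks C \<inter> (marks D \<inter> marks E)) = {}" using al em by (auto split: if_splits)
  have e2: "marks B \<inter> (marks D \<inter> marks E) = {}" using al em by (auto split: if_splits)
  have e3: "marks A \<inter> marks B = {}" using al em by (auto split: if_splits)
  have "distinct [u1, u2, u3, u4, u5, u6, u7]"
    using u1 u2 u3 u4 u5 u6 u7 e1 e2 e3 by auto
  then show False
    by (rule pappus[OF assms(8,7)]) (use assms(2-6) u1 u2 u3 u4 u5 u6 u7 in auto)
qed

lemma orders_fits:
  assumes "fits t as" "p \<in> set (orders t)"
  shows "\<exists>bs. fits p bs \<and> set bs = set as"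
proof -
  from assms(2) obtain A B C where t: "t = [A, B, C]"
    by (cases t rule: orders.cases) auto
  from assms(1) obtain a b c where as: "as = [a, b, c]"
    by (auto simp: t fits_def list_all2_Cons1)
  show ?thesis
    using assms unfolding t as fits_def
    by (auto intro: exI[of _ "[a, b, c]"] exI[of _ "[a, c, b]"] exI[of _ "[b, a, c]"] exI[of _ "[b, c, a]"]
        exI[of _ "[c, a, b]"] exI[of _ "[c, b, a]"])
qed

lemma collin_False:
  assumes "collin s t" "fits s as" "fits t bs" "set as \<union> set bs \<subseteq> J \<union> K" "set as \<inter> set bs = {}"
  shows False
proof -
  from assms(1) obtain p q where pq: "p \<in> set (orders s)" "q \<in> set (orders t)" "aligns p q"
    by (auto simp: collin_def list_ex_iff)
  from orders_fits[OF assms(2) pq(1)] obtain as' where as': "fits p as'" "set as' = set as" by blast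
  from orders_fits[OF assms(3) pq(2)] obtain bs' where bs': "fits q bs'" "set bs' = set bs" by blast
  from pq(3) obtain A X Y B Z W where p: "p = [A, X, Y]" and q: "q = [B, Z, W]"
    by (cases "(p, q)" rule: aligns.cases) auto
  from as'(1) obtain a x y where pa: "as' = [a, x, y]" by (auto simp: p fits_def list_all2_Cons1)
  from bs'(1) obtain b z w where qa: "bs' = [b, z, w]" by (auto simp: q fits_def list_all2_Cons1)
  have dist: "distinct [a, x, y, b, z, w]" and sub: "{a, x, y, b, z, w} \<subseteq> J \<union> K"
    using as' bs' assms(4,5) by (auto simp: fits_def pa qa)
  have m: "marks A \<subseteq> N a" "marks X \<subseteq> N x" "marks Y \<subseteq> N y" "marks B \<subseteq> N b" "marks Z \<subseteq> N z"
    using as'(1) bs'(1) by (auto simp: fits_def p q pa qa)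
  have "align A B Z X Y \<or> align A B X Z Y \<or> align A X Y B Z \<or> align A X B Y Z"
    using pq(3) by (auto simp: p q split: if_splits)
  then show False
    using align_False[of A B Z X Y a b z x y] align_False[of A B X Z Y a b x z y]
      align_False[of A X Y B Z a x y b z] align_False[of A X B Y Z a x b y z] m dist sub by auto
qed

lemma not_three_three:
  assumes "card J = 3" "card K = 3"
  shows False
proof -
  interpret swap: heptagon_incidence N K J by (rule swapped)
  obtain s as where s: "s \<in> set dissections" "fits s as" "set as = J"
    using fits_dissection assms by blast
  obtain t bs where t: "t \<in> set dissections" "fits t bs" "set bs = K"
    using swap.fits_dissection assms by blast
  have "excluded s t" using all_excluded s(1) t(1) unfolding list_all_iff by blast
  then consider "overlap s t" | "concur s t" | "concur t s" | "collin s t" | "collin t s"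
    by (auto simp: excluded_def split: if_splits)
  then show False
  proof cases
    case 1
    then show False by (rule overlap_False[OF _ s(2) t(2)]) (use s(3) t(3) in auto)
  next
    case 2
    then show False by (rule concur_False[OF _ s(2) t(2)]) (use s(3) t(3) disj in auto)
  next
    case 3
    then show False by (rule concur_False[OF _ t(2) s(2)]) (use s(3) t(3) disj in auto)
  next
    case 4
    then show False by (rule collin_False[OF _ s(2) t(2)]) (use s(3) t(3) disj in auto)
  next
    case 5
    then show False by (rule collin_False[OF _ t(2) s(2)]) (use s(3) t(3) disj in auto)
  qed
qed

lemma not_two_four:
  assumes "card J = 2" "card K = 4"
  shows False
proof -
  obtain f g where fg: "\<And>i. i < 7 \<Longrightarrow> f i \<in> J" "\<And>i. i < 7 \<Longrightarrow> g i \<in> K"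
    "\<And>i. i < 7 \<Longrightarrow> {i, next7 i} \<subseteq> N (f i) \<inter> N (g i)" "inj_on (\<lambda>i. (f i, g i)) {..<7}"
    using sides_exist by blast
  define F where "F a = {i. i < 7 \<and> f i = a}" for a
  have finF: "finite (F a)" for a by (simp add: F_def)
  have F4: "card (F a) \<le> 4" for a
    using card_fibre_le[OF fg(2,4), of a] assms by (simp add: F_def)
  obtain a0 b0 where ab0: "J = {a0, b0}" "a0 \<noteq> b0" using assms(1) by (meson card_2_iff)
  have "{..<7} = F a0 \<union> F b0" "F a0 \<inter> F b0 = {}" using fg(1) ab0 by (auto simp: F_def)
  then have "card {..<7::nat} = card (F a0) + card (F b0)" by (simp add: card_Un_disjoint finF)
  \<comment> \<open>Seven sides are shared by two facets with at most four sides each.\<close>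
  then have "card (F a0) = 4 \<or> card (F b0) = 4" using F4[of a0] F4[of b0] by auto
  then obtain a b where J: "J = {a, b}" "a \<noteq> b" "card (F a) = 4"
    using ab0 by (metis insert_commute)
  define ls where "ls = map (\<lambda>i. if f i = a then L0 else L1) [0..<7]"
  have len: "length ls = 7" and nth: "\<And>i. i < 7 \<Longrightarrow> ls ! i = (if f i = a then L0 else L1)"
    by (auto simp: ls_def)
  define A B where "A = region L0 (last ls) ls" and "B = region L1 (last ls) ls"
  have mA: "marks A \<subseteq> N a" unfolding A_def
    by (rule marks_region[OF len]) (use fg nth in \<open>auto split: if_splits\<close>)
  have mB: "marks B \<subseteq> N b" unfolding B_def
    by (rule marks_region[OF len]) (use fg nth J in \<open>fastforce split: if_splits\<close>)
  have "{i. i < 7 \<and> ls ! i = L0} = F a" by (auto simp: F_def nth split: if_splits)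
  then have c4: "card {i. i < 7 \<and> ls ! i = L0} = 4" using J by simp
  have "ls \<in> set (words [L0, L1] (Suc (Suc (Suc (Suc (Suc (Suc (Suc 0))))))))"
    unfolding set_words by (auto simp: ls_def)
  then have "bisected ls"
    using all_bisected unfolding list_all_iff by blast
  then have bis: "at_least (Suc (Suc (Suc 0))) (meet A B) \<or>
     list_ex (\<lambda>(l, E). if l = L1 then
              list_all (\<lambda>(k, F). if k = L0 then blocked A B (join E F) else True) (zip ls sides)
            else False) (zip ls sides)"
    using c4 by (auto simp: bisected_def Let_def at_least_iff marks_map len A_def B_def split: if_splits)
  have overlap3: "\<not> at_least (Suc (Suc (Suc 0))) (meet X Y)"
    if "marks X \<subseteq> N x" "marks Y \<subseteq> N y" "x \<noteq> y" "{x, y} \<subseteq> J \<union> K" for X Y x y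
  proof
    assume "at_least (Suc (Suc (Suc 0))) (meet X Y)"
    then have "3 \<le> card (marks X \<inter> marks Y)" by (simp add: at_least_iff marks_meet)
    also have "\<dots> \<le> card (N x \<inter> N y)" using that by (intro card_mono) (auto simp: finite_N)
    finally show False using two[of x y] that by auto
  qed
  have "\<not> at_least (Suc (Suc (Suc 0))) (meet A B)" using overlap3[OF mA mB] J by auto
  with bis obtain l E where lE: "(l, E) \<in> set (zip ls sides)"
     "if l = L1 then list_all (\<lambda>(k, F). if k = L0 then blocked A B (join E F) else True) (zip ls sides) else False"
    unfolding list_ex_iff by blast
  then have jE: "(L1, E) \<in> set (zip ls sides)"
     "\<And>F. (L0, F) \<in> set (zip ls sides) \<Longrightarrow> blocked A B (join E F)"
    by (auto simp: list_all_iff split: if_splits)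
  have lens: "length sides = 7" by (simp add: sides_def)
  have marks_sides: "marks (sides ! i) = {i, next7 i}" if "i < 7" for i
  proof -
    have "i \<in> {0, 1, 2, 3, 4, 5, 6}" using that by auto
    then show ?thesis
      by (elim insertE) (simp_all add: sides_def marks_Cons next7_def, simp_all add: numeral_eq_Suc insert_commute)
  qed
  from jE(1) obtain j where j: "j < 7" "ls ! j = L1" "E = sides ! j"
    by (auto simp: in_set_conv_nth lens len)
  \<comment> \<open>The partners of the four sides along \<open>a\<close> are all of
    \<open>K\<close>, so side \<open>j\<close> shares its partner with one of them.\<close>
  have "card (g ` F a) = 4"
    using J(3) fg(4) by (subst card_image) (auto simp: inj_on_def F_def)
  moreover have "g ` F a \<subseteq> K" using fg(2) by (auto simp: F_def)
  ultimately have "g ` F a = K" using finite_K assms(2) by (metis card_subset_eq)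
  then obtain i where i: "i < 7" "f i = a" "g i = g j" using fg(2)[OF j(1)] by (auto simp: F_def)
  have "(L0, sides ! i) \<in> set (zip ls sides)"
    using i by (auto simp: in_set_conv_nth lens len nth intro!: exI[of _ i])
  from jE(2)[OF this] have bl: "blocked A B (join E (sides ! i))" .
  have mC: "marks (join E (sides ! i)) \<subseteq> N (g j)"
    using marks_join[of E "sides ! i"] marks_sides i j fg(3)[of i] fg(3)[of j] by auto
  have gj: "g j \<in> K" "g j \<noteq> a" "g j \<noteq> b" using fg(2)[OF j(1)] J disj by auto
  from bl overlap3[OF mA mC] overlap3[OF mB mC] triad_False[OF _ mA mB mC] gj J
  show False by (simp add: blocked_def split: if_splits)
qed

theorem contradiction: False
proof -
  interpret swap: heptagon_incidence N K J by (rule swapped)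
  have "card J \<le> 6" using size by simp
  then have "card J \<in> {0, 1, 2, 3, 4, 5, 6}" by auto
  then consider "card J = 3 \<and> card K = 3" | "card J = 2 \<and> card K = 4" | "card J = 4 \<and> card K = 2"
    using size card_prod_ge by auto
  then show False
    using not_three_three not_two_four swap.not_two_four by cases auto
qed

end

section \<open>Brackets and the slack cone\<close>

definition brk :: "real^3 \<Rightarrow> real^3 \<Rightarrow> real^3 \<Rightarrow> real" where
  "brk a b c = cross3 a b \<bullet> c"

lemma brk_rotate: "brk b c a = brk a b c"
  by (simp add: brk_def cross3_simps)

lemma brk_swap: "brk b a c = - brk a b c" "brk a c b = - brk a b c"
  by (simp_all add: brk_def cross3_simps)

lemma brk_refl [simp]: "brk a a b = 0" "brk a b a = 0" "brk b a a = 0"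
  by (simp_all add: brk_def cross3_simps)

lemma brk_linear [simp]:
  "brk a b (x + y) = brk a b x + brk a b y" "brk a b (x - y) = brk a b x - brk a b y"
  "brk a b (r *\<^sub>R x) = r * brk a b x" "brk a b 0 = 0"
  by (simp_all add: brk_def inner_add_right inner_diff_right)

lemma brk_cramer: "brk a b c *\<^sub>R x = brk x b c *\<^sub>R a + brk a x c *\<^sub>R b + brk a b x *\<^sub>R c"
  by (simp add: brk_def cross3_simps forall_3)

text \<open>Up to the factor \<open>brk a b c\<close>, the cross products form the basis dual to
  \<open>a\<close>, \<open>b\<close>, \<open>c\<close>.\<close>

lemma brk_cramer_dual:
  "brk a b c *\<^sub>R x = (x \<bullet> a) *\<^sub>R cross3 b c + (x \<bullet> b) *\<^sub>R cross3 c a + (x \<bullet> c) *\<^sub>R cross3 a b"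
  by (simp add: brk_def cross3_simps forall_3)

lemma brk_eq_0_orthogonal:
  assumes "w \<noteq> 0" "w \<bullet> a = 0" "w \<bullet> b = 0" "w \<bullet> c = 0"
  shows "brk a b c = 0"
  using brk_cramer_dual[of a b c w] assms by simp

lemma brk_eq_0_dependent:
  assumes "\<alpha> *\<^sub>R a + \<beta> *\<^sub>R b + \<gamma> *\<^sub>R c = 0" "\<alpha> \<noteq> 0"
  shows "brk a b c = 0"
proof -
  have "\<alpha> * brk a b c = brk b c (\<alpha> *\<^sub>R a + \<beta> *\<^sub>R b + \<gamma> *\<^sub>R c)"
    by (simp add: brk_rotate)
  then show ?thesis using assms by simp
qed

text \<open>The linear relation among four vectors of three-space. For vertices in cyclic order its
  signs alternate, which locates the crossing point of the two diagonals.\<close>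

lemma brk_exchange:
  "brk x w y *\<^sub>R u - brk u w y *\<^sub>R x + brk u x y *\<^sub>R w - brk u x w *\<^sub>R y = 0"
  by (simp add: brk_def cross3_simps forall_3)

locale oriented_heptagon =
  fixes v :: "nat \<Rightarrow> real^3"
  assumes orient: "\<And>i j k. i < j \<Longrightarrow> j < k \<Longrightarrow> k < 7 \<Longrightarrow> 0 < brk (v i) (v j) (v k)"
begin

lemma brk_nonzero:
  assumes "i < 7" "j < 7" "k < 7" "i \<noteq> j" "i \<noteq> k" "j \<noteq> k"
  shows "brk (v i) (v j) (v k) \<noteq> 0"
proof -
  have r: "brk (v j) (v k) (v i) = brk (v i) (v j) (v k)" "brk (v k) (v i) (v j) = brk (v i) (v j) (v k)"
    "brk (v i) (v k) (v j) = - brk (v i) (v j) (v k)" "brk (v k) (v j) (v i) = - brk (v i) (v j) (v k)"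
    "brk (v j) (v i) (v k) = - brk (v i) (v j) (v k)"
    by (metis brk_rotate brk_swap)+
  consider "i < j" "j < k" | "i < k" "k < j" | "j < i" "i < k" | "j < k" "k < i" | "k < i" "i < j" | "k < j" "j < i"
    using assms by linarith
  then show ?thesis
  proof cases
    case 1 with orient[of i j k] assms show ?thesis by simp
  next
    case 2 with orient[of i k j] assms r show ?thesis by simp
  next
    case 3 with orient[of j i k] assms r show ?thesis by simp
  next
    case 4 with orient[of j k i] assms r show ?thesis by simp
  next
    case 5 with orient[of k i j] assms r show ?thesis by simp
  next
    case 6 with orient[of k j i] assms r show ?thesis by simp
  qed
qed

definition side :: "nat \<Rightarrow> real^3 \<Rightarrow> real" where
  "side i = brk (v i) (v (next7 i))"

lemma next7: "i < 7 \<Longrightarrow> next7 i < 7" "i < 7 \<Longrightarrow> next7 i \<noteq> i"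
  by (auto simp: next7_def)

lemma side_pos: "i < 7 \<Longrightarrow> k < 7 \<Longrightarrow> k \<noteq> i \<Longrightarrow> k \<noteq> next7 i \<Longrightarrow> 0 < side i (v k)"
proof -
  assume k: "i < 7" "k < 7" "k \<noteq> i" "k \<noteq> next7 i"
  consider "i = 6" "0 < k" "k < 6" | "i < 6" "Suc i < k" | "i < 6" "k < i"
    using k by (fastforce simp: next7_def split: if_splits)
  then show "0 < side i (v k)"
  proof cases
    case 1
    then have "side i (v k) = brk (v 0) (v k) (v 6)" by (simp add: side_def next7_def) (metis brk_rotate)
    then show ?thesis using orient[of 0 k 6] 1 by simp
  next
    case 2
    then show ?thesis using orient[of i "Suc i" k] k by (simp add: side_def next7_def)
  next
    case 3
    then have "side i (v k) = brk (v k) (v i) (v (Suc i))" by (simp add: side_def next7_def) (metis brk_rotate)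
    then show ?thesis using orient[of k i "Suc i"] 3 by simp
  qed
qed

lemma side_ends [simp]: "side i (v i) = 0" "side i (v (next7 i)) = 0"
  by (auto simp: side_def)

lemma side_nonneg: "i < 7 \<Longrightarrow> k < 7 \<Longrightarrow> 0 \<le> side i (v k)"
  using side_pos[of i k] by (cases "k = i \<or> k = next7 i") (auto simp: less_imp_le)

lemma side_linear [simp]:
  "side i (x + y) = side i x + side i y" "side i (x - y) = side i x - side i y"
  "side i (r *\<^sub>R x) = r * side i x" "side i 0 = 0"
  by (simp_all add: side_def)

lemma other_index: "\<exists>k<7. k \<noteq> i \<and> k \<noteq> j" for i j :: nat
proof -
  have "card {i, j} < card {..<7::nat}" by (rule le_less_trans[OF card_insert_le_m1]) auto
  then have "\<not> {..<7} \<subseteq> {i, j}" by (meson card_mono finite.emptyI finite.insertI leD)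
  then show ?thesis by auto
qed

lemma v_nonzero: "i < 7 \<Longrightarrow> v i \<noteq> 0"
proof
  assume i: "i < 7" "v i = 0"
  obtain j where j: "j < 7" "j \<noteq> i" using other_index by blast
  obtain k where k: "k < 7" "k \<noteq> i" "k \<noteq> j" using other_index by blast
  show False using brk_nonzero[of i j k] i j k by (simp add: brk_def)
qed

lemma v_independent:
  assumes "\<alpha> *\<^sub>R v i + \<beta> *\<^sub>R v j = 0" "i < 7" "j < 7" "i \<noteq> j"
  shows "\<alpha> = 0 \<and> \<beta> = 0"
proof -
  obtain k where k: "k < 7" "k \<noteq> i" "k \<noteq> j" using other_index by blast
  have "brk (v j) (v k) (\<alpha> *\<^sub>R v i + \<beta> *\<^sub>R v j) = 0" "brk (v k) (v i) (\<alpha> *\<^sub>R v i + \<beta> *\<^sub>R v j) = 0"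
    using assms(1) by (simp_all del: brk_linear add: brk_linear(4))
  then have "\<alpha> * brk (v j) (v k) (v i) = 0" "\<beta> * brk (v k) (v i) (v j) = 0"
    by simp_all
  then show ?thesis using brk_nonzero[of j k i] brk_nonzero[of k i j] assms k by auto
qed

lemma v_not_parallel: "v i = t *\<^sub>R v j \<Longrightarrow> i < 7 \<Longrightarrow> j < 7 \<Longrightarrow> i = j"
  using v_independent[of 1 i "- t" j] by auto

text \<open>In the dual expansion at \<open>v i\<close>, \<open>v j\<close> and any third vertex
  only one term survives: the line through the two vertices.\<close>

lemma vanish_two:
  assumes "w \<bullet> v i = 0" "w \<bullet> v j = 0" "i < 7" "j < 7" "i \<noteq> j"
  shows "\<exists>t. w = t *\<^sub>R cross3 (v i) (v j)"
proof -
  obtain k where k: "k < 7" "k \<noteq> i" "k \<noteq> j" using other_index by blast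
  have nz: "brk (v i) (v j) (v k) \<noteq> 0" using brk_nonzero assms k by auto
  have "brk (v i) (v j) (v k) *\<^sub>R w = (w \<bullet> v k) *\<^sub>R cross3 (v i) (v j)"
    using brk_cramer_dual[of "v i" "v j" "v k" w] assms by simp
  then have "w = ((w \<bullet> v k) / brk (v i) (v j) (v k)) *\<^sub>R cross3 (v i) (v j)"
    using nz by (metis (no_types, lifting) divideR_right divide_inverse_commute scaleR_scaleR)
  then show ?thesis by blast
qed

lemma vanish_three:
  assumes "w \<bullet> v i = 0" "w \<bullet> v j = 0" "w \<bullet> v k = 0" "i < 7" "j < 7" "k < 7" "i \<noteq> j" "i \<noteq> k" "j \<noteq> k"
  shows "w = 0"
  using brk_cramer_dual[of "v i" "v j" "v k" w] assms brk_nonzero[of i j k] by auto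

end

text \<open>\<open>U \<inter> \<real>\<^sup>n\<^sub>\<ge>\<^sub>0\<close> is the cone over the extension in slack coordinates, \<open>M\<close> is the projection, and \<open>q i\<close>
  lies over vertex \<open>i\<close>. The assumption \<open>extreme\<close> says that all extreme rays lie over vertices.\<close>

locale lifted_heptagon = oriented_heptagon v
  for v :: "nat \<Rightarrow> real^3" +
  fixes U :: "(real^'n) set" and M :: "real^'n \<Rightarrow> real^3" and q :: "nat \<Rightarrow> real^'n"
  assumes U: "subspace U" and M: "linear M" and card_n: "CARD('n) \<le> 6"
    and q: "\<And>i. i < 7 \<Longrightarrow> q i \<in> U" "\<And>i j. i < 7 \<Longrightarrow> 0 \<le> q i $ j" "\<And>i. i < 7 \<Longrightarrow> M (q i) = v i"
    and U_span: "U \<subseteq> span {s \<in> U. \<forall>j. 0 \<le> s $ j}"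
    and side_M: "\<And>i s. i < 7 \<Longrightarrow> s \<in> U \<Longrightarrow> \<forall>j. 0 \<le> s $ j \<Longrightarrow> 0 \<le> side i (M s)"
    and pointed: "\<And>s. s \<in> U \<Longrightarrow> \<forall>j. 0 \<le> s $ j \<Longrightarrow> M s = 0 \<Longrightarrow> s = 0"
    and extreme: "\<And>s. s \<in> U \<Longrightarrow> \<forall>j. 0 \<le> s $ j \<Longrightarrow> s \<noteq> 0 \<Longrightarrow>
        (\<And>s'. s' \<in> U \<Longrightarrow> \<forall>j. 0 \<le> s' $ j \<Longrightarrow> \<forall>j. s $ j = 0 \<longrightarrow> s' $ j = 0 \<Longrightarrow> \<exists>t. s' = t *\<^sub>R s) \<Longrightarrow>
        \<exists>i<7. \<exists>t>0. M s = t *\<^sub>R v i"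
    and no_concurrent: "\<And>i1 i2 i3 i4 i5 i6. {i1, i2, i3, i4, i5, i6} \<subseteq> {..<7} \<Longrightarrow>
        distinct [i1, i2, i3, i4, i5, i6] \<Longrightarrow>
        brk (cross3 (v i1) (v i2)) (cross3 (v i3) (v i4)) (cross3 (v i5) (v i6)) \<noteq> 0"
    and no_collinear: "\<And>u1 u2 u3 u4 u5 u6 u7. {u1, u2, u3, u4, u5, u6, u7} \<subseteq> {..<7} \<Longrightarrow>
        distinct [u1, u2, u3, u4, u5, u6, u7] \<Longrightarrow>
        brk (cross3 (cross3 (v u1) (v u2)) (cross3 (v u3) (v u4)))
            (cross3 (cross3 (v u2) (v u5)) (cross3 (v u4) (v u6)))
            (cross3 (cross3 (v u3) (v u7)) (cross3 (v u1) (v u5))) \<noteq> 0"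
begin

definition C :: "(real^'n) set" where
  "C = {s \<in> U. \<forall>j. 0 \<le> s $ j}"

lemma C_I: "s \<in> U \<Longrightarrow> (\<And>j. 0 \<le> s $ j) \<Longrightarrow> s \<in> C"
  by (simp add: C_def)

lemma C_D: "s \<in> C \<Longrightarrow> s \<in> U" "s \<in> C \<Longrightarrow> 0 \<le> s $ j"
  by (auto simp: C_def)

lemma q_C: "i < 7 \<Longrightarrow> q i \<in> C"
  using q by (auto simp: C_def)

lemma C_add: "s \<in> C \<Longrightarrow> t \<in> C \<Longrightarrow> s + t \<in> C"
  using U by (auto simp: C_def subspace_add)

lemma C_scale: "s \<in> C \<Longrightarrow> 0 \<le> r \<Longrightarrow> r *\<^sub>R s \<in> C"
  using U by (auto simp: C_def subspace_scale)

lemmas M_simps [simp] = linear_add[OF M] linear_diff[OF M] linear_scale[OF M] linear_0[OF M]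

text \<open>Subtracting from \<open>s\<close> the largest admissible multiple of \<open>s'\<close>.\<close>

lemma reduce_support:
  assumes "s \<in> C" "s' \<in> C" "s' \<noteq> 0" "\<And>j. s $ j = 0 \<Longrightarrow> s' $ j = 0"
  obtains r where "0 < r" "s - r *\<^sub>R s' \<in> C"
    "{j. (s - r *\<^sub>R s') $ j \<noteq> 0} \<subset> {j. s $ j \<noteq> 0}"
proof -
  define X where "X = {j. s' $ j \<noteq> 0}"
  have "X \<noteq> {}" using assms(3) by (auto simp: X_def vec_eq_iff)
  define r where "r = Min ((\<lambda>j. s $ j / s' $ j) ` X)"
  have pos: "0 < s' $ j" "0 < s $ j" if "j \<in> X" for j
    using that assms C_D(2)[OF assms(1), of j] C_D(2)[OF assms(2), of j] by (auto simp: X_def less_le)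
  have "r \<in> (\<lambda>j. s $ j / s' $ j) ` X" unfolding r_def using \<open>X \<noteq> {}\<close> by (intro Min_in) auto
  then obtain k where k: "k \<in> X" "r = s $ k / s' $ k" by auto
  then have "0 < r" using pos by auto
  have le: "r * s' $ j \<le> s $ j" for j
  proof (cases "j \<in> X")
    case True
    then have "r \<le> s $ j / s' $ j" unfolding r_def by (intro Min_le) auto
    then show ?thesis using pos[OF True] by (simp add: pos_le_divide_eq)
  qed (use C_D(2)[OF assms(1)] in \<open>auto simp: X_def\<close>)
  show ?thesis
  proof
    show "0 < r" by fact
    show "s - r *\<^sub>R s' \<in> C"
      using assms U le by (auto simp: C_def subspace_diff subspace_scale)
    have "(s - r *\<^sub>R s') $ k = 0" "s $ k \<noteq> 0" using k pos[OF k(1)] by auto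
    then show "{j. (s - r *\<^sub>R s') $ j \<noteq> 0} \<subset> {j. s $ j \<noteq> 0}" using assms(4) by auto
  qed
qed

text \<open>These are the generators of the extreme rays of \<open>C\<close>: the face on which the
  zero coordinates of \<open>s\<close> vanish is a single ray.\<close>

definition minimal :: "real^'n \<Rightarrow> bool" where
  "minimal s \<longleftrightarrow> s \<in> C \<and> s \<noteq> 0 \<and> (\<forall>s'\<in>C. (\<forall>j. s $ j = 0 \<longrightarrow> s' $ j = 0) \<longrightarrow> (\<exists>t. s' = t *\<^sub>R s))"

lemma minimal_vertex: "minimal s \<Longrightarrow> \<exists>i<7. \<exists>t>0. M s = t *\<^sub>R v i"
  using extreme[of s] by (auto simp: minimal_def C_def)

text \<open>A witness against minimality either has smaller support already or loses a coordinate
  when a multiple of \<open>s\<close> is subtracted from it. Subtracting a multiple of the resulting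
  vector from \<open>s\<close> then shrinks the support of \<open>s\<close> as well.\<close>

lemma split_support:
  assumes "s \<in> C" "s \<noteq> 0" "\<not> minimal s"
  obtains a b where "a \<in> C" "b \<in> C" "s = a + b" "a \<noteq> 0"
    "{j. a $ j \<noteq> 0} \<subset> {j. s $ j \<noteq> 0}" "{j. b $ j \<noteq> 0} \<subset> {j. s $ j \<noteq> 0}"
proof -
  from assms obtain s' where s': "s' \<in> C" "\<And>j. s $ j = 0 \<Longrightarrow> s' $ j = 0" "\<And>t. s' \<noteq> t *\<^sub>R s"
    by (auto simp: minimal_def)
  have "s' \<noteq> 0" using s'(3)[of 0] by auto
  obtain s'' where s'': "s'' \<in> C" "s'' \<noteq> 0" "{j. s'' $ j \<noteq> 0} \<subset> {j. s $ j \<noteq> 0}"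
  proof (cases "{j. s' $ j \<noteq> 0} \<subset> {j. s $ j \<noteq> 0}")
    case True
    with s' \<open>s' \<noteq> 0\<close> that show ?thesis by blast
  next
    case False
    then have eq: "{j. s' $ j \<noteq> 0} = {j. s $ j \<noteq> 0}" using s'(2) by auto
    then have imp: "s' $ j = 0 \<Longrightarrow> s $ j = 0" for j by auto
    obtain r where "0 < r" "s' - r *\<^sub>R s \<in> C" "{j. (s' - r *\<^sub>R s) $ j \<noteq> 0} \<subset> {j. s' $ j \<noteq> 0}"
      by (rule reduce_support[OF s'(1) assms(1,2) imp])
    then show ?thesis using that[of "s' - r *\<^sub>R s"] eq s'(3)[of r] by auto
  qed
  then have imp: "\<And>j. s $ j = 0 \<Longrightarrow> s'' $ j = 0" by auto
  obtain r where r: "0 < r" "s - r *\<^sub>R s'' \<in> C"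
     "{j. (s - r *\<^sub>R s'') $ j \<noteq> 0} \<subset> {j. s $ j \<noteq> 0}"
    by (rule reduce_support[OF assms(1) s''(1,2) imp])
  show ?thesis
    by (rule that[of "r *\<^sub>R s''" "s - r *\<^sub>R s''"]) (use r s'' C_scale in auto)
qed

lemma side_sum_0:
  assumes "a \<in> C" "b \<in> C" "i < 7" "side i (M (a + b)) = 0"
  shows "side i (M a) = 0" "side i (M b) = 0"
  using side_M[of i a] side_M[of i b] assms by (auto simp: C_def)

text \<open>Splitting ends because supports shrink. A side functional is nonnegative on the cone, so
  if it vanishes on a sum it vanishes on both summands.\<close>

lemma exists_minimal:
  assumes "s \<in> C" "s \<noteq> 0"
  shows "\<exists>s'. minimal s' \<and> (\<forall>i<7. side i (M s) = 0 \<longrightarrow> side i (M s') = 0)"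
  using assms
proof (induction "card {j. s $ j \<noteq> 0}" arbitrary: s rule: less_induct)
  case less
  show ?case
  proof (cases "minimal s")
    case False
    obtain a b where ab: "a \<in> C" "b \<in> C" "s = a + b" "a \<noteq> 0"
      "{j. a $ j \<noteq> 0} \<subset> {j. s $ j \<noteq> 0}" "{j. b $ j \<noteq> 0} \<subset> {j. s $ j \<noteq> 0}"
      by (rule split_support[OF less.prems False])
    have "card {j. a $ j \<noteq> 0} < card {j. s $ j \<noteq> 0}" by (rule psubset_card_mono) (use ab in auto)
    from less.hyps[OF this ab(1,4)] show ?thesis using side_sum_0 ab by blast
  qed auto
qed

lemma vertex_minimal:
  assumes "i < 7"
  shows "\<exists>s t. minimal s \<and> 0 < t \<and> M s = t *\<^sub>R v i"
proof -
  have "q i \<noteq> 0" using q[OF assms] v_nonzero[OF assms] by auto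
  from exists_minimal[OF q_C[OF assms] this] obtain s where
    s: "minimal s" "\<And>k. k < 7 \<Longrightarrow> side k (v i) = 0 \<Longrightarrow> side k (M s) = 0" using q(3)[OF assms] by auto
  obtain k t where k: "k < 7" "0 < t" "M s = t *\<^sub>R v k" using minimal_vertex[OF s(1)] by blast
  \<comment> \<open>Side \<open>h\<close> precedes side \<open>i\<close>; vertex \<open>i\<close> is
    the only vertex on both.\<close>
  define h where "h = (if i = 0 then 6 else i - 1)"
  have h: "h < 7" "next7 h = i" using assms by (auto simp: h_def next7_def)
  have "side i (v k) = 0" "side h (v k) = 0"
    using s(2)[OF assms] s(2)[OF h(1)] h(2) side_ends[of h] side_ends[of i] k by auto
  then have "k = i \<or> k = next7 i" "k = h \<or> k = i"
    using side_pos[OF assms k(1)] side_pos[OF h(1) k(1)] h(2) by auto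
  moreover have "h \<noteq> next7 i" using assms by (auto simp: h_def next7_def)
  ultimately have "k = i" by auto
  with k s show ?thesis by blast
qed

end

section \<open>Slack cones in a hyperplane\<close>

text \<open>Here \<open>J\<close> and \<open>K\<close> index the positive and negative entries of
  the normal vector, and \<open>S\<close> holds the vertices under coordinate axes. The difference
  \<open>a j1 - a j2\<close> of two rows is the same in every column, which drives all arguments
  below.\<close>

locale heptagon_grid = oriented_heptagon v
  for v :: "nat \<Rightarrow> real^3" +
  fixes S :: "nat set" and J K :: "'a set" and a b :: "'a \<Rightarrow> real^3" and \<phi> :: "'a \<Rightarrow> 'a \<Rightarrow> nat" and t :: "'a \<Rightarrow> 'a \<Rightarrow> real"
  assumes finite_S: "finite S" and finite_J: "finite J" and finite_K: "finite K"
    and size: "card S + card J + card K \<le> 6"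
    and cover: "{..<7} \<subseteq> S \<union> (\<lambda>(j, k). \<phi> j k) ` (J \<times> K)"
    and \<phi>: "\<And>j k. j \<in> J \<Longrightarrow> k \<in> K \<Longrightarrow> \<phi> j k < 7" "\<And>j k. j \<in> J \<Longrightarrow> k \<in> K \<Longrightarrow> 0 < t j k"
      "\<And>j k. j \<in> J \<Longrightarrow> k \<in> K \<Longrightarrow> a j + b k = t j k *\<^sub>R v (\<phi> j k)"
    and no_concurrent: "\<And>i1 i2 i3 i4 i5 i6. {i1, i2, i3, i4, i5, i6} \<subseteq> {..<7} \<Longrightarrow>
        distinct [i1, i2, i3, i4, i5, i6] \<Longrightarrow>
        brk (cross3 (v i1) (v i2)) (cross3 (v i3) (v i4)) (cross3 (v i5) (v i6)) \<noteq> 0"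
begin

lemma transposed: "heptagon_grid v S K J b a (\<lambda>k j. \<phi> j k) (\<lambda>k j. t j k)"
proof
  have "(\<lambda>(k, j). \<phi> j k) ` (K \<times> J) = (\<lambda>(j, k). \<phi> j k) ` (J \<times> K)" by (auto simp: image_iff)
  then show "{..<7} \<subseteq> S \<union> (\<lambda>(k, j). \<phi> j k) ` (K \<times> J)" using cover by simp
  show "card S + card K + card J \<le> 6" using size by simp
  show "b k + a j = t j k *\<^sub>R v (\<phi> j k)" if "k \<in> K" "j \<in> J" for j k
    using \<phi>(3)[OF that(2,1)] by (simp add: add.commute)
qed (use finite_S finite_J finite_K \<phi> no_concurrent in auto)

lemma dependent_three:
  assumes "\<alpha> *\<^sub>R v x + \<beta> *\<^sub>R v y + \<gamma> *\<^sub>R v z = 0" "\<alpha> \<noteq> 0" "x < 7" "y < 7" "z < 7"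
  shows "x = y \<or> x = z \<or> y = z"
  using brk_eq_0_dependent[OF assms(1,2)] brk_nonzero assms by blast

text \<open>If two rows agree in one column, their difference is a multiple of that vertex
  \<open>x\<close>. In every column the two entries and \<open>x\<close> are then dependent, so
  together the rows yield at most one new vertex per column, too few to reach seven.\<close>

lemma row_injective:
  assumes "j1 \<in> J" "j2 \<in> J" "j1 \<noteq> j2" "k \<in> K"
  shows "\<phi> j1 k \<noteq> \<phi> j2 k"
proof
  assume eq: "\<phi> j1 k = \<phi> j2 k"
  define x where "x = \<phi> j1 k"
  \<comment> \<open>One vertex per column that, together with \<open>x\<close>, accounts for both
    rows; column \<open>k\<close> itself accounts for \<open>x\<close>.\<close>
  define h where "h k' = (if k' = k then x else if \<phi> j1 k' = x then \<phi> j2 k' else \<phi> j1 k')" for k'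
  have pair: "\<phi> j1 k' \<in> {x, h k'} \<and> \<phi> j2 k' \<in> {x, h k'}" if k': "k' \<in> K" for k'
  proof -
    define y z where "y = \<phi> j1 k'" and "z = \<phi> j2 k'"
    have "t j1 k' *\<^sub>R v y - t j2 k' *\<^sub>R v z = t j1 k *\<^sub>R v x - t j2 k *\<^sub>R v x"
      using \<phi>(3)[OF assms(1) k'] \<phi>(3)[OF assms(2) k'] \<phi>(3)[OF assms(1,4)] \<phi>(3)[OF assms(2,4)]
      unfolding x_def y_def z_def eq by (metis add_diff_cancel_right)
    then have "t j1 k' *\<^sub>R v y + (- t j2 k') *\<^sub>R v z + (t j2 k - t j1 k) *\<^sub>R v x = 0"
      by (simp add: algebra_simps)
    from dependent_three[OF this] have "y = z \<or> y = x \<or> z = x"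
      using \<phi>(1,2) assms k' by (metis x_def y_def z_def less_irrefl)
    then show ?thesis using eq by (auto simp: h_def x_def y_def z_def)
  qed
  have x: "x = h k" by (simp add: h_def)
  have "{..<7} \<subseteq> S \<union> h ` K \<union> (\<lambda>(j, k). \<phi> j k) ` ((J - {j1, j2}) \<times> K)"
  proof
    fix i :: nat assume "i \<in> {..<7}"
    then consider "i \<in> S" | j k' where "j \<in> J" "k' \<in> K" "i = \<phi> j k'" using cover by auto
    then show "i \<in> S \<union> h ` K \<union> (\<lambda>(j, k). \<phi> j k) ` ((J - {j1, j2}) \<times> K)"
    proof cases
      case (2 j k')
      show ?thesis
      proof (cases "j = j1 \<or> j = j2")
        case True
        then have "i = h k \<or> i = h k'" using pair[OF 2(2)] 2(3) x by auto
        then show ?thesis using 2 assms by auto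
      qed (use 2 in auto)
    qed auto
  qed
  then have "card {..<7::nat} \<le> card (S \<union> h ` K \<union> (\<lambda>(j, k). \<phi> j k) ` ((J - {j1, j2}) \<times> K))"
    by (intro card_mono) (auto simp: finite_S finite_J finite_K)
  also have "\<dots> \<le> card S + card (h ` K) + card ((\<lambda>(j, k). \<phi> j k) ` ((J - {j1, j2}) \<times> K))"
    by (meson card_Un_le add_le_mono1 le_trans)
  also have "\<dots> \<le> card S + card K + card ((J - {j1, j2}) \<times> K)"
    by (intro add_mono card_image_le) (auto simp: finite_J finite_K)
  also have "card ((J - {j1, j2}) \<times> K) = (card J - 2) * card K"
    using assms finite_J by (simp add: card_cartesian_product card_Diff_subset numeral_2_eq_2)
  finally have le: "7 \<le> card S + card K + (card J - 2) * card K" by simp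
  have "2 \<le> card J" using assms finite_J by (metis card_2_iff card_mono empty_subsetI insert_subset)
  then obtain p where p: "card J = p + 2" by (metis le_add_diff_inverse2)
  have "p \<in> {0, 1, 2, 3, 4}" using p size by auto
  then show False using le p size by auto
qed

text \<open>The two diagonals of a two-by-two subgrid have equal sums. A repeated vertex on one
  diagonal thus depends positively on the two vertices of the other, which must coincide and then be
  parallel to it.\<close>

lemma injective:
  assumes "j1 \<in> J" "j2 \<in> J" "k1 \<in> K" "k2 \<in> K" "\<phi> j1 k1 = \<phi> j2 k2"
  shows "j1 = j2 \<and> k1 = k2"
proof (rule ccontr)
  assume neg: "\<not> (j1 = j2 \<and> k1 = k2)"
  interpret tr: heptagon_grid v S K J b a "\<lambda>k j. \<phi> j k" "\<lambda>k j. t j k" by (rule transposed)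
  have ne: "j1 \<noteq> j2" "k1 \<noteq> k2"
    using neg row_injective[OF assms(1,2) _ assms(3)] tr.row_injective[OF assms(3,4) _ assms(1)] assms(5) by auto
  define x y z where "x = \<phi> j1 k1" and "y = \<phi> j1 k2" and "z = \<phi> j2 k1"
  have xy: "x \<noteq> y" "x \<noteq> z"
    using row_injective[OF assms(1,2) ne(1) assms(3)] tr.row_injective[OF assms(3,4) ne(2) assms(1)]
    by (auto simp: x_def y_def z_def)
  have "t j1 k2 *\<^sub>R v y + t j2 k1 *\<^sub>R v z = t j1 k1 *\<^sub>R v x + t j2 k2 *\<^sub>R v x"
  proof -
    have "t j1 k1 *\<^sub>R v x = a j1 + b k1" "t j2 k2 *\<^sub>R v x = a j2 + b k2"
      "t j1 k2 *\<^sub>R v y = a j1 + b k2" "t j2 k1 *\<^sub>R v z = a j2 + b k1"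
      using \<phi>(3) assms by (simp_all add: x_def y_def z_def)
    then show ?thesis by (simp add: algebra_simps)
  qed
  then have eq: "t j1 k2 *\<^sub>R v y + t j2 k1 *\<^sub>R v z + (- (t j1 k1 + t j2 k2)) *\<^sub>R v x = 0"
    by (simp add: algebra_simps)
  have pos: "0 < t j1 k2" "0 < t j2 k1" "x < 7" "y < 7" "z < 7"
    using \<phi>(1,2) assms by (auto simp: x_def y_def z_def)
  from dependent_three[OF eq] pos xy have "y = z" by auto
  then have "(t j1 k2 + t j2 k1) *\<^sub>R v y + (- (t j1 k1 + t j2 k2)) *\<^sub>R v x = 0"
    using eq by (simp add: algebra_simps)
  then show False using v_independent[of _ y _ x] pos xy by (metis add_pos_pos less_irrefl)
qed

text \<open>The common row difference \<open>w\<close> is a nonzero vector on each of the three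
  lines joining the two entries of a column, so these lines concur.\<close>

lemma not_two_three:
  assumes "card J = 2" "card K = 3"
  shows False
proof -
  obtain j1 j2 where j: "J = {j1, j2}" "j1 \<noteq> j2" using assms(1) by (meson card_2_iff)
  obtain k1 k2 k3 where k: "K = {k1, k2, k3}" "k1 \<noteq> k2" "k1 \<noteq> k3" "k2 \<noteq> k3" using assms(2) by (metis card_3_iff)
  define w where "w = a j1 - a j2"
  have w: "w = t j1 k *\<^sub>R v (\<phi> j1 k) - t j2 k *\<^sub>R v (\<phi> j2 k)" if "k \<in> K" for k
    using \<phi>(3)[of j1 k] \<phi>(3)[of j2 k] that j unfolding w_def by (metis add_diff_cancel_right insertI1 insertI2)
  have orth: "w \<bullet> cross3 (v (\<phi> j1 k)) (v (\<phi> j2 k)) = 0" if "k \<in> K" for k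
    unfolding w[OF that] by (simp add: inner_diff_left dot_cross_self)
  have "w \<noteq> 0"
  proof
    assume "w = 0"
    then have "t j1 k1 *\<^sub>R v (\<phi> j1 k1) + (- t j2 k1) *\<^sub>R v (\<phi> j2 k1) = 0" using w[of k1] k by simp
    from v_independent[OF this] \<phi>(1,2)[of j1 k1] \<phi>(1,2)[of j2 k1] j k row_injective[of j1 j2 k1] show False by auto
  qed
  from brk_eq_0_orthogonal[OF this orth[of k1] orth[of k2] orth[of k3]] k
  have "brk (cross3 (v (\<phi> j1 k1)) (v (\<phi> j2 k1))) (cross3 (v (\<phi> j1 k2)) (v (\<phi> j2 k2)))
    (cross3 (v (\<phi> j1 k3)) (v (\<phi> j2 k3))) = 0" by auto
  moreover have "{\<phi> j1 k1, \<phi> j2 k1, \<phi> j1 k2, \<phi> j2 k2, \<phi> j1 k3, \<phi> j2 k3} \<subseteq> {..<7}"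
    using \<phi>(1) j k by simp
  moreover have "distinct [\<phi> j1 k1, \<phi> j2 k1, \<phi> j1 k2, \<phi> j2 k2, \<phi> j1 k3, \<phi> j2 k3]"
  proof -
    have iff: "\<phi> x y = \<phi> x' y' \<longleftrightarrow> x = x' \<and> y = y'" if "x \<in> J" "x' \<in> J" "y \<in> K" "y' \<in> K" for x y x' y'
      using injective that by blast
    have "j1 \<in> J" "j2 \<in> J" "k1 \<in> K" "k2 \<in> K" "k3 \<in> K" using j k by auto
    then show ?thesis using j(2) k(2-) by (simp add: iff)
  qed
  ultimately show False using no_concurrent by blast
qed

theorem contradiction: False
proof -
  interpret tr: heptagon_grid v S K J b a "\<lambda>k j. \<phi> j k" "\<lambda>k j. t j k" by (rule transposed)
  have "card {..<7::nat} \<le> card (S \<union> (\<lambda>(j, k). \<phi> j k) ` (J \<times> K))"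
    using cover by (intro card_mono) (auto simp: finite_S finite_J finite_K)
  also have "\<dots> \<le> card S + card (J \<times> K)"
    by (rule order_trans[OF card_Un_le add_left_mono[OF card_image_le]]) (simp add: finite_J finite_K)
  finally have 7: "7 \<le> card S + card J * card K" by (simp add: card_cartesian_product)
  have "card (J \<times> K) \<le> card {..<7::nat}"
    by (rule card_inj_on_le[of "\<lambda>(j, k). \<phi> j k"]) (use injective \<phi>(1) in \<open>auto simp: inj_on_def\<close>)
  then have le: "card J * card K \<le> 7" by (simp add: card_cartesian_product)
  have "card J \<in> {0, 1, 2, 3, 4, 5, 6}" using size by auto
  \<comment> \<open>Injectivity bounds the grid by seven entries, which excludes 2 x 4 and 3 x 3;
    smaller products cannot make up for the bound on the sizes.\<close>
  then have "card J = 2 \<and> card K = 3 \<or> card J = 3 \<and> card K = 2"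
    using size 7 le by (auto; presburger)
  then show False using not_two_three tr.not_two_three by auto
qed

end

locale lifted_hyperplane = lifted_heptagon v U M q
  for v :: "nat \<Rightarrow> real^3" and U :: "(real^'n) set" and M q +
  fixes c :: "real^'n"
  assumes U_c: "U = {s. c \<bullet> s = 0}"
begin

definition gen :: "'n \<Rightarrow> 'n \<Rightarrow> real^'n" where
  "gen j k = (- c $ k) *\<^sub>R axis j 1 + (c $ j) *\<^sub>R axis k 1"

lemma inner_axis_1: "c \<bullet> axis j 1 = c $ j"
  by (simp add: inner_axis)

lemma minimal_axis:
  assumes "c $ j = 0"
  shows "minimal (axis j 1)"
  unfolding minimal_def
proof (intro conjI ballI impI)
  show "axis j 1 \<in> C"
  proof (rule C_I)
    show "axis j 1 \<in> U" using assms by (simp add: U_c inner_axis_1)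
  qed (simp add: axis_def)
  show "axis j 1 \<noteq> (0 :: real^'n)" by simp
  fix s' :: "real^'n" assume "\<forall>i. axis j 1 $ i = (0::real) \<longrightarrow> s' $ i = 0"
  then have "s' = (s' $ j) *\<^sub>R axis j 1" by (auto simp: vec_eq_iff axis_def)
  then show "\<exists>t. s' = t *\<^sub>R axis j 1" by blast
qed

lemma inner_two:
  fixes s :: "real^'n"
  assumes "\<And>i. i \<noteq> j \<Longrightarrow> i \<noteq> k \<Longrightarrow> s $ i = 0" "j \<noteq> k"
  shows "c \<bullet> s = c $ j * s $ j + c $ k * s $ k"
proof -
  have "c \<bullet> s = (\<Sum>i\<in>{j, k}. c $ i * s $ i)"
    unfolding inner_vec_def by (intro sum.mono_neutral_cong_right) (use assms in auto)
  then show ?thesis using assms(2) by simp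
qed

lemma minimal_gen:
  assumes "0 < c $ j" "c $ k < 0"
  shows "minimal (gen j k)"
  unfolding minimal_def
proof (intro conjI ballI impI)
  have "j \<noteq> k" using assms by auto
  have nth: "gen j k $ i = (if i = j then - c $ k else if i = k then c $ j else 0)" for i
    using \<open>j \<noteq> k\<close> by (auto simp: gen_def axis_def)
  show "gen j k \<in> C"
  proof (rule C_I)
    show "gen j k \<in> U" by (simp add: U_c gen_def inner_diff_right inner_add_right inner_axis_1)
  qed (use assms in \<open>simp add: nth\<close>)
  show "gen j k \<noteq> 0" using assms nth[of j] by auto
  fix s' assume s': "s' \<in> C" "\<forall>i. gen j k $ i = 0 \<longrightarrow> s' $ i = 0"
  then have z: "s' $ i = 0" if "i \<noteq> j" "i \<noteq> k" for i using that by (simp add: nth)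
  have "c $ j * s' $ j + c $ k * s' $ k = 0" using inner_two[OF z \<open>j \<noteq> k\<close>] C_D(1)[OF s'(1)] unfolding U_c by simp
  then have "s' $ k = (s' $ j / (- c $ k)) * c $ j" using assms by (simp add: field_simps)
  then have "s' = (s' $ j / (- c $ k)) *\<^sub>R gen j k" using z assms by (auto simp: vec_eq_iff nth)
  then show "\<exists>t. s' = t *\<^sub>R gen j k" by blast
qed

lemma minimal_multiple:
  assumes "minimal s" "g \<in> C" "g \<noteq> 0" "\<And>i. s $ i = 0 \<Longrightarrow> g $ i = 0"
  obtains r where "0 < r" "s = r *\<^sub>R g"
proof -
  from assms obtain u where u: "g = u *\<^sub>R s" by (auto simp: minimal_def)
  then have "u \<noteq> 0" using assms by auto
  obtain i where i: "g $ i \<noteq> 0" using assms(3) by (auto simp: vec_eq_iff)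
  have "0 \<le> g $ i" "0 \<le> s $ i" using assms C_D by (auto simp: minimal_def)
  moreover have "g $ i = u * s $ i" using u by simp
  ultimately have "0 < u" using i \<open>u \<noteq> 0\<close> by (metis less_le mult_zero_right zero_less_mult_pos2)
  then show ?thesis using u by (intro that[of "1 / u"]) auto
qed

text \<open>If the support avoids the zeros of \<open>c\<close>, the vanishing sum
  \<open>c \<bullet> s\<close> has a positive and a negative term. The support then contains that of
  a generator \<open>gen j k\<close>, to which \<open>s\<close> must be proportional.\<close>

lemma minimal_cases:
  assumes "minimal s"
  obtains j r where "c $ j = 0" "0 < r" "s = r *\<^sub>R axis j 1"
    | j k r where "0 < c $ j" "c $ k < 0" "0 < r" "s = r *\<^sub>R gen j k"
proof (cases "\<exists>j. c $ j = 0 \<and> s $ j \<noteq> 0")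
  case True
  then obtain j where j: "c $ j = 0" "s $ j \<noteq> 0" by auto
  obtain r where "0 < r" "s = r *\<^sub>R axis j 1"
    by (rule minimal_multiple[OF assms, of "axis j 1"])
      (use minimal_axis[OF j(1)] j in \<open>auto simp: minimal_def axis_def\<close>)
  then show ?thesis using that(1) j by blast
next
  case False
  have s: "s \<in> C" "s \<noteq> 0" using assms by (auto simp: minimal_def)
  have sum0: "(\<Sum>i\<in>UNIV. c $ i * s $ i) = 0" using C_D(1)[OF s(1)] unfolding U_c by (simp add: inner_vec_def)
  obtain i where i: "s $ i \<noteq> 0" "c $ i \<noteq> 0" using s False by (auto simp: vec_eq_iff)
  have nn: "0 \<le> s $ i" for i using s by (simp add: C_def)
  have "\<exists>j. 0 < c $ j * s $ j"
  proof (rule ccontr)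
    assume "\<not> ?thesis"
    then have "\<forall>j\<in>UNIV. - (c $ j * s $ j) = 0"
      using sum0 by (subst sum_nonneg_eq_0_iff[symmetric]) (auto simp: sum_negf not_less)
    then show False using i by auto
  qed
  then obtain j where j: "0 < c $ j" "0 < s $ j" using nn by (metis mult_le_0_iff not_le zero_less_mult_iff less_le)
  have "\<exists>j. c $ j * s $ j < 0"
  proof (rule ccontr)
    assume "\<not> ?thesis"
    then have "\<forall>j\<in>UNIV. c $ j * s $ j = 0"
      using sum0 by (subst sum_nonneg_eq_0_iff[symmetric]) (auto simp: not_less)
    then show False using i by auto
  qed
  then obtain k where k: "c $ k < 0" "0 < s $ k" using nn by (metis mult_less_0_iff not_le)
  have "j \<noteq> k" using j k by auto
  then have nth: "gen j k $ i = (if i = j then - c $ k else if i = k then c $ j else 0)" for i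
    by (auto simp: gen_def axis_def)
  obtain r where "0 < r" "s = r *\<^sub>R gen j k"
    by (rule minimal_multiple[OF assms, of "gen j k"])
      (use minimal_gen[OF j(1) k(1)] j k nth in \<open>auto simp: minimal_def split: if_splits\<close>)
  then show ?thesis using that(2) j k by blast
qed

theorem hyperplane_contradiction: False
proof -
  define J K Z where "J = {j. 0 < c $ j}" and "K = {j. c $ j < 0}" and "Z = {j. c $ j = 0}"
  have "\<exists>i u. i < 7 \<and> 0 < u \<and> M (gen j k) = u *\<^sub>R v i" if "j \<in> J" "k \<in> K" for j k
    using minimal_vertex[OF minimal_gen] that by (auto simp: J_def K_def)
  then obtain \<phi> u where gen: "\<And>j k. j \<in> J \<Longrightarrow> k \<in> K \<Longrightarrow> \<phi> j k < (7::nat) \<and> 0 < u j k \<and> M (gen j k) = u j k *\<^sub>R v (\<phi> j k)"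
    by metis
  have "\<exists>i u. i < 7 \<and> 0 < u \<and> M (axis j 1) = u *\<^sub>R v i" if "j \<in> Z" for j
    using minimal_vertex[OF minimal_axis] that by (auto simp: Z_def)
  then obtain \<psi> w where axis: "\<And>j. j \<in> Z \<Longrightarrow> \<psi> j < (7::nat) \<and> 0 < w j \<and> M (axis j 1) = w j *\<^sub>R v (\<psi> j)"
    by metis
  have "UNIV = Z \<union> J \<union> K" "Z \<inter> J = {}" "(Z \<union> J) \<inter> K = {}" by (auto simp: J_def K_def Z_def)
  then have card: "card Z + card J + card K \<le> 6"
    using card_n by (metis card_Un_disjoint finite)
  \<comment> \<open>Division of \<open>gen j k\<close> by \<open>c $ j * (- c $ k)\<close> separates
    the indices into one summand for \<open>j\<close> and one for \<open>k\<close>.\<close>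
  have "heptagon_grid v (\<psi> ` Z) J K (\<lambda>j. (1 / c $ j) *\<^sub>R M (axis j 1)) (\<lambda>k. (1 / (- c $ k)) *\<^sub>R M (axis k 1)) \<phi>
    (\<lambda>j k. u j k / (c $ j * (- c $ k)))"
  proof
    show "card (\<psi> ` Z) + card J + card K \<le> 6"
      using card card_image_le[of Z \<psi>] by simp
    show "{..<7} \<subseteq> \<psi> ` Z \<union> (\<lambda>(j, k). \<phi> j k) ` (J \<times> K)"
    proof
      fix i :: nat assume "i \<in> {..<7}"
      then have i: "i < 7" by simp
      obtain s r where s: "minimal s" "0 < r" "M s = r *\<^sub>R v i" using vertex_minimal[OF i] by blast
      have eq: "i = i'" if "r *\<^sub>R v i = r' *\<^sub>R v i'" "i' < 7" for r' i'
      proof (rule v_not_parallel[OF _ i that(2)])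
        show "v i = (r' / r) *\<^sub>R v i'" using that(1) s(2)
          by (metis (no_types, lifting) divide_inverse_commute divideR_right less_irrefl scaleR_scaleR)
      qed
      from s(1) show "i \<in> \<psi> ` Z \<union> (\<lambda>(j, k). \<phi> j k) ` (J \<times> K)"
      proof (cases rule: minimal_cases)
        case (1 j r')
        then have j: "j \<in> Z" by (simp add: Z_def)
        have "r *\<^sub>R v i = (r' * w j) *\<^sub>R v (\<psi> j)" using s(3) 1 axis[OF j] by simp
        then show ?thesis using eq axis[OF j] j by blast
      next
        case (2 j k r')
        then have j: "j \<in> J" "k \<in> K" by (simp_all add: J_def K_def)
        have "r *\<^sub>R v i = (r' * u j k) *\<^sub>R v (\<phi> j k)" using s(3) 2 gen[OF j] by simp
        then have "i = \<phi> j k" using eq gen[OF j] by blast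
        then show ?thesis using j by auto
      qed
    qed
    fix j k assume jk: "j \<in> J" "k \<in> K"
    then have c: "0 < c $ j" "c $ k < 0" by (auto simp: J_def K_def)
    have comb: "(1 / (\<alpha> * \<beta>)) *\<^sub>R (\<beta> *\<^sub>R x + \<alpha> *\<^sub>R y) = (1 / \<alpha>) *\<^sub>R x + (1 / \<beta>) *\<^sub>R y"
      if "\<alpha> \<noteq> 0" "\<beta> \<noteq> 0" for \<alpha> \<beta> and x y :: "real^3"
      using that by (simp add: scaleR_add_right)
    show "\<phi> j k < 7" using gen[OF jk] by simp
    have pos: "0 < c $ j * - c $ k" using c by (simp add: mult_pos_neg)
    then show "0 < u j k / (c $ j * - c $ k)" using gen[OF jk] by (intro divide_pos_pos) auto
    have "M (gen j k) = (- c $ k) *\<^sub>R M (axis j 1) + (c $ j) *\<^sub>R M (axis k 1)"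
      unfolding gen_def by (simp only: linear_add[OF M] linear_scale[OF M])
    then have "u j k *\<^sub>R v (\<phi> j k) = (- c $ k) *\<^sub>R M (axis j 1) + (c $ j) *\<^sub>R M (axis k 1)"
      using gen[OF jk] by simp
    then have "(1 / (c $ j * - c $ k)) *\<^sub>R (u j k *\<^sub>R v (\<phi> j k)) =
       (1 / (c $ j * - c $ k)) *\<^sub>R ((- c $ k) *\<^sub>R M (axis j 1) + (c $ j) *\<^sub>R M (axis k 1))" by simp
    then show "(1 / c $ j) *\<^sub>R M (axis j 1) + (1 / (- c $ k)) *\<^sub>R M (axis k 1) =
         (u j k / (c $ j * - c $ k)) *\<^sub>R v (\<phi> j k)"
      using comb[of "c $ j" "- c $ k"] c by simp
  qed (use no_concurrent in auto)
  then show False by (rule heptagon_grid.contradiction)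
qed

end

section \<open>Slack cones projecting with one-dimensional kernel\<close>

lemma small_step:
  fixes s d :: "real^'n"
  assumes "\<And>a. 0 \<le> s $ a" "\<And>a. 0 < d $ a \<Longrightarrow> 0 < s $ a"
  obtains z where "0 < z" "\<And>a. 0 \<le> (s - z *\<^sub>R d) $ a"
proof -
  define X where "X = {a. 0 < d $ a}"
  \<comment> \<open>Inserting 1 keeps the minimum meaningful when \<open>d\<close> has no positive
    entry.\<close>
  define z where "z = Min (insert 1 ((\<lambda>a. s $ a / d $ a) ` X))"
  have z: "0 < z" using assms(2) by (auto simp: z_def X_def)
  have "0 \<le> s $ a - z * d $ a" for a
  proof (cases "a \<in> X")
    case True
    then have "z \<le> s $ a / d $ a" unfolding z_def by (intro Min_le) auto
    then show ?thesis using True by (simp add: X_def pos_le_divide_eq)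
  next
    case False
    then have "z * d $ a \<le> 0" using z by (simp add: X_def mult_nonneg_nonpos)
    then show ?thesis using assms(1)[of a] by simp
  qed
  then show ?thesis using that[of z] z by simp
qed

text \<open>The vector \<kappa> may be 0; then the projection is injective on \<open>U\<close>,
  every coordinate lies in \<open>Z\<close>, and counting sides refutes this case.\<close>

locale lifted_line = lifted_heptagon v U M q
  for v :: "nat \<Rightarrow> real^3" and U :: "(real^'n) set" and M q +
  fixes \<kappa> :: "real^'n"
  assumes \<kappa>: "\<kappa> \<in> U" "M \<kappa> = 0"
    and kernel: "\<And>s. s \<in> U \<Longrightarrow> M s = 0 \<Longrightarrow> \<exists>z. s = z *\<^sub>R \<kappa>"
begin

definition "J = {a. 0 < \<kappa> $ a}"
definition "K = {a. \<kappa> $ a < 0}"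
definition "Z = {a. \<kappa> $ a = 0}"

lemma fibre: "s \<in> U \<Longrightarrow> s' \<in> U \<Longrightarrow> M s = M s' \<Longrightarrow> \<exists>z. s' = s + z *\<^sub>R \<kappa>"
  using kernel[of "s' - s"] U by (force simp: subspace_diff algebra_simps)

text \<open>A functional that kills \<kappa> is constant on the fibres of \<open>M\<close> in
  \<open>U\<close>, hence factors through \<open>M\<close>. Cramer's rule for \<open>v 0\<close>,
  \<open>v 1\<close>, \<open>v 2\<close> gives the vector explicitly.\<close>

lemma represent:
  assumes g: "linear g" and "g \<kappa> = 0"
  shows "\<exists>w. \<forall>s\<in>U. g s = w \<bullet> M s"
proof -
  define D where "D = brk (v 0) (v 1) (v 2)"
  have D: "D \<noteq> 0" using orient[of 0 1 2] by (simp add: D_def)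
  define w where "w = (1 / D) *\<^sub>R (g (q 0) *\<^sub>R cross3 (v 1) (v 2) + g (q 1) *\<^sub>R cross3 (v 2) (v 0) + g (q 2) *\<^sub>R cross3 (v 0) (v 1))"
  have "g s = w \<bullet> M s" if s: "s \<in> U" for s
  proof -
    let ?x = "M s"
    define s' where "s' = (1 / D) *\<^sub>R (brk (v 1) (v 2) ?x *\<^sub>R q 0 + brk (v 2) (v 0) ?x *\<^sub>R q 1 + brk (v 0) (v 1) ?x *\<^sub>R q 2)"
    have "s' \<in> U" unfolding s'_def using U q(1) by (intro subspace_scale subspace_add) auto
    have "M s' = (1 / D) *\<^sub>R (brk (v 1) (v 2) ?x *\<^sub>R v 0 + brk (v 2) (v 0) ?x *\<^sub>R v 1 + brk (v 0) (v 1) ?x *\<^sub>R v 2)"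
      by (simp add: s'_def q(3) del: brk_linear)
    also have "\<dots> = (1 / D) *\<^sub>R (D *\<^sub>R ?x)"
      unfolding D_def brk_cramer[of "v 0" "v 1" "v 2" ?x]
      by (simp only: brk_rotate[of "v 1" "v 2" ?x] brk_rotate[of "v 2" "v 0" ?x] brk_rotate[of ?x "v 2" "v 0"])
    finally have "M s' = M s" using D by simp
    from fibre[OF \<open>s' \<in> U\<close> s this] obtain z where "s = s' + z *\<^sub>R \<kappa>" by blast
    then have "g s = g s'" using assms by (simp add: linear_add linear_scale)
    also have "\<dots> = w \<bullet> ?x"
      by (simp add: s'_def w_def linear_add[OF g] linear_scale[OF g] inner_add_left brk_def algebra_simps)
    finally show ?thesis .
  qed
  then show ?thesis by blast
qed

text \<open>This combination of two coordinates kills \<kappa>, so it descends to the plane. Where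
  both coordinates vanish it vanishes too: a nonzero \<open>W a b\<close> is the line carrying the
  projection of the intersection of the two facet planes.\<close>

definition W :: "'n \<Rightarrow> 'n \<Rightarrow> real^3" where
  "W a b = (SOME w. \<forall>s\<in>U. \<kappa> $ b * s $ a - \<kappa> $ a * s $ b = w \<bullet> M s)"

lemma W: "s \<in> U \<Longrightarrow> W a b \<bullet> M s = \<kappa> $ b * s $ a - \<kappa> $ a * s $ b"
proof -
  have "linear (\<lambda>s. \<kappa> $ b * s $ a - \<kappa> $ a * s $ b)"
    by (auto simp: linear_iff algebra_simps)
  from represent[OF this] have "\<exists>w. \<forall>s\<in>U. \<kappa> $ b * s $ a - \<kappa> $ a * s $ b = w \<bullet> M s"
    by simp
  from someI_ex[OF this] show "s \<in> U \<Longrightarrow> W a b \<bullet> M s = \<kappa> $ b * s $ a - \<kappa> $ a * s $ b"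
    by (simp add: W_def)
qed

lemma W_v: "i < 7 \<Longrightarrow> W a b \<bullet> v i = \<kappa> $ b * q i $ a - \<kappa> $ a * q i $ b"
  using W[OF q(1)] q(3) by metis

lemma W_zero: "i < 7 \<Longrightarrow> q i $ a = 0 \<Longrightarrow> q i $ b = 0 \<Longrightarrow> W a b \<bullet> v i = 0"
  by (simp add: W_v)

lemma vanish_012: "w \<bullet> v 0 = 0 \<Longrightarrow> w \<bullet> v 1 = 0 \<Longrightarrow> w \<bullet> v 2 = 0 \<Longrightarrow> w = 0"
  using vanish_three[of w 0 1 2] by simp

lemma W_swap: "W b a = - W a b"
  using vanish_012[of "W b a + W a b"] by (simp add: inner_add_left W_v eq_neg_iff_add_eq_0)

text \<open>This dependence is why the projections of the pairwise intersections of three planes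
  pass through one point.\<close>

lemma W_relation: "\<kappa> $ c *\<^sub>R W a b - \<kappa> $ b *\<^sub>R W a c + \<kappa> $ a *\<^sub>R W b c = 0"
  by (rule vanish_012) (simp_all add: inner_add_left inner_diff_left W_v algebra_simps)

text \<open>If \<open>W a b\<close> vanished, the opposite signs of \<kappa> would force
  \<open>s $ a = 0\<close> on the cone, hence on its span \<open>U\<close>, which contains
  \<kappa>.\<close>

lemma W_opposite:
  assumes "a \<in> J" "b \<in> K"
  shows "W a b \<noteq> 0"
proof
  assume W0: "W a b = 0"
  have sub: "{s \<in> U. \<forall>j. 0 \<le> s $ j} \<subseteq> {s. s $ a = 0}"
  proof
    fix s assume s: "s \<in> {s \<in> U. \<forall>j. 0 \<le> s $ j}"
    then have "\<kappa> $ b * s $ a - \<kappa> $ a * s $ b = 0" using W[of s a b] W0 by simp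
    moreover have "\<kappa> $ b * s $ a \<le> 0" "0 \<le> \<kappa> $ a * s $ b"
      using s assms by (auto simp: J_def K_def mult_nonpos_nonneg)
    ultimately have "\<kappa> $ b * s $ a = 0" by linarith
    then show "s \<in> {s. s $ a = 0}" using assms by (auto simp: K_def)
  qed
  have "subspace {s :: real^'n. s $ a = 0}" by (auto simp: subspace_def)
  from span_minimal[OF sub this] U_span \<kappa>(1) have "\<kappa> $ a = 0" by auto
  then show False using assms by (simp add: J_def)
qed

text \<open>A facet parallel to the direction of projection and standing over side
  \<open>i\<close>.\<close>

definition vert :: "nat \<Rightarrow> 'n \<Rightarrow> bool" where
  "vert i j \<longleftrightarrow> j \<in> Z \<and> (\<exists>\<tau>>0. \<forall>s\<in>U. s $ j = \<tau> * side i (M s))"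

text \<open>One facet of each sign, both containing the lift of side \<open>i\<close> between the
  chosen lifts of its ends.\<close>

definition bound :: "nat \<Rightarrow> 'n \<Rightarrow> 'n \<Rightarrow> bool" where
  "bound i a b \<longleftrightarrow> a \<in> J \<and> b \<in> K \<and> q i $ a = 0 \<and> q (next7 i) $ a = 0 \<and> q i $ b = 0 \<and> q (next7 i) $ b = 0"

text \<open>If no coordinate outside \<open>Z\<close> is tight over the \<open>i\<close>-th side, then some coordinate in \<open>Z\<close> must cut it out:
  otherwise a small step across the side would stay in the cone.\<close>

lemma vert_if:
  assumes i: "i < 7" and s: "s \<in> C" "M s = v i + v (next7 i)" "\<And>a. a \<notin> Z \<Longrightarrow> 0 < s $ a"
  shows "\<exists>j. vert i j"
proof (rule ccontr)
  assume no: "\<nexists>j. vert i j"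
  obtain k where k: "k < 7" "k \<noteq> i" "k \<noteq> next7 i" using other_index by blast
  have i': "next7 i < 7" "next7 i \<noteq> i" using next7 i by auto
  have "q k $ j = 0" if "s $ j = 0" for j
  proof -
    have j: "j \<in> Z" using s(3)[of j] that by auto
    obtain z where "q i + q (next7 i) = s + z *\<^sub>R \<kappa>"
      using fibre[of s "q i + q (next7 i)"] s C_D(1)[OF s(1)] q i i' U by (auto simp: subspace_add)
    then have "(q i + q (next7 i)) $ j = (s + z *\<^sub>R \<kappa>) $ j" by simp
    then have "q i $ j + q (next7 i) $ j = 0" using j that by (simp add: Z_def)
    then have q0: "q i $ j = 0" "q (next7 i) $ j = 0" using q(2)[OF i, of j] q(2)[OF i'(1), of j] by auto
    have "linear (\<lambda>s :: real^'n. s $ j)" by (auto simp: linear_iff)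
    from represent[OF this] j obtain w where w: "\<And>s. s \<in> U \<Longrightarrow> s $ j = w \<bullet> M s" by (auto simp: Z_def)
    then have "w \<bullet> v i = 0" "w \<bullet> v (next7 i) = 0" using q0 q i i' by metis+
    from vanish_two[OF this i i'(1)] i'(2) obtain \<tau> where "w = \<tau> *\<^sub>R cross3 (v i) (v (next7 i))" by metis
    then have \<tau>: "s $ j = \<tau> * side i (M s)" if "s \<in> U" for s
      using w[OF that] by (simp add: side_def brk_def)
    have pos: "0 < side i (v k)" by (rule side_pos[OF i k])
    have "q k $ j = \<tau> * side i (v k)" using \<tau>[OF q(1)[OF k(1)]] q(3)[OF k(1)] by simp
    moreover have "\<not> 0 < \<tau>" using no \<tau> j by (auto simp: vert_def)
    ultimately show "q k $ j = 0" using q(2)[OF k(1), of j] pos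
      by (metis less_le_not_le mult_nonpos_nonneg linorder_not_le order_antisym)
  qed
  then have pos: "0 < q k $ j \<Longrightarrow> 0 < s $ j" for j using C_D(2)[OF s(1), of j] by (cases "s $ j = 0") auto
  obtain z where z: "0 < z" "\<And>a. 0 \<le> (s - z *\<^sub>R q k) $ a"
    using small_step[of s "q k"] C_D(2)[OF s(1)] pos by blast
  have "s - z *\<^sub>R q k \<in> U" using U C_D(1)[OF s(1)] q(1)[OF k(1)] by (simp add: subspace_diff subspace_scale)
  then have "0 \<le> side i (M (s - z *\<^sub>R q k))" using side_M[OF i] z by blast
  then have "z * side i (v k) \<le> 0" using s(2) q(3)[OF k(1)] by simp
  then show False using z(1) side_pos[OF i k] by (simp add: mult_le_0_iff)
qed

text \<open>If no facet of one sign is tight at \<open>s\<close>, a short move along the kernel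
  stays in the cone and makes every coordinate outside \<open>Z\<close> positive, without changing
  the projection.\<close>

lemma tight_if:
  assumes i: "i < 7" and s: "s \<in> C"
    and unique: "\<And>s'. s' \<in> C \<Longrightarrow> M s' = M s \<Longrightarrow> (\<forall>a. a \<notin> Z \<longrightarrow> 0 < s' $ a) \<Longrightarrow> False"
  shows "(\<exists>a\<in>J. s $ a = 0) \<and> (\<exists>b\<in>K. s $ b = 0)"
proof (intro conjI; rule ccontr)
  assume "\<not> (\<exists>a\<in>J. s $ a = 0)"
  then have pos: "0 < s $ a" if "a \<in> J" for a using C_D(2)[OF s, of a] that by (metis less_le)
  obtain z where z: "0 < z" "\<And>a. 0 \<le> (s - z *\<^sub>R \<kappa>) $ a"
    using small_step[of s \<kappa>] C_D(2)[OF s] pos by (auto simp: J_def)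
  \<comment> \<open>Half of the admissible step keeps the coordinates in \<open>J\<close> strictly
    positive, while those in \<open>K\<close> strictly grow.\<close>
  let ?s = "s - (z / 2) *\<^sub>R \<kappa>"
  have p: "0 < ?s $ a" if "a \<notin> Z" for a
  proof (cases "a \<in> J")
    case True
    then have "0 < z * \<kappa> $ a" using z by (simp add: J_def)
    then show ?thesis using z(2)[of a] by simp
  next
    case False
    then have "z * \<kappa> $ a < 0" using z that by (simp add: J_def Z_def mult_pos_neg)
    then show ?thesis using C_D(2)[OF s, of a] by simp
  qed
  have "0 \<le> ?s $ a" for a using p[of a] C_D(2)[OF s, of a] by (cases "a \<in> Z") (auto simp: Z_def)
  then have "?s \<in> C" using C_D(1)[OF s] \<kappa>(1) U by (intro C_I) (auto simp: subspace_diff subspace_scale)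
  then show False using unique[of ?s] p \<kappa>(2) by auto
next
  assume "\<not> (\<exists>a\<in>K. s $ a = 0)"
  then have pos: "0 < s $ a" if "a \<in> K" for a using C_D(2)[OF s, of a] that by (metis less_le)
  obtain z where z: "0 < z" "\<And>a. 0 \<le> (s - z *\<^sub>R (- \<kappa>)) $ a"
    using small_step[of s "- \<kappa>"] C_D(2)[OF s] pos by (auto simp: K_def)
  let ?s = "s + (z / 2) *\<^sub>R \<kappa>"
  have p: "0 < ?s $ a" if "a \<notin> Z" for a
  proof (cases "a \<in> K")
    case True
    then have "z * \<kappa> $ a < 0" using z by (simp add: K_def mult_pos_neg)
    then show ?thesis using z(2)[of a] by simp
  next
    case False
    then have "0 < z * \<kappa> $ a" using z that by (simp add: K_def Z_def)
    then show ?thesis using C_D(2)[OF s, of a] by simp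
  qed
  have "0 \<le> ?s $ a" for a using p[of a] C_D(2)[OF s, of a] by (cases "a \<in> Z") (auto simp: Z_def)
  then have "?s \<in> C" using C_D(1)[OF s] \<kappa>(1) U by (intro C_I) (auto simp: subspace_add subspace_scale)
  then show False using unique[of ?s] p \<kappa>(2) by auto
qed

lemma bound_if:
  assumes i: "i < 7"
    and "\<And>s'. s' \<in> C \<Longrightarrow> M s' = v i + v (next7 i) \<Longrightarrow> (\<forall>a. a \<notin> Z \<longrightarrow> 0 < s' $ a) \<Longrightarrow> False"
  shows "\<exists>a b. bound i a b"
proof -
  have i': "next7 i < 7" using next7 i by auto
  have zero: "q i $ a = 0 \<and> q (next7 i) $ a = 0" if "(q i + q (next7 i)) $ a = 0" for a
    using that q(2)[OF i, of a] q(2)[OF i', of a] by auto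
  have "q i + q (next7 i) \<in> C" by (intro C_add q_C i i')
  have Ms: "M (q i + q (next7 i)) = v i + v (next7 i)" using q(3) i i' by simp
  obtain a b where "a \<in> J" "(q i + q (next7 i)) $ a = 0" "b \<in> K" "(q i + q (next7 i)) $ b = 0"
    using tight_if[OF i \<open>q i + q (next7 i) \<in> C\<close>] assms(2) unfolding Ms by blast
  then show ?thesis
    using zero unfolding bound_def by blast
qed

lemma vert_unique:
  assumes "vert i j" "vert i' j" "i < 7" "i' < 7"
  shows "i = i'"
proof -
  from assms obtain \<tau> \<tau>' where t: "0 < \<tau>" "0 < \<tau>'"
    "\<And>s. s \<in> U \<Longrightarrow> s $ j = \<tau> * side i (M s)" "\<And>s. s \<in> U \<Longrightarrow> s $ j = \<tau>' * side i' (M s)"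
    unfolding vert_def by blast
  have "\<tau> * side i (v k) = \<tau>' * side i' (v k)" if "k < 7" for k
    using t(3,4)[OF q(1)[OF that]] q(3)[OF that] by simp
  then have "side i (v k) = 0 \<Longrightarrow> k < 7 \<Longrightarrow> k = i' \<or> k = next7 i'" for k
    using side_pos[OF assms(4), of k] t by fastforce
  from this[of i] this[of "next7 i"] next7(1)[OF assms(3)] assms(3)
  have "i = i' \<or> i = next7 i'" "next7 i = i' \<or> next7 i = next7 i'" by auto
  then show ?thesis using assms by (auto simp: next7_def split: if_splits)
qed

lemma other_end: "i < 7 \<Longrightarrow> i' < 7 \<Longrightarrow> i \<noteq> i' \<Longrightarrow> \<exists>k\<in>{i', next7 i'}. k \<noteq> i \<and> k \<noteq> next7 i"
  by (auto simp: next7_def)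

lemma bound_unique:
  assumes "bound i a b" "bound i' a b" "i < 7" "i' < 7"
  shows "i = i'"
proof (rule ccontr)
  assume "i \<noteq> i'"
  then obtain k where k: "k \<in> {i', next7 i'}" "k \<noteq> i" "k \<noteq> next7 i" using other_end assms by blast
  have "k < 7" using k next7 assms by auto
  have "W a b = 0"
    by (rule vanish_three[of _ i "next7 i" k])
      (use assms k \<open>k < 7\<close> next7(1) next7(2)[THEN not_sym] in \<open>auto intro!: W_zero simp: bound_def\<close>)
  then show False using W_opposite assms by (auto simp: bound_def)
qed

text \<open>Neither a vertical facet nor a pair of facets serves two sides, so the sides inject into
  the disjoint sum.\<close>

lemma sides_count:
  assumes "\<And>i. i < 7 \<Longrightarrow> (\<exists>j. vert i j) \<or> (\<exists>a\<in>J'. \<exists>b\<in>K'. bound i a b)"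
  shows "7 \<le> card Z + card J' * card K'"
proof -
  have "\<exists>x\<in>Z <+> J' \<times> K'. (\<forall>j. x = Inl j \<longrightarrow> vert i j) \<and> (\<forall>a b. x = Inr (a, b) \<longrightarrow> bound i a b)" if "i < 7" for i
    using assms[OF that]
  proof
    assume "\<exists>j. vert i j"
    then obtain j where "vert i j" ..
    then show ?thesis by (intro bexI[of _ "Inl j"]) (auto simp: vert_def)
  next
    assume "\<exists>a\<in>J'. \<exists>b\<in>K'. bound i a b"
    then obtain a b where "a \<in> J'" "b \<in> K'" "bound i a b" by blast
    then show ?thesis by (intro bexI[of _ "Inr (a, b)"]) auto
  qed
  then obtain f where f: "\<And>i. i < 7 \<Longrightarrow> f i \<in> Z <+> J' \<times> K'"
    "\<And>i j. i < 7 \<Longrightarrow> f i = Inl j \<Longrightarrow> vert i j" "\<And>i a b. i < 7 \<Longrightarrow> f i = Inr (a, b) \<Longrightarrow> bound i a b"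
    by metis
  have "inj_on f {..<7}"
  proof (rule inj_onI)
    fix i i' :: nat assume i: "i \<in> {..<7}" "i' \<in> {..<7}" "f i = f i'"
    show "i = i'"
    proof (cases "f i")
      case (Inl j)
      then show ?thesis using f(2) i vert_unique by (metis lessThan_iff)
    next
      case (Inr p)
      then show ?thesis using f(3) i bound_unique by (metis lessThan_iff surj_pair)
    qed
  qed
  then have "card {..<7::nat} \<le> card (Z <+> J' \<times> K')"
    by (rule card_inj_on_le) (use f(1) in auto)
  then show ?thesis by (simp add: card_Plus card_cartesian_product)
qed

lemma card_sum: "card Z + card J + card K \<le> 6"
proof -
  have "UNIV = Z \<union> J \<union> K" "Z \<inter> J = {}" "(Z \<union> J) \<inter> K = {}" by (auto simp: J_def K_def Z_def)
  then show ?thesis using card_n by (metis card_Un_disjoint finite)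
qed

text \<open>Two vertical facets leave at most four others and hence at most four pairs, in total
  fewer than seven; more of them only make the count smaller.\<close>

lemma card_Z: "card Z \<le> 1"
proof -
  have "(\<exists>j. vert i j) \<or> (\<exists>a\<in>J. \<exists>b\<in>K. bound i a b)" if "i < 7" for i
    using vert_if[OF that] bound_if[OF that] by (meson bound_def)
  from sides_count[OF this] have 7: "7 \<le> card Z + card J * card K" .
  have "z \<le> 1" if "z + j + k \<le> 6" "7 \<le> z + j * k" for z j k :: nat
  proof (rule ccontr)
    assume z: "\<not> z \<le> 1"
    then have "j \<in> {0, 1, 2, 3, 4}" using that by auto
    then show False using that z by auto
  qed
  from this[OF card_sum 7] show ?thesis .
qed

text \<open>Two lifts of a vertex differ along \<kappa>, so their sum is positive outside
  \<open>Z\<close>. Adding the lift of a neighbouring vertex gives such a point over either adjacent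
  side; both sides would then need vertical facets, but there is at most one.\<close>

lemma lift_unique:
  assumes i: "i < 7" and s: "s \<in> C" "M s = v i"
  shows "s = q i"
proof (rule ccontr)
  assume ne: "s \<noteq> q i"
  obtain z where z: "s = q i + z *\<^sub>R \<kappa>" using fibre[of "q i" s] q i s C_D(1) by metis
  have "z \<noteq> 0" using ne z by auto
  have pos: "0 < (q i + s) $ a" if "a \<notin> Z" for a
  proof -
    have "s $ a \<noteq> q i $ a" using z \<open>z \<noteq> 0\<close> that by (auto simp: Z_def)
    then show ?thesis using C_D(2)[OF s(1), of a] q(2)[OF i, of a] by auto
  qed
  have vert: "\<exists>j. vert h j" if h: "h < 7" "i = h \<and> k = next7 h \<or> k = h \<and> i = next7 h" for h k
  proof (rule vert_if[OF h(1)])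
    have k: "k < 7" using h next7 by auto
    show "(1 / 2) *\<^sub>R (q i + s) + q k \<in> C" by (intro C_add C_scale q_C i k s) auto
    show "M ((1 / 2) *\<^sub>R (q i + s) + q k) = v h + v (next7 h)"
      using h q(3) i k s by (auto simp: algebra_simps simp flip: scaleR_add_left)
    show "0 < ((1 / 2) *\<^sub>R (q i + s) + q k) $ a" if "a \<notin> Z" for a
      using pos[OF that] q(2)[OF k, of a] by (auto intro!: add_pos_nonneg)
  qed
  define h where "h = (if i = 0 then 6 else i - 1)"
  have h: "h < 7" "i = next7 h" "h \<noteq> i" using i by (auto simp: h_def next7_def)
  obtain j j' where j: "vert i j" "vert h j'" using vert[OF i, of "next7 i"] vert[OF h(1), of h] h(2) by blast
  then have "j \<noteq> j'" using vert_unique i h by blast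
  moreover have "j \<in> Z" "j' \<in> Z" using j by (auto simp: vert_def)
  ultimately have "2 \<le> card Z" by (metis card_2_iff card_mono empty_subsetI finite insert_subset)
  then show False using card_Z by simp
qed

text \<open>Here the absence of hidden vertices is decisive: a cone point over a side splits into
  extreme rays, each of which lies over an end of that side and is a multiple of its unique
  lift.\<close>

lemma segment_unique:
  assumes "s \<in> C" "i < 7" "side i (M s) = 0"
  shows "\<exists>\<alpha> \<beta>. s = \<alpha> *\<^sub>R q i + \<beta> *\<^sub>R q (next7 i)"
  using assms(1,3)
proof (induction "card {j. s $ j \<noteq> 0}" arbitrary: s rule: less_induct)
  case less
  consider "s = 0" | "minimal s" | "s \<noteq> 0" "\<not> minimal s" by blast
  then show ?case
  proof cases
    case 1
    then show ?thesis by (intro exI[of _ 0]) simp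
  next
    case 2
    obtain k t where k: "k < 7" "0 < t" "M s = t *\<^sub>R v k" using minimal_vertex[OF 2] by blast
    then have "k = i \<or> k = next7 i" using side_pos[OF assms(2) k(1)] less.prems(2) by auto
    have "M ((1 / t) *\<^sub>R s) = v k" using k by simp
    moreover have "(1 / t) *\<^sub>R s \<in> C" using less.prems(1) k by (intro C_scale) auto
    ultimately have "(1 / t) *\<^sub>R s = q k" using lift_unique[OF k(1)] by blast
    then have "s = t *\<^sub>R q k" using k(2) by (metis divide_self_if less_irrefl mult.commute scaleR_one scaleR_scaleR times_divide_eq_right mult_1_right)
    then have "s = (if k = i then t else 0) *\<^sub>R q i + (if k = i then 0 else t) *\<^sub>R q (next7 i)"
      using \<open>k = i \<or> k = next7 i\<close> by auto
    then show ?thesis by blast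
  next
    case 3
    obtain a b where ab: "a \<in> C" "b \<in> C" "s = a + b" "a \<noteq> 0"
      "{j. a $ j \<noteq> 0} \<subset> {j. s $ j \<noteq> 0}" "{j. b $ j \<noteq> 0} \<subset> {j. s $ j \<noteq> 0}"
      by (rule split_support[OF less.prems(1) 3])
    have lt: "card {j. a $ j \<noteq> 0} < card {j. s $ j \<noteq> 0}" "card {j. b $ j \<noteq> 0} < card {j. s $ j \<noteq> 0}"
      using ab(5,6) by (auto intro: psubset_card_mono)
    have z: "side i (M a) = 0" "side i (M b) = 0"
      using side_sum_0[OF ab(1,2) assms(2)] less.prems(2) ab(3) by auto
    obtain \<alpha> \<beta> \<alpha>' \<beta>' where "a = \<alpha> *\<^sub>R q i + \<beta> *\<^sub>R q (next7 i)" "b = \<alpha>' *\<^sub>R q i + \<beta>' *\<^sub>R q (next7 i)"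
      using less.hyps[OF lt(1) ab(1) z(1)] less.hyps[OF lt(2) ab(2) z(2)] by blast
    then have "s = (\<alpha> + \<alpha>') *\<^sub>R q i + (\<beta> + \<beta>') *\<^sub>R q (next7 i)" using ab(3) by (simp add: algebra_simps)
    then show ?thesis by blast
  qed
qed

lemma J_K_nonempty: "J \<noteq> {}" "K \<noteq> {}"
proof -
  have "(\<exists>j. vert i j) \<or> (\<exists>a\<in>J. \<exists>b\<in>K. bound i a b)" if "i < 7" for i
    using vert_if[OF that] bound_if[OF that] by (meson bound_def)
  from sides_count[OF this] have "7 \<le> card Z + card J * card K" .
  then show "J \<noteq> {}" "K \<noteq> {}" using card_Z by auto
qed

text \<open>A point over the side with all coordinates outside \<open>Z\<close> positive could be
  moved along the nonzero vector \<kappa>, contrary to the uniqueness of the lift.\<close>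

lemma bound_exists:
  assumes i: "i < 7"
  shows "\<exists>a b. bound i a b"
proof -
  have i': "next7 i < 7" "next7 i \<noteq> i" using next7 i by auto
  have eq: "s = q i + q (next7 i)" if s: "s \<in> C" "M s = v i + v (next7 i)" for s
  proof -
    obtain \<alpha> \<beta> where ab: "s = \<alpha> *\<^sub>R q i + \<beta> *\<^sub>R q (next7 i)" using segment_unique[OF s(1) i] s(2) by auto
    then have "(\<alpha> - 1) *\<^sub>R v i + (\<beta> - 1) *\<^sub>R v (next7 i) = 0"
      using s(2) q(3) i i' by (simp add: algebra_simps)
    from v_independent[OF this i i'(1)] i'(2) have "\<alpha> = 1" "\<beta> = 1" by auto
    then show ?thesis using ab by simp
  qed
  show ?thesis
  proof (rule bound_if[OF i])
    fix s assume s: "s \<in> C" "M s = v i + v (next7 i)" "\<forall>a. a \<notin> Z \<longrightarrow> 0 < s $ a"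
    have pos: "0 < s $ a" if "0 < \<kappa> $ a" for a using s(3) that by (simp add: Z_def)
    obtain z where z: "0 < z" "\<And>a. 0 \<le> (s - z *\<^sub>R \<kappa>) $ a"
      using small_step[of s \<kappa>] C_D(2)[OF s(1)] pos by blast
    have "s - z *\<^sub>R \<kappa> \<in> C" using z C_D(1)[OF s(1)] \<kappa>(1) U by (intro C_I) (auto simp: subspace_diff subspace_scale)
    moreover have "M (s - z *\<^sub>R \<kappa>) = v i + v (next7 i)" using s(2) \<kappa>(2) by simp
    ultimately have "s - z *\<^sub>R \<kappa> = s" using eq s by metis
    then have "\<kappa> = 0" using z(1) by simp
    moreover obtain a where "0 < \<kappa> $ a" using J_K_nonempty by (auto simp: J_def)
    ultimately show False by simp
  qed
qed

lemma product_ge: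
  assumes "\<And>i. i < 7 \<Longrightarrow> \<exists>a\<in>J'. \<exists>b\<in>K'. bound i a b"
  shows "7 \<le> card J' * card K'"
proof -
  from assms obtain f g where fg: "\<And>i. i < 7 \<Longrightarrow> f i \<in> J' \<and> g i \<in> K' \<and> bound i (f i) (g i)" by metis
  have "inj_on (\<lambda>i. (f i, g i)) {..<7}"
    by (rule inj_onI) (use fg bound_unique in \<open>metis lessThan_iff prod.inject\<close>)
  then have "card {..<7::nat} \<le> card (J' \<times> K')"
    by (rule card_inj_on_le) (use fg in auto)
  then show ?thesis by (simp add: card_cartesian_product)
qed

lemma small_product:
  fixes j k :: nat
  assumes "j + k \<le> 5"
  shows "j * k \<le> 6"
proof -
  have "j \<in> {0, 1, 2, 3, 4, 5}" using assms by auto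
  then show ?thesis using assms by auto
qed

text \<open>If the line degenerates, the slacks \<open>a\<close> and \<open>a'\<close> are
  proportional at all lifted vertices, and \<open>a\<close> can replace \<open>a'\<close>
  everywhere. Five facets offer at most six pairs for seven sides.\<close>

lemma W_nonzero_J:
  assumes "a \<in> J" "a' \<in> J" "a \<noteq> a'"
  shows "W a a' \<noteq> 0"
proof
  assume "W a a' = 0"
  then have eq: "\<kappa> $ a' * q i $ a = \<kappa> $ a * q i $ a'" if "i < 7" for i
    using W_v[OF that, of a a'] by simp
  have zero: "q i $ a' = 0 \<Longrightarrow> q i $ a = 0" if "i < 7" for i
    using eq[OF that] assms by (auto simp: J_def)
  have "\<exists>x\<in>J - {a'}. \<exists>y\<in>K. bound i x y" if i: "i < 7" for i
  proof -
    obtain x y where xy: "bound i x y" using bound_exists[OF i] by blast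
    then have "bound i (if x = a' then a else x) y"
      using zero i next7(1)[OF i] assms by (auto simp: bound_def)
    then show ?thesis using xy assms by (intro bexI[of _ "if x = a' then a else x"] bexI[of _ y]) (auto simp: bound_def)
  qed
  from product_ge[OF this] have "7 \<le> card (J - {a'}) * card K" .
  moreover have "card (J - {a'}) + card K \<le> 5"
  proof -
    have "card (J - {a'}) = card J - 1" "0 < card J" using assms by (auto simp: card_gt_0_iff)
    then show ?thesis using card_sum by linarith
  qed
  ultimately show False using small_product by fastforce
qed

end

section \<open>The incidence constraints satisfied by lower and upper facets\<close>

context lifted_line
begin

text \<open>Reversing the kernel direction exchanges lower and upper facets.\<close>

lemma negated: "lifted_line v U M q (- \<kappa>)"
proof
  show "- \<kappa> \<in> U" using \<kappa>(1) U by (simp add: subspace_neg)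
  show "M (- \<kappa>) = 0" using \<kappa>(2) linear_neg[OF M] by simp
  show "\<exists>z. s = z *\<^sub>R - \<kappa>" if "s \<in> U" "M s = 0" for s
    using kernel[OF that] by (metis minus_minus scaleR_minus_left scaleR_minus_right)
qed

lemma J_negated: "lifted_line.J (- \<kappa>) = K"
  using lifted_line.J_def[OF negated] by (auto simp: K_def)

lemma W_nonzero_K:
  assumes "b \<in> K" "b' \<in> K" "b \<noteq> b'"
  shows "W b b' \<noteq> 0"
proof
  assume "W b b' = 0"
  then have eq: "\<kappa> $ b' * q i $ b = \<kappa> $ b * q i $ b'" if "i < 7" for i
    using W_v[OF that, of b b'] by simp
  have zero: "q i $ b' = 0 \<Longrightarrow> q i $ b = 0" if "i < 7" for i
    using eq[OF that] assms by (auto simp: K_def)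
  have "\<exists>x\<in>J. \<exists>y\<in>K - {b'}. bound i x y" if i: "i < 7" for i
  proof -
    obtain x y where xy: "bound i x y" using bound_exists[OF i] by blast
    then have "bound i x (if y = b' then b else y)"
      using zero i next7(1)[OF i] assms by (auto simp: bound_def)
    then show ?thesis using xy assms by (intro bexI[of _ x] bexI[of _ "if y = b' then b else y"]) (auto simp: bound_def)
  qed
  from product_ge[OF this] have "7 \<le> card J * card (K - {b'})" .
  moreover have "card J + card (K - {b'}) \<le> 5"
  proof -
    have "card (K - {b'}) = card K - 1" "0 < card K" using assms by (auto simp: card_gt_0_iff)
    then show ?thesis using card_sum by linarith
  qed
  ultimately show False using small_product by fastforce
qed

lemma W_nonzero: "a \<in> J \<union> K \<Longrightarrow> b \<in> J \<union> K \<Longrightarrow> a \<noteq> b \<Longrightarrow> W a b \<noteq> 0"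
  using W_opposite[of a b] W_opposite[of b a] W_swap[of a b] W_nonzero_J[of a b] W_nonzero_K[of a b] by auto

definition N :: "'n \<Rightarrow> nat set" where
  "N a = {i. i < 7 \<and> q i $ a = 0}"

lemma W_N: "i \<in> N a \<Longrightarrow> i \<in> N b \<Longrightarrow> W a b \<bullet> v i = 0"
  by (simp add: N_def W_zero)

lemma finite_N [simp]: "finite (N a)"
  by (simp add: N_def)

lemma N_two:
  assumes "a \<in> J \<union> K" "b \<in> J \<union> K" "a \<noteq> b"
  shows "card (N a \<inter> N b) \<le> 2"
proof (rule ccontr)
  assume "\<not> ?thesis"
  then have "3 \<le> card (N a \<inter> N b)" by simp
  then obtain T where T: "T \<subseteq> N a \<inter> N b" "card T = 3" by (meson obtain_subset_with_card_n)
  then obtain i j k where ijk: "T = {i, j, k}" "i \<noteq> j" "i \<noteq> k" "j \<noteq> k" by (metis card_3_iff)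
  have "W a b = 0"
    by (rule vanish_three[of _ i j k]) (use T ijk W_N in \<open>auto simp: N_def\<close>)
  then show False using W_nonzero assms by blast
qed

lemma W_edge:
  assumes "a \<in> J \<union> K" "b \<in> J \<union> K" "a \<noteq> b" "i \<in> N a \<inter> N b" "j \<in> N a \<inter> N b" "i \<noteq> j"
  shows "\<exists>t. t \<noteq> 0 \<and> W a b = t *\<^sub>R cross3 (v i) (v j)"
proof -
  have "i < 7" "j < 7" using assms by (auto simp: N_def)
  then obtain t where "W a b = t *\<^sub>R cross3 (v i) (v j)"
    using vanish_two[of "W a b" i j] W_N assms by auto
  then show ?thesis using W_nonzero[OF assms(1-3)] by auto
qed

text \<open>Over the crossing point of the diagonals lie a point \<open>s\<close> on facet
  \<open>a\<close> and a point \<open>s'\<close> on facet \<open>b\<close>. Equal signs of \<kappa>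
  together with nonnegative slacks force them to coincide. Then both facets are tight at all four
  vertices, more than two.\<close>

lemma N_cross:
  assumes ab: "{a, b} \<subseteq> J \<or> {a, b} \<subseteq> K" "a \<noteq> b" and o: "u < x" "x < w" "w < y"
    and N: "{u, w} \<subseteq> N a" "{x, y} \<subseteq> N b"
  shows False
proof -
  have y: "y < 7" using N by (auto simp: N_def)
  define \<alpha> \<beta> \<gamma> \<delta> where "\<alpha> = brk (v x) (v w) (v y)" and "\<beta> = brk (v u) (v x) (v y)"
    and "\<gamma> = brk (v u) (v w) (v y)" and "\<delta> = brk (v u) (v x) (v w)"
  have pos: "0 < \<alpha>" "0 < \<beta>" "0 < \<gamma>" "0 < \<delta>"
    using orient o y by (auto simp: \<alpha>_def \<beta>_def \<gamma>_def \<delta>_def)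
  have lt: "u < 7" "x < 7" "w < 7" using o y by auto
  define s s' where "s = \<alpha> *\<^sub>R q u + \<beta> *\<^sub>R q w" and "s' = \<gamma> *\<^sub>R q x + \<delta> *\<^sub>R q y"
  have C: "s \<in> C" "s' \<in> C"
    unfolding s_def s'_def using pos lt y by (intro C_add C_scale q_C; simp)+
  have "\<alpha> *\<^sub>R v u + \<beta> *\<^sub>R v w = \<gamma> *\<^sub>R v x + \<delta> *\<^sub>R v y"
    using brk_exchange[of "v x" "v w" "v y" "v u"] unfolding \<alpha>_def \<beta>_def \<gamma>_def \<delta>_def
    by (simp add: algebra_simps)
  then have "M s = M s'" using q(3) lt y by (simp add: s_def s'_def)
  then obtain z where z: "s' = s + z *\<^sub>R \<kappa>" using fibre C C_D by metis
  have sa: "s $ a = 0" "s' $ b = 0" using N by (auto simp: s_def s'_def N_def)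
  have "0 \<le> z * \<kappa> $ a" using z sa(1) C_D(2)[OF C(2), of a] by simp
  moreover have "z * \<kappa> $ b \<le> 0" using z sa(2) C_D(2)[OF C(1), of b] by (metis add_nonneg_eq_0_iff linorder_not_le less_imp_le vector_add_component vector_scaleR_component real_scaleR_def)
  ultimately have "z = 0" using ab(1) by (auto simp: J_def K_def zero_le_mult_iff mult_le_0_iff)
  then have "s' $ a = 0" "s $ b = 0" using z sa by auto
  then have "q x $ a = 0" "q y $ a = 0"
    using pos q(2)[OF lt(2), of a] q(2)[OF y, of a]
    by (auto simp: s'_def add_nonneg_eq_0_iff)
  then have "{u, w, x} \<subseteq> N a \<inter> N b \<or> x \<in> N a" using lt by (auto simp: N_def)
  have "q u $ b = 0"
    using \<open>s $ b = 0\<close> pos q(2)[OF lt(1), of b] q(2)[OF lt(3), of b]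
    by (auto simp: s_def add_nonneg_eq_0_iff)
  then have "{u, x, y} \<subseteq> N a \<inter> N b" using \<open>q x $ a = 0\<close> \<open>q y $ a = 0\<close> N lt y by (auto simp: N_def)
  then have "card {u, x, y} \<le> card (N a \<inter> N b)" by (intro card_mono) auto
  moreover have "card {u, x, y} = 3" using o by auto
  ultimately show False using N_two[of a b] ab by auto
qed

text \<open>The three planes \<open>a, b, c\<close> meet in a point of the cone that lies over the interior of the
  triangle \<open>u, w, x\<close>; it would be a hidden vertex.\<close>

lemma N_star_J:
  assumes J: "J = {a, b, c}" "distinct [a, b, c]"
    and u: "u \<in> N a \<inter> N b - N c" and w: "w \<in> N b \<inter> N c - N a" and x: "x \<in> N a \<inter> N c - N b"
  shows False
proof -
  have lt: "u < 7" "w < 7" "x < 7" using u w x by (auto simp: N_def)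
  have zero: "q u $ a = 0" "q u $ b = 0" "q w $ b = 0" "q w $ c = 0" "q x $ a = 0" "q x $ c = 0"
    using u w x by (auto simp: N_def)
  have pos: "0 < q u $ c" "0 < q w $ a" "0 < q x $ b"
    using u w x q(2) by (auto simp: N_def less_le)
  have \<kappa>pos: "0 < \<kappa> $ a" "0 < \<kappa> $ b" "0 < \<kappa> $ c" using J(1) unfolding J_def by auto
  \<comment> \<open>The weights make the combination of the three lifts agree with \<kappa> in the
    coordinates \<open>a\<close>, \<open>b\<close>, \<open>c\<close>, so that \<open>s\<close> below
    lies on all three planes.\<close>
  define \<alpha> \<beta> \<gamma> where "\<alpha> = \<kappa> $ c / q u $ c" and "\<beta> = \<kappa> $ a / q w $ a" and "\<gamma> = \<kappa> $ b / q x $ b"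
  have cpos: "0 < \<alpha>" "0 < \<beta>" "0 < \<gamma>" using pos \<kappa>pos by (auto simp: \<alpha>_def \<beta>_def \<gamma>_def)
  have mult: "\<alpha> * q u $ c = \<kappa> $ c" "\<beta> * q w $ a = \<kappa> $ a" "\<gamma> * q x $ b = \<kappa> $ b"
    using pos by (auto simp: \<alpha>_def \<beta>_def \<gamma>_def)
  define s where "s = \<alpha> *\<^sub>R q u + \<beta> *\<^sub>R q w + \<gamma> *\<^sub>R q x - \<kappa>"
  have s0: "s $ a = 0" "s $ b = 0" "s $ c = 0" using zero mult by (simp_all add: s_def)
  have sU: "s \<in> U"
    unfolding s_def using U q(1) lt \<kappa>(1) by (intro subspace_diff subspace_add subspace_scale) auto
  \<comment> \<open>Outside \<open>J\<close> the entries of \<kappa> are not positive, so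
    subtracting \<kappa> cannot make a slack negative.\<close>
  have "0 \<le> s $ j" for j
  proof (cases "j \<in> J")
    case False
    then have "\<kappa> $ j \<le> 0" by (simp add: J_def)
    moreover have "0 \<le> \<alpha> * q u $ j + \<beta> * q w $ j + \<gamma> * q x $ j"
      using cpos q(2) lt by (intro add_nonneg_nonneg mult_nonneg_nonneg) auto
    ultimately show ?thesis by (simp add: s_def)
  qed (use s0 J in auto)
  then have sC: "s \<in> C" using sU by (intro C_I)
  have Ms: "M s = \<alpha> *\<^sub>R v u + \<beta> *\<^sub>R v w + \<gamma> *\<^sub>R v x" using q(3) lt \<kappa>(2) by (simp add: s_def)
  have uwx: "u \<noteq> w" "u \<noteq> x" "w \<noteq> x" using u w x by auto
  define D where "D = brk (v u) (v w) (v x)"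
  have D: "D \<noteq> 0" using brk_nonzero lt uwx by (simp add: D_def)
  have "s \<noteq> 0"
  proof
    assume "s = 0"
    then have "\<alpha> *\<^sub>R v u + \<beta> *\<^sub>R v w + \<gamma> *\<^sub>R v x = 0" using Ms by simp
    from brk_eq_0_dependent[OF this] show False using cpos D by (simp add: D_def)
  qed
  have "minimal s"
    unfolding minimal_def
  proof (intro conjI ballI impI)
    fix s' assume s': "s' \<in> C" "\<forall>j. s $ j = 0 \<longrightarrow> s' $ j = 0"
    define f where "f = (1 / D) *\<^sub>R (brk (M s') (v w) (v x) *\<^sub>R q u + brk (v u) (M s') (v x) *\<^sub>R q w + brk (v u) (v w) (M s') *\<^sub>R q x)"
    have "f \<in> U" unfolding f_def using U q(1) lt by (intro subspace_scale subspace_add) auto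
    have "M f = (1 / D) *\<^sub>R (brk (M s') (v w) (v x) *\<^sub>R v u + brk (v u) (M s') (v x) *\<^sub>R v w + brk (v u) (v w) (M s') *\<^sub>R v x)"
      using q(3) lt by (simp add: f_def)
    also have "\<dots> = M s'" unfolding brk_cramer[of "v u" "v w" "v x" "M s'", symmetric] using D by (simp add: D_def)
    finally obtain z where z: "s' = f + z *\<^sub>R \<kappa>" using fibre[OF \<open>f \<in> U\<close> C_D(1)[OF s'(1)]] by blast
    define x1 x2 x3 where "x1 = brk (M s') (v w) (v x) / D" and "x2 = brk (v u) (M s') (v x) / D"
      and "x3 = brk (v u) (v w) (M s') / D"
    have "f = x1 *\<^sub>R q u + x2 *\<^sub>R q w + x3 *\<^sub>R q x"
      unfolding f_def x1_def x2_def x3_def by (simp add: scaleR_add_right)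
    then have f: "s' = x1 *\<^sub>R q u + x2 *\<^sub>R q w + x3 *\<^sub>R q x + z *\<^sub>R \<kappa>"
      using z by simp
    have "s' $ a = 0" "s' $ b = 0" "s' $ c = 0" using s'(2) s0 by auto
    then have "x2 * q w $ a + z * \<kappa> $ a = 0" "x3 * q x $ b + z * \<kappa> $ b = 0" "x1 * q u $ c + z * \<kappa> $ c = 0"
      using zero by (simp_all add: f)
    then have "x2 = - z * \<beta>" "x3 = - z * \<gamma>" "x1 = - z * \<alpha>"
      using pos by (simp_all add: \<alpha>_def \<beta>_def \<gamma>_def field_simps eq_neg_iff_add_eq_0)
    then have "s' = (- z) *\<^sub>R s" unfolding f s_def by (simp add: algebra_simps)
    then show "\<exists>t. s' = t *\<^sub>R s" by blast
  qed (use sC \<open>s \<noteq> 0\<close> in auto)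
  from minimal_vertex[OF this] obtain i t where i: "i < 7" "M s = t *\<^sub>R v i" by blast
  \<comment> \<open>If \<open>s\<close> lies over vertex \<open>i\<close>, a positive combination of
    nonnegative values vanishes, and all three distinct vertices lie on side \<open>i\<close>, which
    has only two.\<close>
  have "\<alpha> * side i (v u) + \<beta> * side i (v w) + \<gamma> * side i (v x) = side i (M s)" unfolding Ms by simp
  also have "\<dots> = 0" using i by simp
  finally have sum: "\<alpha> * side i (v u) + \<beta> * side i (v w) + \<gamma> * side i (v x) = 0" .
  have nn: "0 \<le> \<alpha> * side i (v u)" "0 \<le> \<beta> * side i (v w)" "0 \<le> \<gamma> * side i (v x)"
    using cpos side_nonneg i lt by auto
  then have "\<alpha> * side i (v u) = 0" "\<beta> * side i (v w) = 0" "\<gamma> * side i (v x) = 0"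
    using sum by linarith+
  then have "side i (v u) = 0" "side i (v w) = 0" "side i (v x) = 0" using cpos by auto
  then have "u \<in> {i, next7 i}" "w \<in> {i, next7 i}" "x \<in> {i, next7 i}"
    using side_pos[OF i(1)] lt by (metis insert_iff less_irrefl)+
  then show False using uwx by auto
qed

lemma N_star:
  assumes "{a, b, c} = J \<or> {a, b, c} = K" "distinct [a, b, c]"
    "u \<in> N a \<inter> N b - N c" "w \<in> N b \<inter> N c - N a" "x \<in> N a \<inter> N c - N b"
  shows False
  using assms(1)
proof
  assume "{a, b, c} = J"
  then show False by (rule N_star_J[OF sym assms(2-5)])
next
  assume "{a, b, c} = K"
  then have "lifted_line.J (- \<kappa>) = {a, b, c}" unfolding J_negated by (rule sym)
  then show False by (rule lifted_line.N_star_J[OF negated _ assms(2-5)])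
qed

text \<open>Six vertices mean three disjoint pairs, so all six indices are distinct and each line
  \<open>W\<close> is the line through its pair; \<open>W_relation\<close> makes the three lines
  concurrent.\<close>

lemma N_three:
  assumes abc: "{a, b, c} \<subseteq> J \<union> K" "distinct [a, b, c]"
  shows "card (N a \<inter> N b \<union> N a \<inter> N c \<union> N b \<inter> N c) < 6"
proof (rule ccontr)
  assume "\<not> ?thesis"
  then have six: "6 \<le> card (N a \<inter> N b \<union> N a \<inter> N c \<union> N b \<inter> N c)" by simp
  have two: "card (N a \<inter> N b) \<le> 2" "card (N a \<inter> N c) \<le> 2" "card (N b \<inter> N c) \<le> 2"
    using N_two abc by auto
  have "card (N a \<inter> N b \<union> N a \<inter> N c \<union> N b \<inter> N c) \<le> card (N a \<inter> N b \<union> N a \<inter> N c) + card (N b \<inter> N c)"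
    "card (N a \<inter> N b \<union> N a \<inter> N c) \<le> card (N a \<inter> N b) + card (N a \<inter> N c)"
    by (rule card_Un_le)+
  then have eq: "card (N a \<inter> N b) = 2" "card (N a \<inter> N c) = 2" "card (N b \<inter> N c) = 2"
    "card (N a \<inter> N b \<union> N a \<inter> N c) = 4" "card (N a \<inter> N b \<union> N a \<inter> N c \<union> N b \<inter> N c) = 6"
    using six two by linarith+
  obtain i1 i2 where i12: "N a \<inter> N b = {i1, i2}" "i1 \<noteq> i2" using eq(1) by (meson card_2_iff)
  obtain i3 i4 where i34: "N a \<inter> N c = {i3, i4}" "i3 \<noteq> i4" using eq(2) by (meson card_2_iff)
  obtain i5 i6 where i56: "N b \<inter> N c = {i5, i6}" "i5 \<noteq> i6" using eq(3) by (meson card_2_iff)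
  have "card (set [i1, i2, i3, i4, i5, i6]) = length [i1, i2, i3, i4, i5, i6]"
    using eq(5) unfolding i12 i34 i56 by (simp add: insert_commute Un_insert_left)
  then have dist: "distinct [i1, i2, i3, i4, i5, i6]" by (rule card_distinct)
  have sub: "{i1, i2, i3, i4, i5, i6} \<subseteq> {..<7}" using i12 i34 i56 by (auto simp: N_def)
  obtain t1 where t1: "t1 \<noteq> 0" "W a b = t1 *\<^sub>R cross3 (v i1) (v i2)" using W_edge[of a b i1 i2] abc i12 by auto
  obtain t2 where t2: "t2 \<noteq> 0" "W a c = t2 *\<^sub>R cross3 (v i3) (v i4)" using W_edge[of a c i3 i4] abc i34 by auto
  obtain t3 where t3: "t3 \<noteq> 0" "W b c = t3 *\<^sub>R cross3 (v i5) (v i6)" using W_edge[of b c i5 i6] abc i56 by auto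
  have "(\<kappa> $ c * t1) *\<^sub>R cross3 (v i1) (v i2) + (- \<kappa> $ b * t2) *\<^sub>R cross3 (v i3) (v i4)
     + (\<kappa> $ a * t3) *\<^sub>R cross3 (v i5) (v i6) = 0"
    using W_relation[of c a b] unfolding t1 t2 t3 by simp
  from brk_eq_0_dependent[OF this] have "brk (cross3 (v i1) (v i2)) (cross3 (v i3) (v i4)) (cross3 (v i5) (v i6)) = 0"
    using t1 abc by (auto simp: J_def K_def)
  then show False using no_concurrent[OF sub dist] by simp
qed

text \<open>The lines \<open>W a c\<close> and \<open>W b c\<close> pass through the meeting point
  of the two chords, and by \<open>W_relation\<close> the line \<open>W a b\<close> does as well.
  Applied to \<open>c\<close>, \<open>d\<close>, \<open>e\<close> in turn, this puts the three
  points of condition (3) on one line.\<close>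

lemma W_meet:
  assumes "{a, b, c} \<subseteq> J \<union> K" "distinct [a, b, c]"
    "i \<in> N a \<inter> N c" "j \<in> N a \<inter> N c" "i \<noteq> j" "k \<in> N b \<inter> N c" "l \<in> N b \<inter> N c" "k \<noteq> l"
  shows "W a b \<bullet> cross3 (cross3 (v i) (v j)) (cross3 (v k) (v l)) = 0"
proof -
  let ?p = "cross3 (cross3 (v i) (v j)) (cross3 (v k) (v l))"
  obtain t where t: "W a c = t *\<^sub>R cross3 (v i) (v j)" using W_edge[of a c i j] assms by auto
  obtain t' where t': "W b c = t' *\<^sub>R cross3 (v k) (v l)" using W_edge[of b c k l] assms by auto
  have z: "W a c \<bullet> ?p = 0" "W b c \<bullet> ?p = 0" unfolding t t' by (simp_all add: dot_cross_self)
  have "(\<kappa> $ c *\<^sub>R W a b - \<kappa> $ b *\<^sub>R W a c + \<kappa> $ a *\<^sub>R W b c) \<bullet> ?p = 0"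
    unfolding W_relation by simp
  then have "\<kappa> $ c * (W a b \<bullet> ?p) = 0" using z by (simp add: inner_add_left inner_diff_left)
  then show ?thesis using assms(1) by (auto simp: J_def K_def)
qed

lemma N_pappus:
  assumes pl: "{a, b, c, d, e} \<subseteq> J \<union> K" "distinct [a, b, c, d, e]"
    and dist: "distinct [u1, u2, u3, u4, u5, u6, u7]"
    and N: "{u1, u2, u5} \<subseteq> N a" "{u3, u4, u6, u7} \<subseteq> N b" "{u1, u2, u3, u4} \<subseteq> N c"
      "{u2, u5, u4, u6} \<subseteq> N d" "{u3, u7, u1, u5} \<subseteq> N e"
  shows False
proof -
  have sub: "{u1, u2, u3, u4, u5, u6, u7} \<subseteq> {..<7}" using N by (auto simp: N_def)
  have "W a b \<noteq> 0" using W_nonzero pl by auto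
  moreover have "W a b \<bullet> cross3 (cross3 (v u1) (v u2)) (cross3 (v u3) (v u4)) = 0"
    by (rule W_meet[where c = c]) (use pl dist N in auto)
  moreover have "W a b \<bullet> cross3 (cross3 (v u2) (v u5)) (cross3 (v u4) (v u6)) = 0"
    by (rule W_meet[where c = d]) (use pl dist N in auto)
  moreover have "W b a \<bullet> cross3 (cross3 (v u3) (v u7)) (cross3 (v u1) (v u5)) = 0"
    by (rule W_meet[where c = e]) (use pl dist N in auto)
  then have "W a b \<bullet> cross3 (cross3 (v u3) (v u7)) (cross3 (v u1) (v u5)) = 0"
    using W_swap[of a b] by simp
  ultimately have "brk (cross3 (cross3 (v u1) (v u2)) (cross3 (v u3) (v u4)))
            (cross3 (cross3 (v u2) (v u5)) (cross3 (v u4) (v u6)))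
            (cross3 (cross3 (v u3) (v u7)) (cross3 (v u1) (v u5))) = 0"
    by (rule brk_eq_0_orthogonal)
  then show False using no_collinear[OF sub dist] by simp
qed

theorem line_contradiction: False
proof -
  have "heptagon_incidence N J K"
  proof
    show "finite J" "finite K" by auto
    show "J \<inter> K = {}" by (auto simp: J_def K_def)
    show "card J + card K \<le> 6" using card_sum by simp
    show "i < 7" if "i \<in> N a" for a i using that by (simp add: N_def)
    show "\<exists>a\<in>J. \<exists>b\<in>K. {i, next7 i} \<subseteq> N a \<inter> N b" if i: "i < 7" for i
      using bound_exists[OF i] i next7(1)[OF i] by (auto simp: bound_def N_def)
  qed (fact N_two N_cross N_star N_three N_pappus)+
  then show False by (rule heptagon_incidence.contradiction)
qed

end

context lifted_heptagon
begin

theorem contradiction: False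
proof (cases "\<exists>\<kappa>\<in>U. M \<kappa> = 0 \<and> (\<forall>s\<in>U. M s = 0 \<longrightarrow> (\<exists>z. s = z *\<^sub>R \<kappa>))")
  case True
  then obtain \<kappa> where "\<kappa> \<in> U" "M \<kappa> = 0" "\<And>s. s \<in> U \<Longrightarrow> M s = 0 \<Longrightarrow> \<exists>z. s = z *\<^sub>R \<kappa>" by blast
  then have "lifted_line v U M q \<kappa>"
    by unfold_locales auto
  then show False by (rule lifted_line.line_contradiction)
next
  case False
  then have no: "\<exists>s\<in>U. M s = 0 \<and> (\<forall>z. s \<noteq> z *\<^sub>R \<kappa>)" if "\<kappa> \<in> U" "M \<kappa> = 0" for \<kappa> using that by blast
  obtain \<kappa> where \<kappa>: "\<kappa> \<in> U" "M \<kappa> = 0" "\<kappa> \<noteq> 0" using no[of 0] U subspace_0 by auto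
  obtain \<kappa>' where \<kappa>': "\<kappa>' \<in> U" "M \<kappa>' = 0" "\<And>z. \<kappa>' \<noteq> z *\<^sub>R \<kappa>" using no[OF \<kappa>(1,2)] by blast
  have 1: "dim {\<kappa>} = 1" using \<kappa>(3) by (simp add: dim_insert)
  have 2: "dim {\<kappa>', \<kappa>} = 2" using \<kappa>'(3) 1 by (simp add: dim_insert span_singleton image_iff)
  have sub: "span X \<subseteq> {s. M s \<in> span (M ` X)}" for X by (auto simp: linear_span_image[OF M])
  have z: "span (insert 0 X) = span X" for X :: "(real^3) set" by (rule span_insert_0)
  \<comment> \<open>Since \<open>M\<close> kills both kernel vectors and maps \<open>q 0\<close>,
    \<open>q 1\<close>, \<open>q 2\<close> to independent vectors, the five vectors are
    independent.\<close>
  have "q 0 \<notin> span {\<kappa>', \<kappa>}"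
  proof
    assume "q 0 \<in> span {\<kappa>', \<kappa>}"
    then have "v 0 \<in> span {0}" using sub[of "{\<kappa>', \<kappa>}"] q(3)[of 0] \<kappa> \<kappa>' by auto
    then show False using v_nonzero[of 0] by simp
  qed
  then have 3: "dim {q 0, \<kappa>', \<kappa>} = 3" using 2 by (simp add: dim_insert)
  have "q 1 \<notin> span {q 0, \<kappa>', \<kappa>}"
  proof
    assume "q 1 \<in> span {q 0, \<kappa>', \<kappa>}"
    then have "v 1 \<in> span (insert 0 {v 0})" using sub[of "{q 0, \<kappa>', \<kappa>}"] q(3)[of 0] q(3)[of 1] \<kappa> \<kappa>' by (auto simp: insert_commute)
    then have "v 1 \<in> span {v 0}" by (simp only: z)
    then obtain r where "v 1 = r *\<^sub>R v 0" by (auto simp: span_singleton)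
    then show False using v_not_parallel[of 1 r 0] by simp
  qed
  then have 4: "dim {q 1, q 0, \<kappa>', \<kappa>} = 4" using 3 by (simp add: dim_insert)
  have "q 2 \<notin> span {q 1, q 0, \<kappa>', \<kappa>}"
  proof
    assume "q 2 \<in> span {q 1, q 0, \<kappa>', \<kappa>}"
    then have "v 2 \<in> span (insert 0 {v 1, v 0})"
      using sub[of "{q 1, q 0, \<kappa>', \<kappa>}"] q(3)[of 0] q(3)[of 1] q(3)[of 2] \<kappa> \<kappa>' by (auto simp: insert_commute)
    then have "v 2 \<in> span {v 1, v 0}" by (simp only: z)
    moreover have "span {v 1, v 0} \<subseteq> {x. brk (v 0) (v 1) x = 0}"
      by (rule span_minimal) (auto simp: subspace_def)
    ultimately show False using orient[of 0 1 2] by auto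
  qed
  then have 5: "dim {q 2, q 1, q 0, \<kappa>', \<kappa>} = 5" using 4 by (simp add: dim_insert)
  have "{q 2, q 1, q 0, \<kappa>', \<kappa>} \<subseteq> U" using \<kappa> \<kappa>' q(1) by auto
  then have "5 \<le> dim U" using dim_subset[of "{q 2, q 1, q 0, \<kappa>', \<kappa>}" U] 5 by simp
  have "\<exists>c. U = {s. c \<bullet> s = 0}"
  proof (cases "U = UNIV")
    case True
    \<comment> \<open>With normal vector 0 every coordinate counts as zero entry, and six axes
      cannot cover seven vertices.\<close>
    then show ?thesis by (intro exI[of _ 0]) simp
  next
    case False
    then have "span U \<subset> UNIV" using U by (simp add: span_eq_iff[THEN iffD2] psubset_eq)
    then have "dim U < DIM(real^'n)" by (metis dim_eq_full dim_subset_UNIV le_neq_implies_less psubset_eq)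
    then obtain c where c: "c \<noteq> 0" "\<And>s. s \<in> span U \<Longrightarrow> orthogonal c s" using orthogonal_to_subspace_exists by metis
    then have "U \<subseteq> {s. c \<bullet> s = 0}" by (auto simp: orthogonal_def span_base)
    moreover have "dim {s. c \<bullet> s = 0} \<le> dim U"
      using dim_hyperplane[OF c(1)] card_n \<open>5 \<le> dim U\<close> by simp
    ultimately have "U = {s. c \<bullet> s = 0}"
      using subspace_dim_equal U subspace_hyperplane by blast
    then show ?thesis by blast
  qed
  then obtain c where "U = {s. c \<bullet> s = 0}" by blast
  then have "lifted_hyperplane v U M q c" by unfold_locales
  then show False by (rule lifted_hyperplane.hyperplane_contradiction)
qed

end

section \<open>Facet representations of polytopes\<close>

text \<open>The three-point form matches \<open>mem_affine_3_minus\<close>, so values can be read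
  off for points constructed inside an affine hull.\<close>

definition aff :: "('a::real_vector \<Rightarrow> real) \<Rightarrow> bool" where
  "aff f \<longleftrightarrow> (\<forall>x y z r. f (x + r *\<^sub>R (y - z)) = f x + r * (f y - f z))"

lemma aff_step: "aff f \<Longrightarrow> f (x + r *\<^sub>R (y - z)) = f x + r * (f y - f z)"
  by (simp add: aff_def)

lemma aff_segment: "aff f \<Longrightarrow> f ((1 - u) *\<^sub>R x + u *\<^sub>R y) = (1 - u) * f x + u * f y"
  using aff_step[of f x u y x] by (simp add: algebra_simps)

lemma affine_level:
  assumes "aff f"
  shows "affine {x. f x = c}"
  unfolding affine_alt
proof (intro ballI allI)
  fix x y u assume "x \<in> {x. f x = c}" "y \<in> {x. f x = c}"
  then have "f ((1 - u) *\<^sub>R x + u *\<^sub>R y) = (1 - u) * c + u * c" by (simp add: aff_segment[OF assms])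
  then show "(1 - u) *\<^sub>R x + u *\<^sub>R y \<in> {x. f x = c}" by (simp add: left_diff_distrib)
qed

text \<open>Averaging with a further point preserves strict inequalities, as the functionals are
  nonnegative on \<open>Q\<close>. One point thus becomes strict for all functionals at
  once.\<close>

lemma aff_mean:
  assumes "finite I" "I \<noteq> {}" "convex Q" "\<And>i. i \<in> I \<Longrightarrow> y i \<in> Q"
  shows "\<exists>y0\<in>Q. \<forall>f. aff f \<longrightarrow> (\<forall>x\<in>Q. 0 \<le> f x) \<longrightarrow> (\<exists>i\<in>I. 0 < f (y i)) \<longrightarrow> 0 < f y0"
  using assms(1,2,4)
proof (induction I rule: finite_ne_induct)
  case (singleton i)
  then show ?case by auto
next
  case (insert i I)
  then obtain y0 where y0: "y0 \<in> Q" "\<And>f. aff f \<Longrightarrow> \<forall>x\<in>Q. 0 \<le> f x \<Longrightarrow> \<exists>i\<in>I. 0 < f (y i) \<Longrightarrow> 0 < f y0" by auto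
  let ?y = "(1 - 1 / 2) *\<^sub>R y0 + (1 / 2) *\<^sub>R y i"
  have "?y \<in> Q" using assms(3) y0(1) insert.prems by (intro convexD) auto
  moreover have "0 < f ?y" if f: "aff f" "\<forall>x\<in>Q. 0 \<le> f x" "\<exists>j\<in>insert i I. 0 < f (y j)" for f
  proof -
    have "f ?y = (1 - 1 / 2) * f y0 + (1 / 2) * f (y i)" by (rule aff_segment[OF f(1)])
    moreover have "0 \<le> f y0" "0 \<le> f (y i)" using f(2) y0(1) insert.prems by auto
    moreover have "0 < f y0 \<or> 0 < f (y i)" using f(3) y0(2)[OF f(1,2)] by auto
    ultimately show ?thesis by auto
  qed
  ultimately show ?case by blast
qed

text \<open>A generator that occurs with positive weight in a point of the face either is that point
  or ends an open segment through it inside the hull; in both cases it belongs to the face.\<close>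

lemma face_of_convex_hull_finite:
  assumes "finite S" "F face_of convex hull S"
  shows "F = convex hull (S \<inter> F)"
proof
  have "convex F" using assms(2) face_of_imp_convex by blast
  then show "convex hull (S \<inter> F) \<subseteq> F" by (simp add: hull_minimal)
  show "F \<subseteq> convex hull (S \<inter> F)"
  proof
    fix x assume x: "x \<in> F"
    then have "x \<in> convex hull S" using assms(2) face_of_imp_subset by blast
    then obtain u where u: "\<And>v. v \<in> S \<Longrightarrow> 0 \<le> u v" "sum u S = 1" "(\<Sum>v\<in>S. u v *\<^sub>R v) = x"
      unfolding convex_hull_finite[OF assms(1)] by auto
    have "v \<in> F" if v: "v \<in> S" "u v \<noteq> 0" for v
    proof (cases "u v = 1")
      case True
      then have "sum u (S - {v}) = 0" using u(2) assms(1) v(1) by (simp add: sum_diff1)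
      then have "\<forall>w\<in>S - {v}. u w = 0" using u(1) assms(1) by (subst sum_nonneg_eq_0_iff[symmetric]) auto
      then have "(\<Sum>w\<in>S. u w *\<^sub>R w) = (\<Sum>w\<in>{v}. u w *\<^sub>R w)"
        using v(1) assms(1) by (intro sum.mono_neutral_right) auto
      then show ?thesis using u(3) x True by simp
    next
      case False
      have "sum u (S - {v}) = 1 - u v" using u(2) assms(1) v(1) by (simp add: sum_diff1)
      moreover have "0 \<le> sum u (S - {v})" using u(1) by (intro sum_nonneg) auto
      ultimately have lt: "u v < 1" "0 < u v" using False v u(1)[of v] by auto
      define y where "y = (\<Sum>w\<in>S - {v}. (u w / (1 - u v)) *\<^sub>R w)"
      have "y \<in> convex hull (S - {v})"
        unfolding convex_hull_finite[OF finite_Diff[OF assms(1)]] y_def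
        using u(1) lt \<open>sum u (S - {v}) = 1 - u v\<close>
        by (auto intro!: exI[of _ "\<lambda>w. u w / (1 - u v)"] simp flip: sum_divide_distrib)
      then have y: "y \<in> convex hull S" by (meson Diff_subset hull_mono subsetD)
      have "(1 - u v) *\<^sub>R y = (\<Sum>w\<in>S - {v}. u w *\<^sub>R w)"
        unfolding y_def scaleR_sum_right using lt by simp
      then have xe: "x = u v *\<^sub>R v + (1 - u v) *\<^sub>R y"
        using u(3) assms(1) v(1) by (simp add: sum.remove)
      show ?thesis
      proof (cases "y = v")
        case True
        then have "x = v" using xe by (simp add: algebra_simps)
        then show ?thesis using x by simp
      next
        case False
        then have "x \<in> open_segment v y"
          unfolding in_segment using xe lt by (intro conjI exI[of _ "1 - u v"]) auto
        then show ?thesis using assms(2) x y v(1) hull_inc[OF v(1)] by (meson face_ofD)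
      qed
    qed
    then have "(\<Sum>v\<in>S. u v *\<^sub>R v) = (\<Sum>v\<in>S \<inter> F. u v *\<^sub>R v)" "sum u S = sum u (S \<inter> F)"
      using assms(1) by (auto intro!: sum.mono_neutral_right)
    then have "sum u (S \<inter> F) = 1" "(\<Sum>v\<in>S \<inter> F. u v *\<^sub>R v) = x" using u by auto
    moreover have "finite (S \<inter> F)" using assms(1) by simp
    ultimately show "x \<in> convex hull (S \<inter> F)"
      using u(1) unfolding convex_hull_finite[OF \<open>finite (S \<inter> F)\<close>] by auto
  qed
qed

lemma finite_facets:
  assumes "polytope Q"
  shows "finite {F. is_facet F Q}"
proof -
  obtain S where S: "finite S" "Q = convex hull S" using assms by (auto simp: polytope_def)
  have "F \<in> (\<lambda>T. convex hull T) ` Pow S" if "is_facet F Q" for F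
    using face_of_convex_hull_finite[OF S(1)] that S(2) unfolding is_facet_def by blast
  then have "{F. is_facet F Q} \<subseteq> (\<lambda>T. convex hull T) ` Pow S" by blast
  then show ?thesis using S(1) by (meson finite_Pow_iff finite_imageI finite_subset)
qed

lemma finite_affine_independent:
  fixes B :: "'a::real_vector set"
  assumes "\<not> affine_dependent B" "B \<subseteq> span E" "finite E"
  shows "finite B"
proof (cases "B = {}")
  case False
  then obtain a where a: "a \<in> B" by auto
  have "independent ((\<lambda>x. -a + x) ` (B - {a}))"
    using assms(1) affine_dependent_iff_dependent2[OF a] by simp
  moreover have "(\<lambda>x. -a + x) ` (B - {a}) \<subseteq> span E"
    using assms(2) a by (auto intro!: span_diff)
  ultimately have "finite ((\<lambda>x. -a + x) ` (B - {a}))"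
    using independent_span_bound[OF assms(3)] by blast
  then have "finite (B - {a})" by (rule finite_imageD) (auto simp: inj_on_def)
  then show ?thesis by simp
qed auto

lemma affine_independent_insert_outside:
  fixes B :: "'a::real_vector set"
  assumes "\<not> affine_dependent B" "a \<notin> affine hull B"
  shows "\<not> affine_dependent (insert a B)"
proof
  assume "affine_dependent (insert a B)"
  show False
  proof (cases "B = {}")
    case True
    with \<open>affine_dependent (insert a B)\<close> show ?thesis by simp
  next
    case False
    then obtain b where b: "b \<in> B" by auto
    have ab: "a \<noteq> b" using assms(2) hull_inc[OF b, of affine] by auto
    have ind: "independent ((\<lambda>x. -b + x) ` (B - {b}))"
      using assms(1) affine_dependent_iff_dependent2[OF b] by simp
    have "(\<lambda>x. -b + x) ` (insert a B - {b}) = insert (-b + a) ((\<lambda>x. -b + x) ` (B - {b}))"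
      using ab by auto
    moreover have "-b + a \<notin> span ((\<lambda>x. -b + x) ` (B - {b}))"
    proof
      assume "-b + a \<in> span ((\<lambda>x. -b + x) ` (B - {b}))"
      then have "b + (-b + a) \<in> affine hull B" unfolding affine_hull_span2[OF b] by (rule imageI)
      then show False using assms(2) by simp
    qed
    ultimately have "independent ((\<lambda>x. -b + x) ` (insert a B - {b}))"
      using ind by (simp add: independent_insert)
    moreover have "b \<in> insert a B" using b by simp
    ultimately show ?thesis using affine_dependent_iff_dependent2[of b "insert a B"] \<open>affine_dependent (insert a B)\<close> by blast
  qed
qed

text \<open>Each irredundant inequality cuts out a facet, and a point where it alone is tight tells
  its facet from the others.\<close>

lemma card_irredundant_le_size:
  fixes Q :: "'a::real_vector set"
  assumes Q: "polytope Q" "Q \<noteq> {}" and E: "finite E" "Q \<subseteq> span E"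
    and L: "finite L" "\<And>l. l \<in> L \<Longrightarrow> aff l"
    and rep: "Q = {x \<in> affine hull Q. \<forall>l\<in>L. 0 \<le> l x}"
    and irr: "\<And>l. l \<in> L \<Longrightarrow> \<exists>x\<in>affine hull Q. l x < 0 \<and> (\<forall>l'\<in>L - {l}. 0 \<le> l' x)"
  shows "card L \<le> polytope_size Q"
proof -
  define A where "A = affine hull Q"
  have A: "affine A" by (simp add: A_def affine_affine_hull)
  have A3: "x + r *\<^sub>R (y - z) \<in> A" if "x \<in> A" "y \<in> A" "z \<in> A" for x y z r
    using mem_affine_3_minus[OF A that] .
  have conv: "convex Q" using Q(1) polytope_imp_convex by blast
  have QA: "Q \<subseteq> A" by (simp add: A_def hull_subset)
  have QI: "x \<in> Q" if "x \<in> A" "\<forall>l\<in>L. 0 \<le> l x" for x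
  proof -
    have "x \<in> {x \<in> affine hull Q. \<forall>l\<in>L. 0 \<le> l x}" using that by (simp add: A_def)
    then show ?thesis by (simp only: rep[symmetric])
  qed
  define face where "face l = {x \<in> Q. l x = (0::real)}" for l
  have nn: "0 \<le> l x" if "l \<in> L" "x \<in> Q" for l x
  proof -
    have "x \<in> {x \<in> affine hull Q. \<forall>l\<in>L. 0 \<le> l x}" using that(2) by (simp only: rep[symmetric])
    then show ?thesis using that(1) by simp
  qed
  have "\<exists>y\<in>Q. 0 < l y" if l: "l \<in> L" for l
  proof (rule ccontr)
    assume "\<not> ?thesis"
    then have "Q \<subseteq> {x. l x = 0}" using nn[OF l] by force
    then have "A \<subseteq> {x. l x = 0}" unfolding A_def by (rule hull_minimal) (rule affine_level[OF L(2)[OF l]])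
    then show False using irr[OF l] by (auto simp: A_def)
  qed
  then obtain y where y: "\<And>l. l \<in> L \<Longrightarrow> y l \<in> Q \<and> 0 < l (y l)" by metis
  show ?thesis
  proof (cases "L = {}")
    case False
    have "\<exists>y0\<in>Q. \<forall>f. aff f \<longrightarrow> (\<forall>x\<in>Q. 0 \<le> f x) \<longrightarrow> (\<exists>i\<in>L. 0 < f (y i)) \<longrightarrow> 0 < f y0"
      by (rule aff_mean[OF L(1) False conv]) (use y in blast)
    then obtain y0 where y0Q: "y0 \<in> Q"
      and y0f: "\<And>f. aff f \<Longrightarrow> \<forall>x\<in>Q. 0 \<le> f x \<Longrightarrow> \<exists>i\<in>L. 0 < f (y i) \<Longrightarrow> 0 < f y0" by blast
    have "0 < l y0" if "l \<in> L" for l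
      by (rule y0f[OF L(2)[OF that]]) (use nn y that in blast)+
    note y0 = y0Q this
    have "\<exists>z\<in>Q. l z = 0 \<and> (\<forall>l'\<in>L - {l}. 0 < l' z)" if l: "l \<in> L" for l
    proof -
      obtain x where x: "x \<in> A" "l x < 0" "\<And>l'. l' \<in> L \<Longrightarrow> l' \<noteq> l \<Longrightarrow> 0 \<le> l' x"
        using irr[OF l] by (auto simp: A_def)
      \<comment> \<open>The point of the segment from the strict point \<open>y0\<close> to the
        violating point \<open>x\<close> at which \<open>l\<close> vanishes.\<close>
      define r where "r = l y0 / (l y0 - l x)"
      have r: "0 < r" "r < 1" using x(2) y0(2)[OF l] by (auto simp: r_def field_simps)
      define z where "z = (1 - r) *\<^sub>R y0 + r *\<^sub>R x"
      have "l z = (1 - r) * l y0 + r * l x" unfolding z_def by (rule aff_segment[OF L(2)[OF l]])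
      then have lz: "l z = 0" using x(2) y0(2)[OF l] by (simp add: r_def field_simps)
      have pos: "0 < l' z" if "l' \<in> L" "l' \<noteq> l" for l'
      proof -
        have "l' z = (1 - r) * l' y0 + r * l' x" unfolding z_def by (rule aff_segment[OF L(2)[OF that(1)]])
        moreover have "0 < (1 - r) * l' y0" using r y0(2)[OF that(1)] by simp
        moreover have "0 \<le> r * l' x" using r x(3)[OF that] by simp
        ultimately show ?thesis by simp
      qed
      have "z \<in> A" using A y0(1) QA x(1) unfolding z_def by (auto simp: affine_alt)
      moreover have "\<forall>l'\<in>L. 0 \<le> l' z"
      proof
        fix l' assume "l' \<in> L"
        then show "0 \<le> l' z" using lz pos[of l'] by (cases "l' = l") auto
      qed
      ultimately have "z \<in> Q" by (rule QI)
      then show ?thesis using lz pos by blast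
    qed
    then obtain z where z: "\<And>l. l \<in> L \<Longrightarrow> z l \<in> Q \<and> l (z l) = 0 \<and> (\<forall>l'\<in>L - {l}. 0 < l' (z l))" by metis
    have "is_facet (face l) Q" if l: "l \<in> L" for l
    proof -
      have al: "aff l" using L(2)[OF l] .
      have "face l face_of Q"
        unfolding face_of_def
      proof (intro conjI ballI impI)
        show "face l \<subseteq> Q" by (auto simp: face_def)
        have "convex {x. l x = 0}" using affine_level[OF al] affine_imp_convex by blast
        then have "convex (Q \<inter> {x. l x = 0})" using conv convex_Int by blast
        moreover have "face l = Q \<inter> {x. l x = 0}" by (auto simp: face_def)
        ultimately show "convex (face l)" by simp
        fix a b x assume ab: "a \<in> Q" "b \<in> Q" "x \<in> face l" "x \<in> open_segment a b"
        then obtain u where u: "0 < u" "u < 1" "x = (1 - u) *\<^sub>R a + u *\<^sub>R b" by (auto simp: in_segment)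
        then have "(1 - u) * l a + u * l b = 0" using aff_segment[OF al, of u a b] ab(3) by (simp add: face_def)
        moreover have "0 \<le> (1 - u) * l a" "0 \<le> u * l b" using nn[OF l] ab u by auto
        ultimately have "(1 - u) * l a = 0" "u * l b = 0" by linarith+
        then show "a \<in> face l" "b \<in> face l" using u ab by (auto simp: face_def)
      qed
      obtain B where B: "B \<subseteq> face l" "\<not> affine_dependent B" "affine hull (face l) = affine hull B"
        using affine_basis_exists by blast
      have "finite B" by (rule finite_affine_independent[OF B(2) _ E(1)]) (use B(1) E(2) in \<open>auto simp: face_def\<close>)
      have level: "affine hull (face l) \<subseteq> {x. l x = 0}"
        by (rule hull_minimal) (auto simp: face_def intro: affine_level[OF al])
      have zl: "z l \<in> face l" using z[OF l] by (simp add: face_def)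
      \<comment> \<open>Near \<open>z l\<close> the remaining inequalities are strict, so a short
        step towards \<open>x\<close> stays in the face; extending that step reaches
        \<open>x\<close> within the affine hull.\<close>
      have sup: "x \<in> affine hull (face l)" if x: "x \<in> A" "l x = 0" for x
      proof -
        have "\<exists>e>0. \<forall>l'\<in>L - {l}. 0 \<le> l' (z l) + e * (l' x - l' (z l))"
        proof -
          have ev: "\<forall>\<^sub>F e in at_right (0::real). 0 < l' (z l) + e * (l' x - l' (z l))" if "l' \<in> L - {l}" for l'
          proof -
            have "((\<lambda>e. l' (z l) + e * (l' x - l' (z l))) \<longlongrightarrow> l' (z l) + 0 * (l' x - l' (z l))) (at_right 0)"
              by (intro tendsto_intros)
            then show ?thesis using z[OF l] that by (intro order_tendstoD(1)) auto
          qed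
          have "\<forall>\<^sub>F e in at_right (0::real). 0 < e \<and> (\<forall>l'\<in>L - {l}. 0 < l' (z l) + e * (l' x - l' (z l)))"
            using L(1) ev by (intro eventually_conj eventually_ball_finite) (auto simp: eventually_at_right_less)
          from eventually_happens'[OF _ this] show ?thesis by (auto intro: less_imp_le)
        qed
        then obtain e where e: "0 < e" "\<And>l'. l' \<in> L - {l} \<Longrightarrow> 0 \<le> l' (z l) + e * (l' x - l' (z l))" by blast
        define w where "w = z l + e *\<^sub>R (x - z l)"
        have zA: "z l \<in> A" using z[OF l] QA by auto
        have "w \<in> A" unfolding w_def by (rule A3[OF zA x(1) zA])
        have lw: "l' w = l' (z l) + e * (l' x - l' (z l))" if "l' \<in> L" for l'
          unfolding w_def by (rule aff_step[OF L(2)[OF that]])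
        have "l w = 0" using lw[OF l] x(2) z[OF l] by simp
        have "\<forall>l'\<in>L. 0 \<le> l' w"
        proof
          fix l' assume "l' \<in> L"
          then show "0 \<le> l' w" using lw e(2)[of l'] \<open>l w = 0\<close> by (cases "l' = l") auto
        qed
        then have "w \<in> Q" using QI[OF \<open>w \<in> A\<close>] by blast
        then have "w \<in> face l" using \<open>l w = 0\<close> by (simp add: face_def)
        have "x = z l + (1 / e) *\<^sub>R (w - z l)" using e(1) by (simp add: w_def)
        moreover have "z l + (1 / e) *\<^sub>R (w - z l) \<in> affine hull (face l)"
          by (rule mem_affine_3_minus[OF affine_affine_hull]) (use zl \<open>w \<in> face l\<close> in \<open>auto intro: hull_inc\<close>)
        ultimately show ?thesis by simp
      qed
      have y0B: "y0 \<notin> affine hull B" using level y0(2)[OF l] B(3) by auto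
      have "\<not> affine_dependent (insert y0 B)" by (rule affine_independent_insert_outside[OF B(2) y0B])
      have "affine hull (insert y0 B) = A"
      proof
        show "affine hull (insert y0 B) \<subseteq> A"
          by (rule hull_minimal) (use A B(1) y0(1) QA in \<open>auto simp: face_def\<close>)
        show "A \<subseteq> affine hull (insert y0 B)"
        proof
          fix x assume x: "x \<in> A"
          let ?H = "affine hull (insert y0 B)"
          \<comment> \<open>Moving \<open>x\<close> parallel to the line through \<open>z l\<close>
            and \<open>y0\<close> until \<open>l\<close> vanishes shows that one extra point spans
            the whole affine hull, which gives codimension one.\<close>
          define r where "r = l x / l y0"
          define w where "w = x + (- r) *\<^sub>R (y0 - z l)"
          have zA: "z l \<in> A" "y0 \<in> A" using z[OF l] y0(1) QA by auto
          have "w \<in> A" unfolding w_def by (rule A3[OF x zA(2,1)])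
          moreover have "l w = 0" unfolding w_def aff_step[OF al] using z[OF l] y0(2)[OF l] by (simp add: r_def)
          ultimately have "w \<in> affine hull B" using sup B(3) by auto
          moreover have "z l \<in> affine hull B" using zl hull_inc B(3) by metis
          moreover have "affine hull B \<subseteq> ?H" by (rule hull_mono) auto
          ultimately have "w \<in> ?H" "z l \<in> ?H" "y0 \<in> ?H" by (auto intro: hull_inc)
          then have "w + r *\<^sub>R (y0 - z l) \<in> ?H" by (intro mem_affine_3_minus[OF affine_affine_hull])
          then show "x \<in> ?H" by (simp add: w_def)
        qed
      qed
      then have "has_aff_dim Q (int (card B))"
        unfolding has_aff_dim_def A_def using \<open>finite B\<close> \<open>\<not> affine_dependent (insert y0 B)\<close> y0B
        by (intro exI[of _ "insert y0 B"]) (auto simp: card_insert_if hull_inc)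
      moreover have "has_aff_dim (face l) (int (card B) - 1)"
        unfolding has_aff_dim_def using B \<open>finite B\<close> by (intro exI[of _ B]) auto
      ultimately show ?thesis unfolding is_facet_def using \<open>face l face_of Q\<close> zl by blast
    qed
    then have sub: "face ` L \<subseteq> {F. is_facet F Q}" by auto
    have "inj_on face L"
    proof (rule inj_onI, rule ccontr)
      fix l l' assume l: "l \<in> L" "l' \<in> L" "face l = face l'" "l \<noteq> l'"
      have "z l \<in> face l" using z[OF l(1)] by (auto simp: face_def)
      then have "l' (z l) = 0" unfolding l(3) by (simp add: face_def)
      moreover have "0 < l' (z l)" using z[OF l(1)] l(2,4) by blast
      ultimately show False by simp
    qed
    then show ?thesis
      unfolding polytope_size_def using card_inj_on_le[OF _ sub finite_facets[OF Q(1)]] by blast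
  qed simp
qed

lemma irredundant_subset:
  assumes "finite L" "Q = {x \<in> A. \<forall>l\<in>L. (0::real) \<le> l x}"
  shows "\<exists>L'\<subseteq>L. Q = {x \<in> A. \<forall>l\<in>L'. 0 \<le> l x} \<and>
    (\<forall>l\<in>L'. \<exists>x\<in>A. l x < 0 \<and> (\<forall>l'\<in>L' - {l}. 0 \<le> l' x))"
  using assms
proof (induction "card L" arbitrary: L rule: less_induct)
  case less
  show ?case
  proof (cases "\<forall>l\<in>L. \<exists>x\<in>A. l x < 0 \<and> (\<forall>l'\<in>L - {l}. 0 \<le> l' x)")
    case True
    then show ?thesis using less.prems by blast
  next
    case False
    then obtain l where l: "l \<in> L" "\<And>x. x \<in> A \<Longrightarrow> \<forall>l'\<in>L - {l}. 0 \<le> l' x \<Longrightarrow> 0 \<le> l x" by (meson not_le)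
    then have eq: "Q = {x \<in> A. \<forall>l\<in>L - {l}. 0 \<le> l x}" using less.prems(2) by auto
    have lt: "card (L - {l}) < card L" using l(1) less.prems(1) by (rule card_Diff1_less[rotated])
    have fin: "finite (L - {l})" using less.prems(1) by simp
    from less.hyps[OF lt fin eq] obtain L' where "L' \<subseteq> L - {l}" "Q = {x \<in> A. \<forall>l\<in>L'. 0 \<le> l x}"
      "\<forall>l\<in>L'. \<exists>x\<in>A. l x < 0 \<and> (\<forall>l'\<in>L' - {l}. 0 \<le> l' x)"
      by (elim exE conjE)
    then show ?thesis by (intro exI[of _ L']) auto
  qed
qed

definition pos :: "'a::real_vector set \<Rightarrow> 'a set" where
  "pos S = {y. \<exists>c. (\<forall>x\<in>S. 0 \<le> c x) \<and> y = (\<Sum>x\<in>S. c x *\<^sub>R x)}"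

lemma pos_insert:
  assumes "finite S" "a \<notin> S"
  shows "x \<in> pos (insert a S) \<longleftrightarrow> (\<exists>t\<ge>0. x - t *\<^sub>R a \<in> pos S)"
proof
  assume "x \<in> pos (insert a S)"
  then obtain c where "\<forall>x\<in>insert a S. 0 \<le> c x" "x = c a *\<^sub>R a + (\<Sum>x\<in>S. c x *\<^sub>R x)"
    using assms by (auto simp: pos_def)
  then show "\<exists>t\<ge>0. x - t *\<^sub>R a \<in> pos S" unfolding pos_def by (intro exI[of _ "c a"]) auto
next
  assume "\<exists>t\<ge>0. x - t *\<^sub>R a \<in> pos S"
  then obtain t c where tc: "0 \<le> t" "\<forall>x\<in>S. 0 \<le> c x" "x - t *\<^sub>R a = (\<Sum>x\<in>S. c x *\<^sub>R x)"
    by (auto simp: pos_def)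
  have "(\<Sum>x\<in>S. (c(a := t)) x *\<^sub>R x) = (\<Sum>x\<in>S. c x *\<^sub>R x)" using assms by (intro sum.cong) auto
  then have "x = (\<Sum>x\<in>insert a S. (c(a := t)) x *\<^sub>R x)" using tc(3) assms by (simp add: algebra_simps)
  then show "x \<in> pos (insert a S)" using tc unfolding pos_def by (intro CollectI exI[of _ "c(a := t)"]) auto
qed

lemma between_finite:
  fixes L U :: "real set"
  assumes "finite L" "finite U" "\<And>l u. l \<in> L \<Longrightarrow> u \<in> U \<Longrightarrow> l \<le> u"
  shows "\<exists>t. (\<forall>l\<in>L. l \<le> t) \<and> (\<forall>u\<in>U. t \<le> u)"
proof (cases "L = {}")
  case True
  then show ?thesis using assms(2) by (cases "U = {}") (auto intro!: exI[of _ "Min U"])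
next
  case False
  then show ?thesis using assms by (intro exI[of _ "Max L"]) auto
qed

text \<open>Fourier-Motzkin elimination of the coefficient of each generator.\<close>

lemma pos_halfspaces:
  fixes V :: "'a::real_vector set"
  assumes V: "subspace V" and B: "finite B" "\<And>f. f \<in> B \<Longrightarrow> linear f"
    "\<And>x. x \<in> V \<Longrightarrow> \<forall>f\<in>B. f x = (0::real) \<Longrightarrow> x = 0"
    and S: "finite S" "S \<subseteq> V"
  shows "\<exists>L. finite L \<and> (\<forall>l\<in>L. linear l) \<and> (\<forall>x\<in>V. x \<in> pos S \<longleftrightarrow> (\<forall>l\<in>L. (0::real) \<le> l x))"
  using S
proof (induction S rule: finite_induct)
  case empty
  \<comment> \<open>The empty set generates only 0, which the separating functionals and their
    negatives cut out.\<close>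
  let ?L = "B \<union> (\<lambda>f x. - f x) ` B"
  have lin: "\<forall>l\<in>?L. linear l" using B(2) by (auto intro: linear_compose_neg)
  have iff: "x \<in> pos {} \<longleftrightarrow> (\<forall>l\<in>?L. 0 \<le> l x)" if "x \<in> V" for x
  proof
    assume "x \<in> pos {}"
    then show "\<forall>l\<in>?L. 0 \<le> l x" using B(2) by (auto simp: pos_def linear_0)
  next
    assume all: "\<forall>l\<in>?L. 0 \<le> l x"
    have "f x = 0" if "f \<in> B" for f
    proof -
      have "(\<lambda>x. - f x) \<in> ?L" using that by blast
      with all have "0 \<le> (\<lambda>x. - f x) x" by (rule bspec)
      moreover have "0 \<le> f x" using all that by blast
      ultimately show ?thesis by simp
    qed
    then have "x = 0" using B(3)[OF \<open>x \<in> V\<close>] by blast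
    then show "x \<in> pos {}" by (simp add: pos_def)
  qed
  have fin: "finite ?L" using B(1) by simp
  show ?case by (rule exI[of _ ?L]) (intro conjI fin lin ballI iff)
next
  case (insert a S)
  from insert.prems have "S \<subseteq> V" by simp
  from insert.IH[OF this] obtain L where "finite L" and lL: "\<forall>l\<in>L. linear l"
    and pL: "\<forall>x\<in>V. x \<in> pos S \<longleftrightarrow> (\<forall>l\<in>L. (0::real) \<le> l x)" by (elim exE conjE)
  note L = \<open>finite L\<close> lL[rule_format] pL[THEN bspec]
  \<comment> \<open>\<open>N\<close> keeps the functionals that are nonnegative on the new
    generator; \<open>P\<close> pairs opposite signs so that the coefficient of the generator
    cancels.\<close>
  define N P where "N = {l \<in> L. 0 \<le> l a}" and "P = (\<lambda>(l, l') x. l x * (- l' a) + l' x * l a) ` ({l \<in> L. 0 < l a} \<times> {l \<in> L. l a < 0})"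
  have lin: "linear (\<lambda>x. l x * (- l' a) + l' x * l a)" if "l \<in> L" "l' \<in> L" for l l'
    using linear_add[OF L(2)[OF that(1)]] linear_add[OF L(2)[OF that(2)]]
      linear_scale[OF L(2)[OF that(1)]] linear_scale[OF L(2)[OF that(2)]]
    by (intro linearI) (simp_all add: algebra_simps)
  have "x \<in> pos (insert a S) \<longleftrightarrow> (\<forall>l\<in>N \<union> P. 0 \<le> l x)" if x: "x \<in> V" for x
  proof -
    have step: "x - t *\<^sub>R a \<in> pos S \<longleftrightarrow> (\<forall>l\<in>L. t * l a \<le> l x)" for t
    proof -
      have "x - t *\<^sub>R a \<in> V" using x insert.prems V by (auto intro: subspace_diff subspace_scale)
      then show ?thesis using L(2,3) by (simp add: linear_diff linear_scale)
    qed
    show ?thesis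
    proof
      assume "x \<in> pos (insert a S)"
      then obtain t where t: "0 \<le> t" "\<And>l. l \<in> L \<Longrightarrow> t * l a \<le> l x"
        using pos_insert[OF insert.hyps] step by auto
      have "0 \<le> l x" if "l \<in> N" for l
        using t(1) t(2)[of l] that by (auto simp: N_def intro: order_trans[OF mult_nonneg_nonneg])
      moreover have "0 \<le> l x * (- l' a) + l' x * l a" if "l \<in> L" "l' \<in> L" "0 < l a" "l' a < 0" for l l'
      proof -
        have "(t * l a) * (- l' a) \<le> l x * (- l' a)" using t(2)[OF that(1)] that by (intro mult_right_mono) auto
        moreover have "(t * l' a) * l a \<le> l' x * l a" using t(2)[OF that(2)] that by (intro mult_right_mono) auto
        ultimately show ?thesis by (simp add: algebra_simps)
      qed
      ultimately show "\<forall>l\<in>N \<union> P. 0 \<le> l x" by (auto simp: P_def)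
    next
      assume all: "\<forall>l\<in>N \<union> P. 0 \<le> l x"
      \<comment> \<open>Negative values on \<open>a\<close> and the condition on the coefficient
        give lower bounds for \<open>t\<close>, positive values give upper bounds; \<open>N\<close>
        and \<open>P\<close> say that no lower bound exceeds an upper one.\<close>
      have "\<exists>t. (\<forall>u\<in>insert 0 ((\<lambda>l. l x / l a) ` {l \<in> L. l a < 0}). u \<le> t) \<and> (\<forall>u\<in>(\<lambda>l. l x / l a) ` {l \<in> L. 0 < l a}. t \<le> u)"
      proof (rule between_finite)
        fix u w assume u: "u \<in> insert 0 ((\<lambda>l. l x / l a) ` {l \<in> L. l a < 0})" and "w \<in> (\<lambda>l. l x / l a) ` {l \<in> L. 0 < l a}"
        then obtain l where l: "l \<in> L" "0 < l a" "w = l x / l a" by auto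
        from u consider "u = 0" | l' where "l' \<in> L" "l' a < 0" "u = l' x / l' a" by auto
        then show "u \<le> w"
        proof cases
          case 1
          then show ?thesis using all l by (auto simp: N_def)
        next
          case (2 l')
          have "(\<lambda>x. l x * (- l' a) + l' x * l a) \<in> N \<union> P" using l 2 by (force simp: P_def)
          with all have "0 \<le> (\<lambda>x. l x * (- l' a) + l' x * l a) x" by (rule bspec)
          then have "0 \<le> l x * (- l' a) + l' x * l a" .
          moreover have "l x = w * l a" "l' x = u * l' a" using l 2 by simp_all
          ultimately have "(l' a * l a) * w \<le> (l' a * l a) * u" by (simp add: algebra_simps)
          moreover have "l' a * l a < 0" using l 2 by (simp add: mult_neg_pos)
          ultimately show ?thesis by (metis mult_le_cancel_left_neg)
        qed
      qed (use L(1) in auto)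
      then obtain t where t: "0 \<le> t" "\<And>l. l \<in> L \<Longrightarrow> l a < 0 \<Longrightarrow> l x / l a \<le> t" "\<And>l. l \<in> L \<Longrightarrow> 0 < l a \<Longrightarrow> t \<le> l x / l a"
        by auto
      have "t * l a \<le> l x" if l: "l \<in> L" for l
      proof -
        consider "l a = 0" | "0 < l a" | "l a < 0" by linarith
        then show ?thesis
        proof cases
          case 1
          then show ?thesis using all l by (auto simp: N_def)
        next
          case 2
          then show ?thesis using t(3)[OF l] by (simp add: pos_le_divide_eq)
        next
          case 3
          then show ?thesis using t(2)[OF l] by (simp add: neg_divide_le_eq)
        qed
      qed
      then show "x \<in> pos (insert a S)" using pos_insert[OF insert.hyps] step t(1) by blast
    qed
  qed
  moreover have "finite (N \<union> P)" using L(1) by (auto simp: N_def P_def)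
  moreover have "linear l" if "l \<in> N \<union> P" for l using that L(2) lin by (auto simp: N_def P_def)
  ultimately show ?case by (intro exI[of _ "N \<union> P"] conjI ballI)
qed

lemma lookup_scaleR [simp]:
  "Poly_Mapping.lookup (r *\<^sub>R x) i = r * Poly_Mapping.lookup (x :: point) i"
proof -
  have "finite {i. r * Poly_Mapping.lookup x i \<noteq> 0}"
    by (rule finite_subset[OF _ finite_keys[of x]]) (auto simp: in_keys_iff)
  then show ?thesis by (simp add: scaleR_poly_mapping_def)
qed

lemma Rn_iff: "x \<in> Rn n \<longleftrightarrow> (\<forall>i\<ge>n. Poly_Mapping.lookup x i = 0)"
  by (auto simp: Rn_def subset_eq) (metis in_keys_iff linorder_not_le)+

lemma subspace_Rn: "subspace (Rn n)"
  by (auto simp: subspace_def Rn_iff lookup_add)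

lemma Rn_span: "Rn n \<subseteq> span ((\<lambda>i. Poly_Mapping.single i 1) ` {..<n})"
proof
  fix x assume x: "x \<in> Rn n"
  have "x = (\<Sum>i<n. Poly_Mapping.lookup x i *\<^sub>R Poly_Mapping.single i 1)"
    by (rule poly_mapping_eqI)
      (use x in \<open>auto simp: lookup_sum lookup_single when_def Rn_iff if_distrib cong: if_cong\<close>)
  moreover have "\<dots> \<in> span ((\<lambda>i. Poly_Mapping.single i 1) ` {..<n})"
    by (intro span_sum span_scale span_base) auto
  ultimately show "x \<in> span ((\<lambda>i. Poly_Mapping.single i 1) ` {..<n})" by simp
qed

text \<open>\<open>Q\<close> is the slice at height 1 of the cone generated by the pairs
  \<open>(v, 1)\<close>. Elimination describes this cone by linear inequalities, and an irredundant
  selection is no larger than the number of facets.\<close>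

lemma facet_representation:
  assumes Q: "polytope_in n Q" "Q \<noteq> {}"
  shows "\<exists>L. finite L \<and> (\<forall>l\<in>L. linear l) \<and> Q = {x \<in> affine hull Q. \<forall>l\<in>L. (0::real) \<le> l (x, 1::real)} \<and>
    card L \<le> polytope_size Q"
proof -
  obtain S where S: "finite S" "Q = convex hull S" using Q(1) by (auto simp: polytope_in_def polytope_def)
  have QR: "Q \<subseteq> Rn n" using Q(1) by (simp add: polytope_in_def)
  then have SR: "S \<subseteq> Rn n" using S(2) hull_subset[of S convex] by simp
  let ?B = "insert snd ((\<lambda>i x. Poly_Mapping.lookup (fst x) i) ` {..<n}) :: (point \<times> real \<Rightarrow> real) set"
  have "\<exists>L. finite L \<and> (\<forall>l\<in>L. linear l) \<and>
    (\<forall>x\<in>Rn n \<times> (UNIV :: real set). x \<in> pos ((\<lambda>v. (v, 1)) ` S) \<longleftrightarrow> (\<forall>l\<in>L. (0::real) \<le> l x))"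
  proof (rule pos_halfspaces[of _ ?B])
    show "subspace (Rn n \<times> (UNIV :: real set))" using subspace_Rn[of n]
      by (auto simp: subspace_def zero_prod_def)
    show "linear f" if "f \<in> ?B" for f using that by (auto simp: linear_iff lookup_add)
    show "x = 0" if "x \<in> Rn n \<times> UNIV" "\<forall>f\<in>?B. f x = 0" for x
    proof -
      have "fst x = 0"
      proof (rule poly_mapping_eqI)
        fix k show "Poly_Mapping.lookup (fst x) k = Poly_Mapping.lookup 0 k"
          by (cases "k < n") (use that in \<open>auto simp: Rn_iff\<close>)
      qed
      moreover have "snd x = 0" using that(2) by simp
      ultimately show "x = 0" by (simp add: prod_eq_iff)
    qed
  qed (use S SR in auto)
  then obtain L where "finite L" and lL: "\<forall>l\<in>L. linear l"
    and pL: "\<forall>x\<in>Rn n \<times> (UNIV :: real set). x \<in> pos ((\<lambda>v. (v, 1)) ` S) \<longleftrightarrow> (\<forall>l\<in>L. (0::real) \<le> l x)"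
    by (elim exE conjE)
  have pL1: "(x, 1) \<in> pos ((\<lambda>v. (v, 1::real)) ` S) \<longleftrightarrow> (\<forall>l\<in>L. 0 \<le> l (x, 1))" if "x \<in> Rn n" for x
    by (rule bspec[OF pL]) (use that in simp)
  note L = \<open>finite L\<close> lL[rule_format] pL1
  have hull: "x \<in> Q \<longleftrightarrow> (x, 1) \<in> pos ((\<lambda>v. (v, 1::real)) ` S)" for x
  proof -
    have inj: "inj_on (\<lambda>v. (v, 1::real)) S" by (auto simp: inj_on_def)
    have "(x, 1) \<in> pos ((\<lambda>v. (v, 1::real)) ` S) \<longleftrightarrow>
       (\<exists>c. (\<forall>v\<in>S. 0 \<le> c (v, 1::real)) \<and> (x, 1) = (\<Sum>v\<in>S. c (v, 1) *\<^sub>R (v, 1::real)))"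
      by (simp add: pos_def sum.reindex[OF inj])
    also have "\<dots> \<longleftrightarrow> (\<exists>c. (\<forall>v\<in>S. 0 \<le> c v) \<and> (x, 1) = (\<Sum>v\<in>S. c v *\<^sub>R (v, 1::real)))"
      (is "(\<exists>c. ?P c) \<longleftrightarrow> (\<exists>c. ?R c)")
    proof
      assume "\<exists>c. ?P c"
      then obtain c where "?P c" ..
      then show "\<exists>c. ?R c" by (rule exI[of ?R "\<lambda>v. c (v, 1)"])
    next
      assume "\<exists>c. ?R c"
      then obtain c where "?R c" ..
      then have "?P (\<lambda>v. c (fst v))" by simp
      then show "\<exists>c. ?P c" by (rule exI[of ?P "\<lambda>v. c (fst v)"])
    qed
    also have "\<dots> \<longleftrightarrow> x \<in> Q"
      unfolding S(2) convex_hull_finite[OF S(1)] by (auto simp: prod_eq_iff fst_sum snd_sum)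
    finally show ?thesis by simp
  qed
  have AR: "affine hull Q \<subseteq> Rn n" by (rule hull_minimal[OF QR]) (simp add: subspace_Rn subspace_imp_affine)
  define L1 where "L1 = (\<lambda>l x. l (x, 1::real)) ` L"
  have "Q = {x \<in> affine hull Q. \<forall>l\<in>L1. 0 \<le> l x}"
    using hull L(3) AR hull_subset[of Q affine] by (auto simp: L1_def)
  from irredundant_subset[OF _ this] L(1) obtain L2 where L2: "L2 \<subseteq> L1" "Q = {x \<in> affine hull Q. \<forall>l\<in>L2. 0 \<le> l x}"
    "\<And>l. l \<in> L2 \<Longrightarrow> \<exists>x\<in>affine hull Q. l x < 0 \<and> (\<forall>l'\<in>L2 - {l}. 0 \<le> l' x)"
    by (auto simp: L1_def)
  have aff1: "aff l" if l: "l \<in> L1" for l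
  proof -
    obtain l' where l': "l' \<in> L" "l = (\<lambda>x. l' (x, 1))" using l by (auto simp: L1_def)
    have "l' (x + r *\<^sub>R (y - z), 1) = l' (x, 1) + r * (l' (y, 1) - l' (z, 1))" for x y z r
    proof -
      have "(x + r *\<^sub>R (y - z), 1) = (x, 1) + r *\<^sub>R ((y, 1) - (z, 1::real))" by simp
      then show ?thesis using L(2)[OF l'(1)] by (simp only: linear_add linear_scale linear_diff real_scaleR_def)
    qed
    then show ?thesis by (simp add: aff_def l')
  qed
  have fin: "finite L2" using L2(1) L(1) by (auto simp: L1_def intro: finite_subset)
  have "card L2 \<le> polytope_size Q"
  proof (rule card_irredundant_le_size[OF _ Q(2) _ _ fin _ L2(2,3)])
    show "polytope Q" using Q(1) by (simp add: polytope_in_def)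
    show "Q \<subseteq> span ((\<lambda>i. Poly_Mapping.single i 1) ` {..<n})" using QR Rn_span by blast
  qed (use L2(1) aff1 in auto)
  \<comment> \<open>Different homogeneous functionals may agree at height 1; one preimage for each
    affine functional preserves the count.\<close>
  moreover from subset_image_inj[THEN iffD1, OF L2(1)[unfolded L1_def]]
  obtain L3 where L3: "L3 \<subseteq> L" "inj_on (\<lambda>l x. l (x, 1::real)) L3" "L2 = (\<lambda>l x. l (x, 1::real)) ` L3"
    by (elim exE conjE)
  ultimately have le: "card L3 \<le> polytope_size Q" by (simp add: card_image)
  have "{x \<in> affine hull Q. \<forall>l\<in>L2. 0 \<le> l x} = {x \<in> affine hull Q. \<forall>l\<in>L3. 0 \<le> l (x, 1)}"
    unfolding L3(3) by simp
  with L2(2) have eq: "Q = {x \<in> affine hull Q. \<forall>l\<in>L3. 0 \<le> l (x, 1)}" by (rule trans)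
  have "finite L3" using L3(1) L(1) by (rule finite_subset)
  moreover have "\<forall>l\<in>L3. linear l" using L3(1) L(2) by blast
  ultimately show ?thesis using eq le by (intro exI[of _ L3] conjI)
qed

section \<open>Homogenization of an extension\<close>

definition hom :: "point \<times> real \<Rightarrow> real^3" where
  "hom x = vector [snd x, Poly_Mapping.lookup (fst x) 0, Poly_Mapping.lookup (fst x) 1]"

lemma hom_nth [simp]: "hom x $ 1 = snd x" "hom x $ 2 = Poly_Mapping.lookup (fst x) 0"
    "hom x $ 3 = Poly_Mapping.lookup (fst x) 1"
  by (simp_all add: hom_def)

lemma linear_hom: "linear hom"
  by (auto simp: linear_iff vec_eq_iff forall_3 lookup_add)

lemma hom_proj: "hom (proj 2 x, t) = hom (x, t)"
  by (simp add: hom_def lookup_proj)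

lemma bounded_lookup:
  assumes "polytope (Q :: point set)"
  shows "\<exists>B. \<forall>x\<in>Q. \<bar>Poly_Mapping.lookup x i\<bar> \<le> B"
proof -
  obtain S where S: "finite S" "Q = convex hull S" using assms by (auto simp: polytope_def)
  define B where "B = (\<Sum>v\<in>S. \<bar>Poly_Mapping.lookup v i\<bar>)"
  have "convex {x :: point. \<bar>Poly_Mapping.lookup x i\<bar> \<le> B}"
  proof (rule convexI)
    fix x y :: point and u w :: real
    assume a: "x \<in> {x. \<bar>Poly_Mapping.lookup x i\<bar> \<le> B}" "y \<in> {x. \<bar>Poly_Mapping.lookup x i\<bar> \<le> B}" "0 \<le> u" "0 \<le> w" "u + w = 1"
    have "\<bar>u * Poly_Mapping.lookup x i + w * Poly_Mapping.lookup y i\<bar> \<le> u * \<bar>Poly_Mapping.lookup x i\<bar> + w * \<bar>Poly_Mapping.lookup y i\<bar>"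
      using a by (intro order_trans[OF abs_triangle_ineq]) (simp add: abs_mult)
    also have "\<dots> \<le> u * B + w * B" using a by (intro add_mono mult_left_mono) auto
    also have "\<dots> = B" using a by (simp flip: distrib_right)
    finally show "u *\<^sub>R x + w *\<^sub>R y \<in> {x. \<bar>Poly_Mapping.lookup x i\<bar> \<le> B}" by (simp add: lookup_add)
  qed
  moreover have "S \<subseteq> {x. \<bar>Poly_Mapping.lookup x i\<bar> \<le> B}"
    using S(1) unfolding B_def by (auto intro: member_le_sum[where f = "\<lambda>v. \<bar>Poly_Mapping.lookup v i\<bar>"])
  ultimately have "Q \<subseteq> {x. \<bar>Poly_Mapping.lookup x i\<bar> \<le> B}" unfolding S(2) by (rule hull_minimal[rotated])
  then show ?thesis by blast
qed

lemma no_ray: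
  assumes "polytope (Q :: point set)" "\<And>r. 0 \<le> r \<Longrightarrow> y + r *\<^sub>R d \<in> Q"
  shows "d = 0"
proof (rule ccontr)
  assume "d \<noteq> 0"
  then obtain i where i: "Poly_Mapping.lookup d i \<noteq> 0" by (metis lookup_zero poly_mapping_eqI)
  obtain B where B: "\<And>x. x \<in> Q \<Longrightarrow> \<bar>Poly_Mapping.lookup x i\<bar> \<le> B" using bounded_lookup[OF assms(1)] by blast
  define r where "r = (2 * B + 1) / \<bar>Poly_Mapping.lookup d i\<bar>"
  have y: "\<bar>Poly_Mapping.lookup y i\<bar> \<le> B" using B[OF assms(2)[of 0]] by simp
  then have "0 \<le> B" by linarith
  then have "0 \<le> r" by (simp add: r_def)
  have "\<bar>Poly_Mapping.lookup y i + r * Poly_Mapping.lookup d i\<bar> \<le> B"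
    using B[OF assms(2)[OF \<open>0 \<le> r\<close>]] by (simp add: lookup_add)
  then have "\<bar>r * Poly_Mapping.lookup d i\<bar> \<le> 2 * B" using y by linarith
  moreover have "\<bar>r * Poly_Mapping.lookup d i\<bar> = 2 * B + 1"
    using \<open>0 \<le> r\<close> \<open>0 \<le> B\<close> i by (simp add: abs_mult r_def)
  ultimately show False by simp
qed

text \<open>The map sending \<open>(x, t)\<close> to \<open>x - t *\<^sub>R y0\<close> is linear and
  takes every generator to a direction of the affine hull of \<open>Q\<close>.\<close>

lemma homogenized_affine_hull:
  fixes y0 :: "'a::real_vector"
  assumes "y0 \<in> Q" "(x, t) \<in> span ((\<lambda>y. (y, 1::real)) ` Q)"
  shows "x - t *\<^sub>R y0 \<in> span ((\<lambda>x. -y0 + x) ` (Q - {y0}))"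
proof -
  let ?D = "span ((\<lambda>x. -y0 + x) ` (Q - {y0}))"
  have "(\<lambda>y. (y, 1::real)) ` Q \<subseteq> {v. fst v - snd v *\<^sub>R y0 \<in> ?D}"
  proof
    fix w assume "w \<in> (\<lambda>y. (y, 1::real)) ` Q"
    then obtain y where y: "y \<in> Q" "w = (y, 1)" by auto
    have "y - y0 \<in> ?D"
    proof (cases "y = y0")
      case False
      then have "-y0 + y \<in> ?D" using y(1) by (intro span_base imageI) auto
      then show ?thesis by simp
    qed (simp add: span_zero)
    then show "w \<in> {v. fst v - snd v *\<^sub>R y0 \<in> ?D}" using y(2) by simp
  qed
  moreover have "subspace {v. fst v - snd v *\<^sub>R y0 \<in> ?D}"
    unfolding subspace_def
  proof (intro conjI ballI allI)
    fix a b :: "'a \<times> real" assume "a \<in> {v. fst v - snd v *\<^sub>R y0 \<in> ?D}" "b \<in> {v. fst v - snd v *\<^sub>R y0 \<in> ?D}"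
    then have "(fst a - snd a *\<^sub>R y0) + (fst b - snd b *\<^sub>R y0) \<in> ?D" by (intro span_add) auto
    then show "a + b \<in> {v. fst v - snd v *\<^sub>R y0 \<in> ?D}" by (simp add: algebra_simps)
  next
    fix a :: "'a \<times> real" and c assume "a \<in> {v. fst v - snd v *\<^sub>R y0 \<in> ?D}"
    then have "c *\<^sub>R (fst a - snd a *\<^sub>R y0) \<in> ?D" by (intro span_scale) auto
    then show "c *\<^sub>R a \<in> {v. fst v - snd v *\<^sub>R y0 \<in> ?D}" by (simp add: algebra_simps)
  qed (simp add: span_zero)
  ultimately have "span ((\<lambda>y. (y, 1::real)) ` Q) \<subseteq> {v. fst v - snd v *\<^sub>R y0 \<in> ?D}" by (rule span_minimal)
  then show ?thesis using assms(2) by auto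
qed

theorem extension_has_hidden_vertex:
  fixes Q :: "point set" and p :: "nat \<Rightarrow> point"
  assumes Q: "polytope_in n Q" and size: "polytope_size Q \<le> 6"
    and P: "proj 2 ` Q = convex hull (p ` {..<7})"
    and orient: "\<And>i j k. i < j \<Longrightarrow> j < k \<Longrightarrow> k < 7 \<Longrightarrow> 0 < brk (hom (p i, 1)) (hom (p j, 1)) (hom (p k, 1))"
    and no_concurrent: "\<And>i1 i2 i3 i4 i5 i6. {i1, i2, i3, i4, i5, i6} \<subseteq> {..<7} \<Longrightarrow>
        distinct [i1, i2, i3, i4, i5, i6] \<Longrightarrow>
        brk (cross3 (hom (p i1, 1)) (hom (p i2, 1))) (cross3 (hom (p i3, 1)) (hom (p i4, 1)))
          (cross3 (hom (p i5, 1)) (hom (p i6, 1))) \<noteq> 0"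
    and no_collinear: "\<And>u1 u2 u3 u4 u5 u6 u7. {u1, u2, u3, u4, u5, u6, u7} \<subseteq> {..<7} \<Longrightarrow>
        distinct [u1, u2, u3, u4, u5, u6, u7] \<Longrightarrow>
        brk (cross3 (cross3 (hom (p u1, 1)) (hom (p u2, 1))) (cross3 (hom (p u3, 1)) (hom (p u4, 1))))
            (cross3 (cross3 (hom (p u2, 1)) (hom (p u5, 1))) (cross3 (hom (p u4, 1)) (hom (p u6, 1))))
            (cross3 (cross3 (hom (p u3, 1)) (hom (p u7, 1))) (cross3 (hom (p u1, 1)) (hom (p u5, 1)))) \<noteq> 0"
  shows "\<exists>x\<in>vertices Q. proj 2 x \<notin> p ` {..<7}"
proof (rule ccontr)
  assume "\<not> ?thesis"
  then have vert: "\<And>x. x extreme_point_of Q \<Longrightarrow> \<exists>i<7. proj 2 x = p i" by (auto simp: vertices_def)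
  define v where "v i = hom (p i, 1)" for i
  interpret oriented_heptagon v by unfold_locales (simp add: v_def orient)
  have poly: "polytope Q" using Q by (simp add: polytope_in_def)
  have "\<forall>i\<in>{..<7::nat}. \<exists>y\<in>Q. proj 2 y = p i"
  proof
    fix i :: nat assume "i \<in> {..<7}"
    then have "p i \<in> proj 2 ` Q" unfolding P by (intro hull_inc) auto
    then show "\<exists>y\<in>Q. proj 2 y = p i" by auto
  qed
  then obtain y where y: "\<And>i. i < 7 \<Longrightarrow> y i \<in> Q \<and> proj 2 (y i) = p i" by (metis lessThan_iff)
  have ne: "Q \<noteq> {}" using y[of 0] by auto
  have hom_y: "hom (y i, 1) = v i" if "i < 7" for i
    using hom_proj[of "y i" 1] y[OF that] by (simp add: v_def)
  have "y 0 \<noteq> y 1" using hom_y[of 0] hom_y[of 1] v_not_parallel[of 0 1 1] by auto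
  from facet_representation[OF Q ne] obtain L where finL: "finite L" and lL: "\<forall>l\<in>L. linear l"
    and rep: "Q = {x \<in> affine hull Q. \<forall>l\<in>L. (0::real) \<le> l (x, 1::real)}" and cardL: "card L \<le> polytope_size Q"
    by (elim exE conjE)
  have "card L \<le> card (UNIV :: 6 set)" using cardL size by simp
  then obtain g :: "(point \<times> real \<Rightarrow> real) \<Rightarrow> 6" where g: "inj_on g L"
    using card_le_inj[OF finL finite] by metis
  \<comment> \<open>Coordinates to which no functional is assigned get the zero functional, so fewer
    than six inequalities also yield vectors in \<open>real^6\<close>.\<close>
  define lf where "lf j = (if j \<in> g ` L then inv_into L g j else (\<lambda>_. 0))" for j
  have lin: "linear (lf j)" for j
    using lL by (auto simp: lf_def inv_into_into linear_zero)
  have lf_g: "lf (g l) = l" if "l \<in> L" for l using that g by (simp add: lf_def)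
  have nonneg: "0 \<le> lf j (x, 1)" if "x \<in> Q" for j x
  proof (cases "j \<in> g ` L")
    case True
    then have "lf j \<in> L" by (auto simp: lf_def inv_into_into)
    moreover have "x \<in> {x \<in> affine hull Q. \<forall>l\<in>L. 0 \<le> l (x, 1)}" using that by (simp only: rep[symmetric])
    ultimately show ?thesis by simp
  qed (simp add: lf_def)
  have QI: "x \<in> Q" if "x \<in> affine hull Q" "\<And>j. 0 \<le> lf j (x, 1)" for x
  proof -
    have "0 \<le> l (x, 1)" if "l \<in> L" for l using lf_g[OF that] \<open>\<And>j. 0 \<le> lf j (x, 1)\<close>[of "g l"] by simp
    then have "x \<in> {x \<in> affine hull Q. \<forall>l\<in>L. 0 \<le> l (x, 1)}" using that(1) by simp
    then show ?thesis by (simp only: rep[symmetric])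
  qed
  define T :: "point \<times> real \<Rightarrow> real^6" where "T x = (\<chi> j. lf j x)" for x
  have linT: "linear T"
    by (rule linearI) (simp_all add: T_def vec_eq_iff linear_add[OF lin] linear_scale[OF lin])
  define Vs where "Vs = span ((\<lambda>y. (y, 1::real)) ` Q)"
  have subV: "subspace Vs" by (simp add: Vs_def)
  define y0 where "y0 = y 0"
  have y0: "y0 \<in> Q" using y[of 0] by (simp add: y0_def)
  define D where "D = span ((\<lambda>x. -y0 + x) ` (Q - {y0}))"
  have A: "x \<in> affine hull Q \<longleftrightarrow> x - y0 \<in> D" for x
    unfolding affine_hull_span2[OF y0] D_def by (auto simp: image_iff algebra_simps intro: bexI[of _ "x - y0"])
  have VsD: "x - t *\<^sub>R y0 \<in> D" if "(x, t) \<in> Vs" for x t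
    using homogenized_affine_hull[OF y0] that by (simp add: Vs_def D_def)
  \<comment> \<open>A nonzero direction with nonnegative slacks would start a ray inside the bounded
    set \<open>Q\<close>.\<close>
  have ray: "d = 0" if d: "d \<in> D" "\<And>j. 0 \<le> lf j (d, 0)" for d
  proof (rule no_ray[OF poly])
    fix r :: real assume r: "0 \<le> r"
    show "y0 + r *\<^sub>R d \<in> Q"
    proof (rule QI)
      show "y0 + r *\<^sub>R d \<in> affine hull Q" using d(1) by (simp add: A D_def span_scale)
      fix j
      have "(y0 + r *\<^sub>R d, 1) = (y0, 1) + r *\<^sub>R (d, 0::real)" by simp
      then have "lf j (y0 + r *\<^sub>R d, 1) = lf j (y0, 1) + r * lf j (d, 0)"
        by (simp only: linear_add[OF lin] linear_scale[OF lin] real_scaleR_def)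
      then show "0 \<le> lf j (y0 + r *\<^sub>R d, 1)" using nonneg[OF y0] d(2) r by simp
    qed
  qed
  have D_diff: "x - x' \<in> D" if "x \<in> affine hull Q" "x' \<in> affine hull Q" for x x'
  proof -
    have "(x - y0) - (x' - y0) \<in> D" using that unfolding A D_def by (rule span_diff)
    then show ?thesis by simp
  qed
  have cone: "w = 0 \<or> (\<exists>t>0. \<exists>x\<in>Q. w = t *\<^sub>R (x, 1))" if w: "w \<in> Vs" "\<And>j. 0 \<le> lf j w" for w
  proof -
    obtain d t where dt: "w = (d, t)" by (cases w)
    have D: "d - t *\<^sub>R y0 \<in> D" using VsD w(1) dt by simp
    have hull: "(1 / t) *\<^sub>R d \<in> affine hull Q" if "t \<noteq> 0"
    proof -
      have "(1 / t) *\<^sub>R (d - t *\<^sub>R y0) \<in> D" using D unfolding D_def by (rule span_scale)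
      then show ?thesis using that by (simp add: A scaleR_diff_right)
    qed
    have val: "lf j ((1 / t) *\<^sub>R d, 1) = (1 / t) * lf j w" if "t \<noteq> 0" for j
    proof -
      have "((1 / t) *\<^sub>R d, 1) = (1 / t) *\<^sub>R w" using that by (simp add: dt)
      then show ?thesis by (simp only: linear_scale[OF lin] real_scaleR_def)
    qed
    consider "t = 0" | "0 < t" | "t < 0" by linarith
    then show ?thesis
    proof cases
      case 1
      then have "d = 0" using ray[of d] D w(2) dt by simp
      then show ?thesis using 1 dt by (simp add: zero_prod_def)
    next
      case 2
      then have "(1 / t) *\<^sub>R d \<in> Q" using hull val w(2) by (intro QI) auto
      moreover have "w = t *\<^sub>R ((1 / t) *\<^sub>R d, 1)" using 2 by (simp add: dt)
      ultimately show ?thesis using 2 by blast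
    next
      \<comment> \<open>At negative height, the difference of any point of \<open>Q\<close> and the
        rescaled vector has nonnegative slacks and must vanish. Then \<open>Q\<close> would be a
        single point, although \<open>y 0\<close> and \<open>y 1\<close> differ.\<close>
      case 3
      have "z = (1 / t) *\<^sub>R d" if z: "z \<in> Q" for z
      proof -
        have "z - (1 / t) *\<^sub>R d \<in> D" using z 3 hull by (intro D_diff) (auto intro: hull_inc)
        moreover have "0 \<le> lf j (z - (1 / t) *\<^sub>R d, 0)" for j
        proof -
          have "(z - (1 / t) *\<^sub>R d, 0) = (z, 1) - ((1 / t) *\<^sub>R d, 1::real)" by simp
          then have "lf j (z - (1 / t) *\<^sub>R d, 0) = lf j (z, 1) - lf j ((1 / t) *\<^sub>R d, 1)"
            by (simp only: linear_diff[OF lin])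
          also have "\<dots> = lf j (z, 1) - (1 / t) * lf j w" using val 3 by simp
          finally show ?thesis using nonneg[OF z, of j] w(2)[of j] 3 by (simp add: divide_nonneg_neg order_trans[of _ 0])
        qed
        ultimately show ?thesis using ray by fastforce
      qed
      from this[of "y 0"] this[of "y 1"] y[of 0] y[of 1] have "y 0 = y 1" by simp
      then show ?thesis using \<open>y 0 \<noteq> y 1\<close> by simp
    qed
  qed
  \<comment> \<open>A nonzero vector without slack lies in the cone together with its negative, but
    nonzero cone vectors have positive height.\<close>
  have kernel: "w = 0" if w: "w \<in> Vs" "T w = 0" for w
  proof (rule ccontr)
    assume "w \<noteq> 0"
    have z: "lf j w = 0" for j using w(2) by (simp add: T_def vec_eq_iff)
    obtain t x where t: "0 < t" "w = t *\<^sub>R (x, 1)" using cone[OF w(1)] z \<open>w \<noteq> 0\<close> by auto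
    have "- w \<in> Vs" using w(1) subV by (rule subspace_neg[rotated])
    moreover have "0 \<le> lf j (- w)" for j using linear_neg[OF lin, of j w] z by simp
    ultimately obtain t' x' where "0 < t'" "- w = t' *\<^sub>R (x', 1)" using cone[of "- w"] \<open>w \<noteq> 0\<close> by auto
    then have "snd (- w) = t'" by simp
    moreover have "snd (- w) = - t" using t(2) by simp
    ultimately show False using t(1) \<open>0 < t'\<close> by simp
  qed
  have injT: "inj_on T Vs"
  proof (rule inj_onI)
    fix a b assume ab: "a \<in> Vs" "b \<in> Vs" "T a = T b"
    then have "T (a - b) = 0" by (simp add: linear_diff[OF linT])
    then show "a = b" using kernel[of "a - b"] ab subV by (simp add: subspace_diff)
  qed
  \<comment> \<open>Slacks determine the points of \<open>Vs\<close>; composing this inverse with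
    \<open>hom\<close> expresses the projection in slack coordinates.\<close>
  obtain G where G: "linear G" "\<And>w. w \<in> Vs \<Longrightarrow> G (T w) = w"
    using linear_exists_left_inverse_on[OF linT subV injT] by blast
  define U where "U = T ` Vs"
  define M where "M s = hom (G s)" for s
  have MT: "M (T w) = hom w" if "w \<in> Vs" for w using G(2)[OF that] by (simp add: M_def)
  define q where "q i = T (y i, 1)" for i
  have inV: "(x, 1) \<in> Vs" if "x \<in> Q" for x using that by (simp add: Vs_def span_base)
  have hom_pos: "hom (t *\<^sub>R (x, 1)) = t *\<^sub>R hom (proj 2 x, 1)" for t x
    using linear_scale[OF linear_hom, of t "(x, 1)"] by (simp add: hom_proj)
  have "lifted_heptagon v U M q"
  proof (intro lifted_heptagon.intro lifted_heptagon_axioms.intro)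
    show "oriented_heptagon v" by unfold_locales
    show "subspace U" unfolding U_def using linT subV by (rule linear_subspace_image)
    show "linear M" unfolding M_def using linear_compose[OF G(1) linear_hom] by (simp add: o_def)
    show "CARD(6) \<le> 6" by simp
    show "q i \<in> U" if "i < 7" for i using y[OF that] by (simp add: q_def U_def inV)
    show "0 \<le> q i $ j" if "i < 7" for i j using y[OF that] by (simp add: q_def T_def nonneg)
    show "M (q i) = v i" if "i < 7" for i using y[OF that] hom_y[OF that] unfolding q_def by (simp only: MT inV)
    show "U \<subseteq> span {s \<in> U. \<forall>j. 0 \<le> s $ j}"
    proof -
      have "U = span (T ` (\<lambda>y. (y, 1)) ` Q)" unfolding U_def Vs_def by (rule linear_span_image[OF linT, symmetric])
      moreover have "T ` (\<lambda>y. (y, 1)) ` Q \<subseteq> {s \<in> U. \<forall>j. 0 \<le> s $ j}"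
        by (auto simp: U_def inV T_def nonneg)
      ultimately show ?thesis using span_mono by blast
    qed
    show "0 \<le> side i (M s)" if i: "i < 7" and s: "s \<in> U" "\<forall>j. 0 \<le> s $ j" for i s
    proof -
      obtain w where w: "w \<in> Vs" "s = T w" using s(1) by (auto simp: U_def)
      have nn: "0 \<le> lf j w" for j using s(2) w(2) by (simp add: T_def)
      consider "w = 0" | t x where "0 < t" "x \<in> Q" "w = t *\<^sub>R (x, 1)" using cone[OF w(1) nn] by blast
      then show ?thesis
      proof cases
        case 1
        then show ?thesis using MT[OF w(1)] w(2) by (simp add: linear_0[OF linear_hom])
      next
        case (2 t x)
        have "convex {z. 0 \<le> side i (hom (z, 1))}"
        proof (rule convexI)
          fix a b and r r' :: real
          assume ab: "a \<in> {z. 0 \<le> side i (hom (z, 1))}" "b \<in> {z. 0 \<le> side i (hom (z, 1))}" "0 \<le> r" "0 \<le> r'" "r + r' = 1"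
          have "(r *\<^sub>R a + r' *\<^sub>R b, 1) = r *\<^sub>R (a, 1) + r' *\<^sub>R (b, 1::real)" using ab(5) by simp
          then have "hom (r *\<^sub>R a + r' *\<^sub>R b, 1) = r *\<^sub>R hom (a, 1) + r' *\<^sub>R hom (b, 1)"
            by (simp only: linear_add[OF linear_hom] linear_scale[OF linear_hom])
          then show "r *\<^sub>R a + r' *\<^sub>R b \<in> {z. 0 \<le> side i (hom (z, 1))}" using ab by simp
        qed
        moreover have "p ` {..<7} \<subseteq> {z. 0 \<le> side i (hom (z, 1))}" using side_nonneg[OF i] by (auto simp: v_def)
        ultimately have "convex hull (p ` {..<7}) \<subseteq> {z. 0 \<le> side i (hom (z, 1))}" by (rule hull_minimal[rotated])
        then have "0 \<le> side i (hom (proj 2 x, 1))" using 2(2) P by blast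
        moreover have "M s = t *\<^sub>R hom (proj 2 x, 1)"
          using MT[OF w(1)] w(2) unfolding 2(3) hom_pos by simp
        ultimately show ?thesis using 2(1) by simp
      qed
    qed
    show "s = 0" if s: "s \<in> U" "\<forall>j. 0 \<le> s $ j" "M s = 0" for s
    proof -
      obtain w where w: "w \<in> Vs" "s = T w" using s(1) by (auto simp: U_def)
      have nn: "0 \<le> lf j w" for j using s(2) w(2) by (simp add: T_def)
      have "hom w = 0" using MT[OF w(1)] w(2) s(3) by simp
      then have "snd w = 0" by (metis hom_nth(1) zero_index)
      then have "w = 0" using cone[OF w(1) nn] by auto
      then show ?thesis using w(2) linear_0[OF linT] by simp
    qed
    show "\<exists>i<7. \<exists>t>0. M s = t *\<^sub>R v i"
      if s: "s \<in> U" "\<forall>j. 0 \<le> s $ j" "s \<noteq> 0"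
        and min: "\<And>s'. s' \<in> U \<Longrightarrow> \<forall>j. 0 \<le> s' $ j \<Longrightarrow> \<forall>j. s $ j = 0 \<longrightarrow> s' $ j = 0 \<Longrightarrow> \<exists>t. s' = t *\<^sub>R s" for s
    proof -
      obtain w where w: "w \<in> Vs" "s = T w" using s(1) by (auto simp: U_def)
      have nn: "0 \<le> lf j w" for j using s(2) w(2) by (simp add: T_def)
      have "w \<noteq> 0" using w(2) s(3) linear_0[OF linT] by auto
      then obtain t x where t: "0 < t" "x \<in> Q" "w = t *\<^sub>R (x, 1)" using cone[OF w(1) nn] by auto
      \<comment> \<open>If \<open>x\<close> were inside a segment, each slack vanishing at
        \<open>x\<close> would vanish at the end \<open>a\<close>. Minimality makes
        \<open>(a, 1)\<close> a multiple of \<open>(x, 1)\<close>, and equal heights give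
        \<open>a = x\<close>.\<close>
      have "x extreme_point_of Q"
        unfolding extreme_point_of_def
      proof (intro conjI ballI notI)
        fix a b assume ab: "a \<in> Q" "b \<in> Q" "x \<in> open_segment a b"
        then obtain u where u: "0 < u" "u < 1" "x = (1 - u) *\<^sub>R a + u *\<^sub>R b" by (auto simp: in_segment)
        have "lf j (a, 1) = 0" if "s $ j = 0" for j
        proof -
          have "lf j (t *\<^sub>R (x, 1)) = 0" using that w(2) t(3) by (simp add: T_def)
          then have "lf j (x, 1) = 0" using t(1) by (simp only: linear_scale[OF lin]) simp
          moreover have "(x, 1) = (1 - u) *\<^sub>R (a, 1) + u *\<^sub>R (b, 1::real)" using u(3) by simp
          ultimately have "(1 - u) * lf j (a, 1) + u * lf j (b, 1) = 0"
            by (simp only: linear_add[OF lin] linear_scale[OF lin] real_scaleR_def)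
          moreover have "0 \<le> (1 - u) * lf j (a, 1)" "0 \<le> u * lf j (b, 1)" using nonneg ab u by auto
          ultimately have "(1 - u) * lf j (a, 1) = 0" by linarith
          then show ?thesis using u by simp
        qed
        moreover have "T (a, 1) \<in> U" using inV[OF ab(1)] by (simp add: U_def)
        ultimately obtain r where "T (a, 1) = r *\<^sub>R s" using min[of "T (a, 1)"] nonneg[OF ab(1)] by (auto simp: T_def)
        then have "T (a, 1) = T (r *\<^sub>R w)" using w(2) by (simp add: linear_scale[OF linT])
        then have "(a, 1) = r *\<^sub>R w" using injT inV[OF ab(1)] w(1) subV by (auto simp: inj_on_def subspace_scale)
        then have "a = (r * t) *\<^sub>R x" "1 = r * t" using t(3) by auto
        then have "a = x" by simp
        then show False using ab(3) by (simp add: open_segment_def)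
      qed (use t in auto)
      then obtain i where "i < 7" "proj 2 x = p i" using vert by blast
      moreover have "M s = t *\<^sub>R hom (proj 2 x, 1)"
        using MT[OF w(1)] w(2) unfolding t(3) hom_pos by simp
      ultimately have "M s = t *\<^sub>R v i" by (simp add: v_def)
      then show ?thesis using \<open>i < 7\<close> t(1) by blast
    qed
  qed (use no_concurrent no_collinear in \<open>simp_all only: v_def not_False_eq_True\<close>)
  then show False by (rule lifted_heptagon.contradiction)
qed

section \<open>Cyclic labelling and general position\<close>

text \<open>A generating set of least cardinality contains no redundant point, so all of its points
  are extreme.\<close>

lemma polytope_hull_vertices:
  fixes P :: "'a::real_vector set"
  assumes "polytope P"
  shows "P = convex hull (vertices P)"
proof -
  obtain S0 where "finite S0 \<and> convex hull S0 = P" using assms by (auto simp: polytope_def)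
  then obtain S where S: "finite S \<and> convex hull S = P"
    "\<And>T. finite T \<and> convex hull T = P \<Longrightarrow> card S \<le> card T"
    using exists_least_iff[of "\<lambda>k. \<exists>S. finite S \<and> convex hull S = P \<and> card S = k"] by (metis leI)
  have "x extreme_point_of P" if x: "x \<in> S" for x
  proof -
    have ins: "insert x (S - {x}) = S" using x by auto
    have "x \<notin> convex hull (S - {x})"
    proof
      assume "x \<in> convex hull (S - {x})"
      then have "convex hull (insert x (S - {x})) = convex hull (S - {x})" by (rule hull_redundant)
      then have "convex hull (S - {x}) = P" using S(1) ins by simp
      then have "card S \<le> card (S - {x})" using S by simp
      then show False using x S(1) by (metis card_Diff1_less not_le)
    qed
    then have "x extreme_point_of convex hull (insert x (S - {x}))"
      using S(1) by (intro extreme_point_of_convex_hull_insert) auto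
    then show ?thesis using S(1) ins by simp
  qed
  then have "S \<subseteq> vertices P" by (auto simp: vertices_def)
  moreover have "vertices P \<subseteq> S"
    using S(1) extreme_point_of_convex_hull by (auto simp: vertices_def)
  ultimately show ?thesis using S(1) by auto
qed

lemma vertex_not_in_hull_others:
  fixes P :: "'a::real_vector set"
  assumes "polytope P" "x \<in> vertices P"
  shows "x \<notin> convex hull (vertices P - {x})"
proof
  assume "x \<in> convex hull (vertices P - {x})"
  then have "convex hull (insert x (vertices P - {x})) = convex hull (vertices P - {x})" by (rule hull_redundant)
  moreover have "insert x (vertices P - {x}) = vertices P" using assms(2) by auto
  ultimately have "P = convex hull (vertices P - {x})" using polytope_hull_vertices[OF assms(1)] by simp
  moreover have "x extreme_point_of P" using assms(2) by (simp add: vertices_def)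
  ultimately have "x \<in> vertices P - {x}" using extreme_point_of_convex_hull by metis
  then show False by simp
qed

lemma Rn2_eqI:
  fixes x y :: point
  assumes "x \<in> Rn 2" "y \<in> Rn 2" "Poly_Mapping.lookup x 0 = Poly_Mapping.lookup y 0"
    "Poly_Mapping.lookup x 1 = Poly_Mapping.lookup y 1"
  shows "x = y"
proof (rule poly_mapping_eqI)
  fix k :: nat
  consider "k = 0" | "k = 1" | "2 \<le> k" by linarith
  then show "Poly_Mapping.lookup x k = Poly_Mapping.lookup y k"
    by cases (use assms in \<open>auto simp: Rn_iff\<close>)
qed

lemma brk_hom: "brk (hom (a, 1)) (hom (b, 1)) (hom (c, 1)) =
   (Poly_Mapping.lookup b 0 - Poly_Mapping.lookup a 0) * (Poly_Mapping.lookup c 1 - Poly_Mapping.lookup a 1)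
   - (Poly_Mapping.lookup b 1 - Poly_Mapping.lookup a 1) * (Poly_Mapping.lookup c 0 - Poly_Mapping.lookup a 0)"
  by (simp add: brk_def cross3_def inner_vec_def sum_3 vector_3) (simp add: algebra_simps)

lemma exposing_functional:
  assumes "finite W" "W \<subseteq> Rn 2" "v \<in> Rn 2" "v \<notin> convex hull W"
  shows "\<exists>a b. \<forall>x\<in>W. 0 < a * (Poly_Mapping.lookup x 0 - Poly_Mapping.lookup v 0) + b * (Poly_Mapping.lookup x 1 - Poly_Mapping.lookup v 1)"
proof -
  \<comment> \<open>The separation takes place in \<open>real \<times> real\<close>, into which
    \<open>f\<close> maps \<open>Rn 2\<close> injectively.\<close>
  define f :: "point \<Rightarrow> real \<times> real" where "f x = (Poly_Mapping.lookup x 0, Poly_Mapping.lookup x 1)" for x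
  have lin: "linear f" by (auto simp: linear_iff f_def lookup_add)
  have hull: "convex hull W \<subseteq> Rn 2" by (rule hull_minimal[OF assms(2)]) (simp add: subspace_Rn subspace_imp_convex)
  have "f v \<notin> f ` (convex hull W)"
  proof
    assume "f v \<in> f ` (convex hull W)"
    then obtain x where "x \<in> convex hull W" "f v = f x" by auto
    then have "v = x" using Rn2_eqI[of v x] hull assms(3) by (auto simp: f_def)
    then show False using assms(4) \<open>x \<in> convex hull W\<close> by simp
  qed
  then have "f v \<notin> convex hull (f ` W)" by (simp add: convex_hull_linear_image[OF lin])
  moreover have "closed (convex hull (f ` W))"
    using assms(1) by (simp add: compact_imp_closed finite_imp_compact_convex_hull)
  ultimately obtain c d where cd: "c \<bullet> f v < d" "\<And>x. x \<in> convex hull (f ` W) \<Longrightarrow> d < c \<bullet> x"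
    using separating_hyperplane_closed_point[of "convex hull (f ` W)" "f v"] by auto
  have "0 < fst c * (Poly_Mapping.lookup x 0 - Poly_Mapping.lookup v 0) + snd c * (Poly_Mapping.lookup x 1 - Poly_Mapping.lookup v 1)"
    if "x \<in> W" for x
  proof -
    have "c \<bullet> f v < c \<bullet> f x" using cd(1) cd(2)[of "f x"] that by (meson hull_inc imageI less_trans)
    then show ?thesis by (simp add: f_def inner_prod_def algebra_simps)
  qed
  then show ?thesis by blast
qed

text \<open>From one vertex the other six are seen within an open half-plane and can be sorted by
  angle. Convex position then determines the remaining orientations.\<close>

lemma heptagon_labelling:
  assumes P: "polytope_in 2 P" "card (vertices P) = 7"
  shows "\<exists>p :: nat \<Rightarrow> point. vertices P = p ` {..<7} \<and> inj_on p {..<7} \<and>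
    (\<forall>i j k. i < j \<and> j < k \<and> k < 7 \<longrightarrow> 0 < brk (hom (p i, 1)) (hom (p j, 1)) (hom (p k, 1)))"
proof -
  define V where "V = vertices P"
  have poly: "polytope P" and sub: "P \<subseteq> Rn 2" using P(1) by (auto simp: polytope_in_def)
  have VP: "V \<subseteq> P" by (auto simp: V_def vertices_def extreme_point_of_def)
  have VR: "V \<subseteq> Rn 2" using VP sub by blast
  have fin: "finite V" and card: "card V = 7" using P(2) unfolding V_def by (auto intro: card_ge_0_finite)
  have nin: "x \<notin> convex hull (V - {x})" if "x \<in> V" for x
    using vertex_not_in_hull_others[OF poly] that by (simp add: V_def)
  have ext: "x \<notin> open_segment a b" if "x \<in> V" "a \<in> V" "b \<in> V" for x a b
    using that VP by (auto simp: V_def vertices_def extreme_point_of_def)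
  obtain v where v: "v \<in> V" using card by fastforce
  define W where "W = V - {v}"
  have W: "finite W" "card W = 6" "W \<subseteq> V" "v \<notin> W" using fin card v by (auto simp: W_def)
  obtain a b where ab: "\<And>x. x \<in> W \<Longrightarrow> 0 < a * (Poly_Mapping.lookup x 0 - Poly_Mapping.lookup v 0) + b * (Poly_Mapping.lookup x 1 - Poly_Mapping.lookup v 1)"
    using exposing_functional[of W v] W v VR nin[OF v] by (metis W_def subset_trans subsetD)
  define t s where "t x = a * (Poly_Mapping.lookup x 0 - Poly_Mapping.lookup v 0) + b * (Poly_Mapping.lookup x 1 - Poly_Mapping.lookup v 1)"
    and "s x = a * (Poly_Mapping.lookup x 1 - Poly_Mapping.lookup v 1) - b * (Poly_Mapping.lookup x 0 - Poly_Mapping.lookup v 0)" for x :: point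
  have t: "0 < t x" if "x \<in> W" for x using ab[OF that] by (simp add: t_def)
  define c where "c = a\<^sup>2 + b\<^sup>2"
  have c: "0 < c"
  proof -
    obtain x where "x \<in> W" using W(2) by fastforce
    then have "a \<noteq> 0 \<or> b \<noteq> 0" using ab by fastforce
    then show ?thesis by (simp add: c_def sum_power2_gt_zero_iff)
  qed
  have cross: "c * brk (hom (v, 1)) (hom (x, 1)) (hom (y, 1)) = t x * s y - s x * t y" for x y
    unfolding brk_hom c_def t_def s_def by (simp add: algebra_simps power2_eq_square)
  \<comment> \<open>In the frame with axis \<open>(a, b)\<close> this is the slope of the ray from
    \<open>v\<close> to \<open>x\<close>; by \<open>cross\<close>, comparing slopes is the same as
    the sign of the bracket.\<close>
  define key where "key x = s x / t x" for x
  have key_less: "0 < brk (hom (v, 1)) (hom (x, 1)) (hom (y, 1))" if "x \<in> W" "y \<in> W" "key x < key y" for x y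
  proof -
    have "s x * t y < s y * t x" using that t by (simp add: key_def divide_less_eq less_divide_eq field_simps)
    then have "0 < c * brk (hom (v, 1)) (hom (x, 1)) (hom (y, 1))" unfolding cross by (simp add: mult.commute)
    then show ?thesis using c by (simp add: zero_less_mult_iff)
  qed
  have coord: "c * (Poly_Mapping.lookup x 0 - Poly_Mapping.lookup v 0) = a * t x - b * s x"
    "c * (Poly_Mapping.lookup x 1 - Poly_Mapping.lookup v 1) = b * t x + a * s x" for x
    by (simp_all add: c_def t_def s_def algebra_simps power2_eq_square)
  \<comment> \<open>Equal slopes would put one vertex on the open segment from \<open>v\<close> to
    another, contrary to extremality.\<close>
  have seg: False if xy: "x \<in> W" "y \<in> W" "x \<noteq> y" "key x = key y" "t x \<le> t y" for x y
  proof -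
    define r where "r = t x / t y"
    have r: "0 < r" "r \<le> 1" using t xy by (auto simp: r_def)
    have tx: "t x = r * t y" using t[OF xy(2)] by (simp add: r_def)
    have "s x = key x * t x" "s y = key y * t y" using t[OF xy(1)] t[OF xy(2)] by (simp_all add: key_def)
    then have sx: "s x = r * s y" using xy(4) tx by simp
    have "c * (Poly_Mapping.lookup x 0 - Poly_Mapping.lookup v 0) = c * (r * (Poly_Mapping.lookup y 0 - Poly_Mapping.lookup v 0))"
      "c * (Poly_Mapping.lookup x 1 - Poly_Mapping.lookup v 1) = c * (r * (Poly_Mapping.lookup y 1 - Poly_Mapping.lookup v 1))"
      unfolding coord mult.left_commute[of c r] tx sx by (simp_all add: algebra_simps)
    then have e: "Poly_Mapping.lookup x 0 - Poly_Mapping.lookup v 0 = r * (Poly_Mapping.lookup y 0 - Poly_Mapping.lookup v 0)"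
      "Poly_Mapping.lookup x 1 - Poly_Mapping.lookup v 1 = r * (Poly_Mapping.lookup y 1 - Poly_Mapping.lookup v 1)"
      using c by simp_all
    have R: "x \<in> Rn 2" "y \<in> Rn 2" "v \<in> Rn 2" using xy W v VR by auto
    have "x = (1 - r) *\<^sub>R v + r *\<^sub>R y"
    proof (rule Rn2_eqI)
      show "(1 - r) *\<^sub>R v + r *\<^sub>R y \<in> Rn 2" using R subspace_Rn[of 2] by (intro subspace_add subspace_scale)
    qed (use e R in \<open>simp_all add: lookup_add lookup_minus algebra_simps\<close>)
    moreover have "v \<noteq> y" using xy W by auto
    moreover have "r < 1"
    proof (rule ccontr)
      assume "\<not> r < 1"
      then have "r = 1" using r by simp
      then show False using \<open>x = (1 - r) *\<^sub>R v + r *\<^sub>R y\<close> xy(3) by simp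
    qed
    ultimately have "x \<in> open_segment v y" using r by (auto simp: in_segment)
    then show False using ext xy W v by blast
  qed
  have inj_key: "inj_on key W"
  proof (rule inj_onI, rule ccontr)
    fix x y assume "x \<in> W" "y \<in> W" "key x = key y" "x \<noteq> y"
    then show False using seg[of x y] seg[of y x] by (cases "t x \<le> t y") auto
  qed
  define ks where "ks = sorted_list_of_set (key ` W)"
  have ks: "length ks = 6" "set ks = key ` W" "sorted_wrt (<) ks"
    using W inj_key by (simp_all add: ks_def card_image)
  define p where "p i = (if i = 0 then v else inv_into W key (ks ! (i - 1)))" for i
  have pW: "p i \<in> W \<and> key (p i) = ks ! (i - 1)" if "0 < i" "i < 7" for i
  proof -
    have "ks ! (i - 1) \<in> key ` W" using ks(1) that unfolding ks(2)[symmetric] by (intro nth_mem) auto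
    then show ?thesis using that by (auto simp: p_def inv_into_into f_inv_into_f)
  qed
  have less: "key (p i) < key (p j)" if "0 < i" "i < j" "j < 7" for i j
    using pW[of i] pW[of j] that sorted_wrt_nth_less[OF ks(3), of "i - 1" "j - 1"] ks(1) by auto
  have pos0: "0 < brk (hom (p 0, 1)) (hom (p i, 1)) (hom (p j, 1))" if "0 < i" "i < j" "j < 7" for i j
  proof -
    have "p 0 = v" by (simp add: p_def)
    then show ?thesis using key_less[OF _ _ less[OF that]] pW[of i] pW[of j] that by simp
  qed
  have inj: "inj_on p {..<7}"
  proof (rule inj_onI, rule ccontr)
    fix i j assume ij: "i \<in> {..<7}" "j \<in> {..<7}" "p i = p j" "i \<noteq> j"
    have no: False if "i < j" "j < 7" "p i = p j" for i j
    proof (cases "i = 0")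
      case True
      then show False using that pW[of j] W(4) by (simp add: p_def)
    next
      case False
      then show False using less[of i j] that by simp
    qed
    show False using no[of i j] no[of j i] ij by (cases "i < j") auto
  qed
  have pV: "p i \<in> V" if "i < 7" for i using pW[of i] W that v by (cases "i = 0") (auto simp: p_def)
  have img: "p ` {..<7} = V"
    by (rule card_subset_eq[OF fin]) (use pV inj card in \<open>auto simp: card_image\<close>)
  have orient: "0 < brk (hom (p i, 1)) (hom (p j, 1)) (hom (p k, 1))" if ijk: "i < j" "j < k" "k < 7" for i j k
  proof (cases "i = 0")
    case True
    then show ?thesis using pos0[of j k] ijk by simp
  next
    case False
    define A B C E where "A = brk (hom (p 0, 1)) (hom (p i, 1)) (hom (p j, 1))"
      and "B = brk (hom (p 0, 1)) (hom (p j, 1)) (hom (p k, 1))"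
      and "C = brk (hom (p 0, 1)) (hom (p i, 1)) (hom (p k, 1))"
      and "E = brk (hom (p i, 1)) (hom (p j, 1)) (hom (p k, 1))"
    have pos: "0 < A" "0 < B" "0 < C" unfolding A_def B_def C_def using pos0 False ijk by auto
    have sum: "A + B = C + E" unfolding A_def B_def C_def E_def brk_hom by (simp add: algebra_simps)
    \<comment> \<open>Cramer's relation among the four points. If \<open>E\<close> were not
      positive, it would exhibit \<open>p j\<close> as a convex combination of \<open>p 0\<close>,
      \<open>p i\<close>, \<open>p k\<close>.\<close>
    have co: "C * Poly_Mapping.lookup (p j) m = - E * Poly_Mapping.lookup (p 0) m + B * Poly_Mapping.lookup (p i) m + A * Poly_Mapping.lookup (p k) m"
      if "m = 0 \<or> m = 1" for m
      using that unfolding A_def B_def C_def E_def brk_hom by (auto simp: algebra_simps)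
    show ?thesis
    proof (rule ccontr)
      assume "\<not> ?thesis"
      then have E: "E \<le> 0" by (simp add: E_def)
      define \<alpha> \<beta> \<gamma> where "\<alpha> = - E / C" and "\<beta> = B / C" and "\<gamma> = A / C"
      have nn: "0 \<le> \<alpha>" "0 \<le> \<beta>" "0 \<le> \<gamma>" using pos E by (auto simp: \<alpha>_def \<beta>_def \<gamma>_def divide_nonpos_pos)
      have one: "\<alpha> + \<beta> + \<gamma> = 1" using sum pos by (simp add: \<alpha>_def \<beta>_def \<gamma>_def field_simps)
      have R: "p 0 \<in> Rn 2" "p i \<in> Rn 2" "p j \<in> Rn 2" "p k \<in> Rn 2" using pV VR ijk by auto
      have co': "Poly_Mapping.lookup (p j) m = \<alpha> * Poly_Mapping.lookup (p 0) m + \<beta> * Poly_Mapping.lookup (p i) m + \<gamma> * Poly_Mapping.lookup (p k) m"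
        if "m = 0 \<or> m = 1" for m
        using co[OF that] pos by (simp add: \<alpha>_def \<beta>_def \<gamma>_def field_simps)
      have "p j = \<alpha> *\<^sub>R p 0 + \<beta> *\<^sub>R p i + \<gamma> *\<^sub>R p k"
      proof (rule Rn2_eqI)
        show "\<alpha> *\<^sub>R p 0 + \<beta> *\<^sub>R p i + \<gamma> *\<^sub>R p k \<in> Rn 2" using R subspace_Rn[of 2] by (intro subspace_add subspace_scale)
      qed (use co' R in \<open>auto simp: lookup_add\<close>)
      also have "\<dots> \<in> convex hull {p 0, p i, p k}"
        unfolding convex_hull_3 using nn one by blast
      also have "\<dots> \<subseteq> convex hull (V - {p j})"
      proof (rule hull_mono)
        have "p 0 \<noteq> p j" "p i \<noteq> p j" "p k \<noteq> p j" using inj_on_eq_iff[OF inj, of _ j] ijk by auto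
        then show "{p 0, p i, p k} \<subseteq> V - {p j}" using pV ijk by auto
      qed
      finally show False using nin pV[of j] ijk by auto
    qed
  qed
  show ?thesis
  proof (rule exI[of _ p], intro conjI allI impI)
    show "vertices P = p ` {..<7}" using img by (simp add: V_def)
    show "inj_on p {..<7}" by (rule inj)
    fix i j k :: nat assume "i < j \<and> j < k \<and> k < 7"
    then show "0 < brk (hom (p i, 1)) (hom (p j, 1)) (hom (p k, 1))" using orient by simp
  qed
qed

section \<open>Lines, intersection points and general position in terms of brackets\<close>

lemma line_eq: "line u v = range (\<lambda>r. u + r *\<^sub>R (v - u))"
  unfolding line_def by (rule affine_hull_2_alt)

lemma line_Rn: "u \<in> Rn 2 \<Longrightarrow> v \<in> Rn 2 \<Longrightarrow> line u v \<subseteq> Rn 2"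
  using subspace_Rn[of 2] by (auto simp: line_eq intro: subspace_add subspace_scale subspace_diff)

lemma brk_line:
  assumes "x \<in> line u v"
  shows "brk (hom (u, 1)) (hom (v, 1)) (hom (x, 1)) = 0"
proof -
  obtain r where x: "x = u + r *\<^sub>R (v - u)" using assms by (auto simp: line_eq)
  show ?thesis unfolding x brk_hom by (simp add: lookup_add lookup_minus)
qed

lemma point_on_line:
  assumes R: "x \<in> Rn 2" "u \<in> Rn 2" "v \<in> Rn 2" and "u \<noteq> v"
    and "brk (hom (u, 1)) (hom (v, 1)) (hom (x, 1)) = 0"
  shows "x \<in> line u v"
proof -
  define d0 d1 where "d0 = Poly_Mapping.lookup v 0 - Poly_Mapping.lookup u 0"
    and "d1 = Poly_Mapping.lookup v 1 - Poly_Mapping.lookup u 1"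
  have d: "d0 \<noteq> 0 \<or> d1 \<noteq> 0" using Rn2_eqI[OF R(3,2)] assms(4) by (auto simp: d0_def d1_def)
  have eq: "d0 * (Poly_Mapping.lookup x 1 - Poly_Mapping.lookup u 1) = d1 * (Poly_Mapping.lookup x 0 - Poly_Mapping.lookup u 0)"
    using assms(5) by (simp add: brk_hom d0_def d1_def)
  define r where "r = (if d0 \<noteq> 0 then (Poly_Mapping.lookup x 0 - Poly_Mapping.lookup u 0) / d0
    else (Poly_Mapping.lookup x 1 - Poly_Mapping.lookup u 1) / d1)"
  have r: "Poly_Mapping.lookup x 0 - Poly_Mapping.lookup u 0 = r * d0"
    "Poly_Mapping.lookup x 1 - Poly_Mapping.lookup u 1 = r * d1"
    using d eq by (auto simp: r_def field_simps)
  have "x = u + r *\<^sub>R (v - u)"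
  proof (rule Rn2_eqI)
    show "u + r *\<^sub>R (v - u) \<in> Rn 2" using R subspace_Rn[of 2] by (intro subspace_add subspace_scale subspace_diff)
  qed (use r R in \<open>simp_all add: lookup_add lookup_minus d0_def d1_def\<close>)
  then show ?thesis by (auto simp: line_eq)
qed

lemma cross_lines_fst:
  "cross3 (cross3 (hom (u1, 1)) (hom (u2, 1))) (cross3 (hom (u3, 1)) (hom (u4, 1))) $ 1 =
   (Poly_Mapping.lookup u2 0 - Poly_Mapping.lookup u1 0) * (Poly_Mapping.lookup u4 1 - Poly_Mapping.lookup u3 1)
   - (Poly_Mapping.lookup u2 1 - Poly_Mapping.lookup u1 1) * (Poly_Mapping.lookup u4 0 - Poly_Mapping.lookup u3 0)"
  by (simp add: cross3_def vector_3) (simp add: algebra_simps)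

text \<open>The first coordinate of the cross product of two lines is the determinant of their
  directions.\<close>

lemma parallel_lines:
  assumes R: "u1 \<in> Rn 2" "u2 \<in> Rn 2" "u3 \<in> Rn 2" "u4 \<in> Rn 2" and ne: "u1 \<noteq> u2" "u3 \<noteq> u4"
    and z: "cross3 (cross3 (hom (u1, 1)) (hom (u2, 1))) (cross3 (hom (u3, 1)) (hom (u4, 1))) $ 1 = 0"
  shows "affine_parallel (line u1 u2) (line u3 u4)"
proof -
  define d e where "d = u2 - u1" and "e = u4 - u3"
  have dR: "d \<in> Rn 2" "e \<in> Rn 2" using R subspace_Rn[of 2] by (auto simp: d_def e_def subspace_diff)
  have "u1 + e \<in> line u1 u2"
  proof (rule point_on_line[OF _ R(1,2) ne(1)])
    show "u1 + e \<in> Rn 2" using R dR subspace_Rn[of 2] by (auto simp: subspace_add)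
    show "brk (hom (u1, 1)) (hom (u2, 1)) (hom (u1 + e, 1)) = 0"
      using z unfolding cross_lines_fst brk_hom by (simp add: lookup_add lookup_minus e_def)
  qed
  then obtain c where "u1 + e = u1 + c *\<^sub>R (u2 - u1)" unfolding line_eq by blast
  then have "e = c *\<^sub>R d" by (simp add: d_def)
  moreover have "c \<noteq> 0" using \<open>e = c *\<^sub>R d\<close> ne(2) by (auto simp: e_def)
  ultimately have "u3 + r *\<^sub>R e = u3 + (r * c) *\<^sub>R d" "u3 + r *\<^sub>R d = u3 + (r / c) *\<^sub>R e" for r by auto
  then have "range (\<lambda>r. u3 + r *\<^sub>R e) = range (\<lambda>r. u3 + r *\<^sub>R d)" by (blast intro: range_eqI)
  also have "\<dots> = (\<lambda>x. (u3 - u1) + x) ` range (\<lambda>r. u1 + r *\<^sub>R d)" by (simp add: image_image)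
  finally have "line u3 u4 = (\<lambda>x. (u3 - u1) + x) ` line u1 u2"
    unfolding line_eq d_def[symmetric] e_def[symmetric] .
  then show ?thesis unfolding affine_parallel_def by blast
qed

lemma point_of_vector:
  assumes "t $ 1 \<noteq> 0"
  obtains x where "x \<in> Rn 2" "hom (x, 1) = (1 / t $ 1) *\<^sub>R t"
proof
  let ?x = "Poly_Mapping.single 0 (t $ 2 / t $ 1) + Poly_Mapping.single 1 (t $ 3 / t $ 1) :: point"
  show "?x \<in> Rn 2" by (auto simp: Rn_iff lookup_add lookup_single)
  show "hom (?x, 1) = (1 / t $ 1) *\<^sub>R t" using assms by (simp add: vec_eq_iff forall_3 lookup_add lookup_single)
qed

lemma brk_scale_hom: "brk a b ((1 / r) *\<^sub>R t) = (1 / r) * (cross3 a b \<bullet> t)"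
  by (simp add: brk_def)

lemma lines_meet:
  assumes R: "{u1, u2, u3, u4} \<subseteq> Rn 2" and ne: "u1 \<noteq> u2" "u3 \<noteq> u4" and x: "x \<in> Rn 2"
    and t: "t = cross3 (cross3 (hom (u1, 1)) (hom (u2, 1))) (cross3 (hom (u3, 1)) (hom (u4, 1)))" "t $ 1 \<noteq> 0"
    and hx: "hom (x, 1) = (1 / t $ 1) *\<^sub>R t"
  shows "line u1 u2 \<inter> line u3 u4 = {x}"
proof
  have "cross3 (hom (u1, 1)) (hom (u2, 1)) \<bullet> t = 0" "cross3 (hom (u3, 1)) (hom (u4, 1)) \<bullet> t = 0"
    unfolding t(1) by (rule dot_cross_self)+
  then have "x \<in> line u1 u2" "x \<in> line u3 u4"
    using R ne x by (auto intro!: point_on_line simp: hx brk_scale_hom simp del: brk_linear)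
  then show "{x} \<subseteq> line u1 u2 \<inter> line u3 u4" by simp
  show "line u1 u2 \<inter> line u3 u4 \<subseteq> {x}"
  proof
    fix y assume y: "y \<in> line u1 u2 \<inter> line u3 u4"
    let ?l = "cross3 (hom (u1, 1)) (hom (u2, 1))" and ?m = "cross3 (hom (u3, 1)) (hom (u4, 1))" and ?h = "hom (y, 1)"
    have z: "?l \<bullet> ?h = 0" "?m \<bullet> ?h = 0" using brk_line[of y] y by (auto simp: brk_def)
    have "cross3 (cross3 l m) h = (l \<bullet> h) *\<^sub>R m - (m \<bullet> h) *\<^sub>R l" for l m h :: "real^3"
      by (simp add: cross3_simps forall_3)
    then have "cross3 t ?h = (?l \<bullet> ?h) *\<^sub>R ?m - (?m \<bullet> ?h) *\<^sub>R ?l" unfolding t(1) .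
    then have "cross3 t ?h = 0" unfolding z by simp
    then have "cross3 t ?h $ 2 = 0" "cross3 t ?h $ 3 = 0" by simp_all
    then have "t $ 3 = t $ 1 * Poly_Mapping.lookup y 1" "t $ 2 = t $ 1 * Poly_Mapping.lookup y 0"
      by (simp_all add: cross3_def vector_3)
    moreover have "hom (x, 1) $ 2 = t $ 2 / t $ 1" "hom (x, 1) $ 3 = t $ 3 / t $ 1" unfolding hx by simp_all
    ultimately have "Poly_Mapping.lookup y 0 = Poly_Mapping.lookup x 0" "Poly_Mapping.lookup y 1 = Poly_Mapping.lookup x 1"
      using t(2) by simp_all
    moreover have "y \<in> Rn 2" using y line_Rn R by auto
    ultimately show "y \<in> {x}" using Rn2_eqI x by simp
  qed
qed

lemma collinear_points:
  assumes R: "x \<in> Rn 2" "y \<in> Rn 2" "z \<in> Rn 2" and "brk (hom (x, 1)) (hom (y, 1)) (hom (z, 1)) = 0"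
  shows "collinear {x, y, z}"
proof -
  have "\<exists>u. \<exists>r s. y = x + r *\<^sub>R u \<and> z = x + s *\<^sub>R u"
  proof (cases "x = y")
    case True
    then show ?thesis by (intro exI[of _ "z - x"] exI[of _ 0] exI[of _ 1]) auto
  next
    case False
    then have "z \<in> line x y" using point_on_line assms by blast
    then obtain s where "z = x + s *\<^sub>R (y - x)" by (auto simp: line_eq)
    then show ?thesis by (intro exI[of _ "y - x"] exI[of _ 1] exI[of _ s]) auto
  qed
  then obtain u r s where e: "y = x + r *\<^sub>R u" "z = x + s *\<^sub>R u" by blast
  have "\<exists>c. a - b = c *\<^sub>R u" if "a \<in> {x, y, z}" "b \<in> {x, y, z}" for a b
  proof -
    have "\<exists>\<alpha>. a = x + \<alpha> *\<^sub>R u" "\<exists>\<beta>. b = x + \<beta> *\<^sub>R u" using that e by (auto intro: exI[of _ 0])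
    then obtain \<alpha> \<beta> where "a = x + \<alpha> *\<^sub>R u" "b = x + \<beta> *\<^sub>R u" by blast
    then have "a - b = (\<alpha> - \<beta>) *\<^sub>R u" by (simp add: algebra_simps)
    then show ?thesis ..
  qed
  then show ?thesis unfolding collinear_def by blast
qed

context
  fixes P :: "point set"
  assumes gp: "general_position P" and R: "vertices P \<subseteq> Rn 2"
begin

lemma gp_not_parallel:
  assumes "{u1, u2, u3, u4} \<subseteq> vertices P" "distinct [u1, u2, u3, u4]"
  shows "cross3 (cross3 (hom (u1, 1)) (hom (u2, 1))) (cross3 (hom (u3, 1)) (hom (u4, 1))) $ 1 \<noteq> 0"
proof
  assume "cross3 (cross3 (hom (u1, 1)) (hom (u2, 1))) (cross3 (hom (u3, 1)) (hom (u4, 1))) $ 1 = 0"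
  then have "affine_parallel (line u1 u2) (line u3 u4)"
    using assms R by (intro parallel_lines) auto
  with gp[unfolded general_position_def, THEN conjunct1] assms show False by (metis (no_types, lifting))
qed

text \<open>Condition (1) makes the first coordinate of the intersection vector nonzero, so the
  vector can be normalized to a point of the plane.\<close>

lemma gp_meet:
  assumes "{u1, u2, u3, u4} \<subseteq> vertices P" "distinct [u1, u2, u3, u4]"
  obtains x r where "x \<in> Rn 2" "r \<noteq> 0" "line u1 u2 \<inter> line u3 u4 = {x}"
    "cross3 (cross3 (hom (u1, 1)) (hom (u2, 1))) (cross3 (hom (u3, 1)) (hom (u4, 1))) = r *\<^sub>R hom (x, 1)"
proof -
  define t where "t = cross3 (cross3 (hom (u1, 1)) (hom (u2, 1))) (cross3 (hom (u3, 1)) (hom (u4, 1)))"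
  have t1: "t $ 1 \<noteq> 0" unfolding t_def by (rule gp_not_parallel[OF assms])
  obtain x where x: "x \<in> Rn 2" "hom (x, 1) = (1 / t $ 1) *\<^sub>R t" using point_of_vector[OF t1] .
  have meet: "line u1 u2 \<inter> line u3 u4 = {x}"
    by (rule lines_meet[OF _ _ _ x(1) t_def t1 x(2)]) (use assms R in auto)
  have t: "t = (t $ 1) *\<^sub>R hom (x, 1)" using x(2) t1 by simp
  show ?thesis by (rule that[OF x(1) t1 meet]) (fold t_def, rule t)
qed

lemma gp_no_concurrent:
  assumes V: "{u1, u2, u3, u4, u5, u6} \<subseteq> vertices P" and dist: "distinct [u1, u2, u3, u4, u5, u6]"
  shows "brk (cross3 (hom (u1, 1)) (hom (u2, 1))) (cross3 (hom (u3, 1)) (hom (u4, 1))) (cross3 (hom (u5, 1)) (hom (u6, 1))) \<noteq> 0"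
proof
  assume z: "brk (cross3 (hom (u1, 1)) (hom (u2, 1))) (cross3 (hom (u3, 1)) (hom (u4, 1))) (cross3 (hom (u5, 1)) (hom (u6, 1))) = 0"
  obtain x r where x: "x \<in> Rn 2" "r \<noteq> 0" "line u1 u2 \<inter> line u3 u4 = {x}"
    "cross3 (cross3 (hom (u1, 1)) (hom (u2, 1))) (cross3 (hom (u3, 1)) (hom (u4, 1))) = r *\<^sub>R hom (x, 1)"
    by (rule gp_meet[of u1 u2 u3 u4]) (use V dist in auto)
  have "r * brk (hom (u5, 1)) (hom (u6, 1)) (hom (x, 1)) = 0"
    using z unfolding brk_def x(4) by (simp add: inner_commute)
  then have "brk (hom (u5, 1)) (hom (u6, 1)) (hom (x, 1)) = 0" using x(2) by simp
  then have "x \<in> line u5 u6" using V R dist x(1) by (intro point_on_line) auto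
  then have "line u1 u2 \<inter> line u3 u4 \<inter> line u5 u6 \<noteq> {}" using x(3) by blast
  then show False using gp V dist unfolding general_position_def by blast
qed

lemma gp_no_collinear:
  assumes V: "{u1, u2, u3, u4, u5, u6, u7} \<subseteq> vertices P" and dist: "distinct [u1, u2, u3, u4, u5, u6, u7]"
  shows "brk (cross3 (cross3 (hom (u1, 1)) (hom (u2, 1))) (cross3 (hom (u3, 1)) (hom (u4, 1))))
            (cross3 (cross3 (hom (u2, 1)) (hom (u5, 1))) (cross3 (hom (u4, 1)) (hom (u6, 1))))
            (cross3 (cross3 (hom (u3, 1)) (hom (u7, 1))) (cross3 (hom (u1, 1)) (hom (u5, 1)))) \<noteq> 0"
proof
  assume z: "brk (cross3 (cross3 (hom (u1, 1)) (hom (u2, 1))) (cross3 (hom (u3, 1)) (hom (u4, 1))))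
            (cross3 (cross3 (hom (u2, 1)) (hom (u5, 1))) (cross3 (hom (u4, 1)) (hom (u6, 1))))
            (cross3 (cross3 (hom (u3, 1)) (hom (u7, 1))) (cross3 (hom (u1, 1)) (hom (u5, 1)))) = 0"
  obtain a r where a: "a \<in> Rn 2" "r \<noteq> 0" "line u1 u2 \<inter> line u3 u4 = {a}"
    "cross3 (cross3 (hom (u1, 1)) (hom (u2, 1))) (cross3 (hom (u3, 1)) (hom (u4, 1))) = r *\<^sub>R hom (a, 1)"
    by (rule gp_meet[of u1 u2 u3 u4]) (use V dist in auto)
  obtain b s where b: "b \<in> Rn 2" "s \<noteq> 0" "line u2 u5 \<inter> line u4 u6 = {b}"
    "cross3 (cross3 (hom (u2, 1)) (hom (u5, 1))) (cross3 (hom (u4, 1)) (hom (u6, 1))) = s *\<^sub>R hom (b, 1)"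
    by (rule gp_meet[of u2 u5 u4 u6]) (use V dist in auto)
  obtain c t where c: "c \<in> Rn 2" "t \<noteq> 0" "line u3 u7 \<inter> line u1 u5 = {c}"
    "cross3 (cross3 (hom (u3, 1)) (hom (u7, 1))) (cross3 (hom (u1, 1)) (hom (u5, 1))) = t *\<^sub>R hom (c, 1)"
    by (rule gp_meet[of u3 u7 u1 u5]) (use V dist in auto)
  have "r * s * t * brk (hom (a, 1)) (hom (b, 1)) (hom (c, 1)) = 0"
    using z unfolding a(4) b(4) c(4) by (auto simp: brk_def cross_mult_left cross_mult_right)
  then have "brk (hom (a, 1)) (hom (b, 1)) (hom (c, 1)) = 0" using a(2) b(2) c(2) by simp
  then have "collinear {a, b, c}" by (rule collinear_points[OF a(1) b(1) c(1)])
  then show False using gp V dist a(3) b(3) c(3) unfolding general_position_def by blast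
qed

end

section \<open>A three-dimensional extension with six facets\<close>

lemma brk_pluecker: "brk p a c * brk p b d = brk p a b * brk p c d + brk p a d * brk p b c"
  by (simp add: brk_def cross3_simps)

context oriented_heptagon
begin

text \<open>A shift moves a final segment of the three indices to the front, a cyclic permutation
  that leaves the bracket unchanged.\<close>

lemma shifted: "oriented_heptagon (\<lambda>k. v ((k + n) mod 7))"
proof
  fix i j k :: nat assume o: "i < j" "j < k" "k < 7"
  define m where "m = n mod 7"
  have m: "m < 7" by (simp add: m_def)
  have eq: "(x + n) mod 7 = (if x + m < 7 then x + m else x + m - 7)" if "x < 7" for x
  proof -
    have "(x + n) mod 7 = (x + m) mod 7" by (simp add: m_def mod_add_right_eq)
    then show ?thesis using that m by (auto simp: mod_if)
  qed
  note e = eq[of i] eq[of j] eq[of k]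
  consider "k + m < 7" | "j + m < 7" "7 \<le> k + m" | "i + m < 7" "7 \<le> j + m" | "7 \<le> i + m" by linarith
  then show "0 < brk (v ((i + n) mod 7)) (v ((j + n) mod 7)) (v ((k + n) mod 7))"
  proof cases
    case 1
    then show ?thesis using o e orient[of "i + m" "j + m" "k + m"] by simp
  next
    case 2
    then have "0 < brk (v (k + m - 7)) (v (i + m)) (v (j + m))" using o m by (intro orient) auto
    then show ?thesis using o e 2 by (simp add: brk_rotate[of "v (i + m)" "v (j + m)" "v (k + m - 7)"])
  next
    case 3
    then have "0 < brk (v (j + m - 7)) (v (k + m - 7)) (v (i + m))" using o m by (intro orient) auto
    then show ?thesis using o e 3
      by (simp add: brk_rotate[of "v (j + m - 7)" "v (k + m - 7)" "v (i + m)"])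
  next
    case 4
    then have "0 < brk (v (i + m - 7)) (v (j + m - 7)) (v (k + m - 7))" using o m by (intro orient) auto
    then show ?thesis using o e 4 by simp
  qed
qed

end

definition rot :: "nat \<Rightarrow> (nat \<Rightarrow> real^3) \<Rightarrow> nat \<Rightarrow> real^3" where
  "rot n w k = w ((k + n) mod 7)"

text \<open>\<open>N1\<close> says that the lift of vertex 5 violates the upper bound hinged on the side 01, \<open>N2\<close> that the
  lift of vertex 2 violates the one hinged on the side 60.\<close>

definition N1 :: "(nat \<Rightarrow> real^3) \<Rightarrow> bool" where
  "N1 w \<longleftrightarrow> brk (w 0) (w 1) (w 5) * brk (w 2) (w 3) (w 4) < brk (w 0) (w 1) (w 2) * brk (w 3) (w 4) (w 5)"

definition N2 :: "(nat \<Rightarrow> real^3) \<Rightarrow> bool" where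
  "N2 w \<longleftrightarrow> brk (w 0) (w 2) (w 6) * brk (w 3) (w 4) (w 5) < brk (w 0) (w 5) (w 6) * brk (w 2) (w 3) (w 4)"

lemma rot_rot: "rot m (rot n w) = rot (m + n) w"
proof (rule ext)
  fix k
  have "((k + m) mod 7 + n) mod 7 = (k + (m + n)) mod 7" by presburger
  then show "rot m (rot n w) k = rot (m + n) w k" by (simp only: rot_def)
qed

lemma rot_period: "rot (n + 7) w = rot n w"
proof (rule ext)
  fix k
  have "(k + (n + 7)) mod 7 = (k + n) mod 7" by presburger
  then show "rot (n + 7) w k = rot n w k" by (simp only: rot_def)
qed

lemma rot_add: "rot (n + m) w k = rot n w (k + m)"
  by (simp add: rot_def add_ac)

lemma rot_wrap: "rot n w (k + 7) = rot n w k"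
proof -
  have "(k + 7 + n) mod 7 = (k + n) mod 7" by presburger
  then show ?thesis by (simp only: rot_def)
qed

lemma prod_cyclic_shift:
  fixes f :: "nat \<Rightarrow> real"
  assumes "\<And>i. f (i + 7) = f i"
  shows "(\<Prod>i<7. f (i + m)) = (\<Prod>i<7. f i)"
proof (induction m)
  case (Suc m)
  let ?g = "\<lambda>i. f (i + m)"
  have "(\<Prod>i<Suc 6. ?g (Suc i)) = (\<Prod>i<6. ?g (Suc i)) * ?g 7"
    unfolding prod.lessThan_Suc by (simp add: eval_nat_numeral)
  also have "?g 7 = ?g 0" using assms[of m] by (simp add: add.commute)
  also have "(\<Prod>i<6. ?g (Suc i)) * ?g 0 = (\<Prod>i<Suc 6. ?g i)" by (simp only: prod.lessThan_Suc_shift mult.commute)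
  finally have "(\<Prod>i<7. ?g (Suc i)) = (\<Prod>i<7. ?g i)" by simp
  then show ?case using Suc by simp
qed simp

context oriented_heptagon
begin

lemma oriented_rot: "oriented_heptagon (rot n v)"
  using shifted[of n] unfolding rot_def[abs_def] .

text \<open>The product of the two inequalities would make the quotient \<open>[01x] / [34x]\<close>
  smaller at vertex 5 than at vertex 6. Expanding \<open>v 6\<close> in \<open>v 4\<close>,
  \<open>v 5\<close>, \<open>v 0\<close> shows that it is larger at 5.\<close>

lemma N1_not_N2_rot: "N1 v \<Longrightarrow> \<not> N2 (rot 4 v)"
proof
  assume n: "N1 v" "N2 (rot 4 v)"
  let ?b = "\<lambda>i j k. brk (v i) (v j) (v k)"
  have pos: "0 < ?b 2 3 4" "0 < ?b 0 1 2" "0 < ?b 0 1 5" "0 < ?b 3 4 6" "0 < ?b 0 1 6" "0 < ?b 3 4 5" "0 < ?b 0 4 5"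
      "0 < ?b 0 3 4" "0 < ?b 4 5 6" "0 < ?b 0 1 4" "0 < ?b 0 5 6"
    by (simp_all add: orient)
  have a: "?b 0 1 5 * ?b 2 3 4 < ?b 0 1 2 * ?b 3 4 5" using n unfolding N1_def by auto
  have "brk (v 4) (v 6) (v 3) * ?b 0 1 2 < brk (v 4) (v 2) (v 3) * brk (v 6) (v 0) (v 1)"
    using n(2) by (simp add: N2_def rot_def)
  moreover have "brk (v 4) (v 6) (v 3) = ?b 3 4 6" "brk (v 4) (v 2) (v 3) = ?b 2 3 4" "brk (v 6) (v 0) (v 1) = ?b 0 1 6"
    by (metis brk_rotate)+
  ultimately have b: "?b 3 4 6 * ?b 0 1 2 < ?b 2 3 4 * ?b 0 1 6" by simp
  have "(?b 0 1 5 * ?b 2 3 4) * (?b 3 4 6 * ?b 0 1 2) < (?b 0 1 2 * ?b 3 4 5) * (?b 2 3 4 * ?b 0 1 6)"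
    by (rule mult_strict_mono[OF a b]) (use pos in auto)
  then have "(?b 2 3 4 * ?b 0 1 2) * (?b 0 1 5 * ?b 3 4 6) < (?b 2 3 4 * ?b 0 1 2) * (?b 0 1 6 * ?b 3 4 5)"
    by (simp only: mult.commute mult.left_commute mult.assoc)
  then have lt: "?b 0 1 5 * ?b 3 4 6 < ?b 0 1 6 * ?b 3 4 5" using pos by (simp add: mult_less_cancel_left_pos)
  have c: "?b 4 5 0 *\<^sub>R v 6 = ?b 6 5 0 *\<^sub>R v 4 + ?b 4 6 0 *\<^sub>R v 5 + ?b 4 5 6 *\<^sub>R v 0" by (rule brk_cramer)
  have rot: "?b 4 5 0 = ?b 0 4 5" "?b 6 5 0 = - ?b 0 5 6" "?b 3 4 0 = ?b 0 3 4"
    by (metis brk_rotate brk_swap(1))+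
  have "brk (v 3) (v 4) (?b 4 5 0 *\<^sub>R v 6) = brk (v 3) (v 4) (?b 6 5 0 *\<^sub>R v 4 + ?b 4 6 0 *\<^sub>R v 5 + ?b 4 5 6 *\<^sub>R v 0)"
    "brk (v 0) (v 1) (?b 4 5 0 *\<^sub>R v 6) = brk (v 0) (v 1) (?b 6 5 0 *\<^sub>R v 4 + ?b 4 6 0 *\<^sub>R v 5 + ?b 4 5 6 *\<^sub>R v 0)"
    by (simp_all only: c)
  then have e: "?b 0 4 5 * ?b 3 4 6 = ?b 4 6 0 * ?b 3 4 5 + ?b 4 5 6 * ?b 0 3 4"
    "?b 0 4 5 * ?b 0 1 6 = - ?b 0 5 6 * ?b 0 1 4 + ?b 4 6 0 * ?b 0 1 5"
    by (simp_all add: rot)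
  have "?b 0 4 5 * (?b 0 1 5 * ?b 3 4 6 - ?b 0 1 6 * ?b 3 4 5)
     = ?b 0 1 5 * (?b 0 4 5 * ?b 3 4 6) - ?b 3 4 5 * (?b 0 4 5 * ?b 0 1 6)" by (simp add: algebra_simps)
  also have "\<dots> = ?b 0 1 5 * (?b 4 5 6 * ?b 0 3 4) + ?b 3 4 5 * (?b 0 5 6 * ?b 0 1 4)"
    unfolding e by (simp add: algebra_simps)
  also have "\<dots> > 0" using pos by (simp add: add_pos_pos)
  finally show False using lt pos by (simp add: zero_less_mult_iff)
qed

text \<open>Multiplying the seven inequalities, and seven Pluecker inequalities, bounds the same quotient of
  cyclic products from both sides.\<close>

lemma not_all:
  shows "\<exists>i. \<not> N1 (rot i v)" and "\<exists>i. \<not> N2 (rot i v)"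
proof -
  define a c d g where "a i = brk (rot i v 0) (rot i v 1) (rot i v 2)" and "c i = brk (rot i v 0) (rot i v 2) (rot i v 4)"
    and "d i = brk (rot i v 0) (rot i v 1) (rot i v 5)" and "g i = brk (rot i v 0) (rot i v 1) (rot i v 3)" for i
  have pos: "0 < brk (rot i v x) (rot i v y) (rot i v z)" if "x < y" "y < z" "z < 7" for i x y z
    using oriented_heptagon.orient[OF oriented_rot that] .
  have p: "0 < a i" "0 < c i" "0 < d i" "0 < g i" for i
    by (simp_all add: a_def c_def d_def g_def pos)
  have w: "rot i v 7 = rot i v 0" "rot i v 8 = rot i v 1" "rot i v 9 = rot i v 2" "rot i v 10 = rot i v 3" "rot i v 11 = rot i v 4" for i
    using rot_wrap[of i v 0] rot_wrap[of i v 1] rot_wrap[of i v 2] rot_wrap[of i v 3] rot_wrap[of i v 4] by simp_all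
  have s: "a (i + 2) = brk (rot i v 2) (rot i v 3) (rot i v 4)" "a (i + 3) = brk (rot i v 3) (rot i v 4) (rot i v 5)"
    "a (i + 5) = brk (rot i v 0) (rot i v 5) (rot i v 6)" "c (i + 5) = brk (rot i v 0) (rot i v 2) (rot i v 5)"
    "d (i + 6) = brk (rot i v 0) (rot i v 4) (rot i v 6)" "g (i + 6) = brk (rot i v 0) (rot i v 2) (rot i v 6)"
    "c (i + 3) = brk (rot i v 0) (rot i v 3) (rot i v 5)" for i
  proof -
    note r = rot_add[of i _ v 0] rot_add[of i _ v 1] rot_add[of i _ v 2] rot_add[of i _ v 3] rot_add[of i _ v 4] rot_add[of i _ v 5]
    show "a (i + 2) = brk (rot i v 2) (rot i v 3) (rot i v 4)" "a (i + 3) = brk (rot i v 3) (rot i v 4) (rot i v 5)"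
      using r[of 2] r[of 3] by (simp_all add: a_def eval_nat_numeral)
    have "a (i + 5) = brk (rot i v 5) (rot i v 6) (rot i v 0)" using r[of 5] w[of i] by (simp add: a_def)
    then show "a (i + 5) = brk (rot i v 0) (rot i v 5) (rot i v 6)" by (metis brk_rotate)
    have "c (i + 5) = brk (rot i v 5) (rot i v 0) (rot i v 2)" using r[of 5] w[of i] by (simp add: c_def)
    then show "c (i + 5) = brk (rot i v 0) (rot i v 2) (rot i v 5)" by (metis brk_rotate)
    have "d (i + 6) = brk (rot i v 6) (rot i v 0) (rot i v 4)" using r[of 6] w[of i] by (simp add: d_def)
    then show "d (i + 6) = brk (rot i v 0) (rot i v 4) (rot i v 6)" by (metis brk_rotate)
    have "g (i + 6) = brk (rot i v 6) (rot i v 0) (rot i v 2)" using r[of 6] w[of i] by (simp add: g_def)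
    then show "g (i + 6) = brk (rot i v 0) (rot i v 2) (rot i v 6)" by (metis brk_rotate)
    have "c (i + 3) = brk (rot i v 3) (rot i v 5) (rot i v 0)" using r[of 3] w[of i] by (simp add: c_def)
    then show "c (i + 3) = brk (rot i v 0) (rot i v 3) (rot i v 5)" by (metis brk_rotate)
  qed
  have period: "a (i + 7) = a i" "c (i + 7) = c i" "d (i + 7) = d i" "g (i + 7) = g i" for i
    by (simp_all only: a_def c_def d_def g_def rot_period)
  define PA PC PD PG where "PA = prod a {..<7}" and "PC = prod c {..<7}" and "PD = prod d {..<7}" and "PG = prod g {..<7}"
  have P: "0 < PA" "0 < PC" "0 < PD" "0 < PG" using p by (auto simp: PA_def PC_def PD_def PG_def intro: prod_pos)
  note shift = prod_cyclic_shift[of a, OF period(1)] prod_cyclic_shift[of c, OF period(2)]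
    prod_cyclic_shift[of d, OF period(3)] prod_cyclic_shift[of g, OF period(4)]
  have mono: "(\<Prod>i<7. f i) < (\<Prod>i<7. h i)" if "\<And>i. 0 < f i" "\<And>i. f i < h i" for f h :: "nat \<Rightarrow> real"
    by (rule prod_mono_strict[of 0]) (use that in \<open>auto intro: less_imp_le order.strict_trans\<close>)
  have "(\<Prod>i<7. c i * a (i + 5)) < (\<Prod>i<7. c (i + 5) * d (i + 6))"
  proof (rule mono)
    fix i
    show "0 < c i * a (i + 5)" using p by simp
    have "c (i + 5) * d (i + 6) = c i * a (i + 5) + brk (rot i v 0) (rot i v 2) (rot i v 6) * brk (rot i v 0) (rot i v 4) (rot i v 5)"
      unfolding s c_def[of i] by (rule brk_pluecker)
    then show "c i * a (i + 5) < c (i + 5) * d (i + 6)" using pos[of 0 2 6 i] pos[of 0 4 5 i] by simp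
  qed
  moreover have "(\<Prod>i<7. c i * a (i + 5)) = PC * PA" "(\<Prod>i<7. c (i + 5) * d (i + 6)) = PC * PD"
    by (simp_all only: PA_def PC_def PD_def prod.distrib shift)
  ultimately have AD: "PA < PD" using P by simp
  have "(\<Prod>i<7. a i * c (i + 3)) < (\<Prod>i<7. g i * c (i + 5))"
  proof (rule mono)
    fix i
    show "0 < a i * c (i + 3)" using p by simp
    have "g i * c (i + 5) = a i * c (i + 3) + brk (rot i v 0) (rot i v 1) (rot i v 5) * brk (rot i v 0) (rot i v 2) (rot i v 3)"
      unfolding s a_def[of i] g_def[of i] by (rule brk_pluecker)
    then show "a i * c (i + 3) < g i * c (i + 5)" using pos[of 0 1 5 i] pos[of 0 2 3 i] by simp
  qed
  moreover have "(\<Prod>i<7. a i * c (i + 3)) = PA * PC" "(\<Prod>i<7. g i * c (i + 5)) = PG * PC"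
    by (simp_all only: PA_def PC_def PG_def prod.distrib shift)
  ultimately have AG: "PA < PG" using P by simp
  show "\<exists>i. \<not> N1 (rot i v)"
  proof (rule ccontr)
    assume "\<not> ?thesis"
    then have "d i * a (i + 2) < a i * a (i + 3)" for i
      unfolding s a_def[of i] d_def[of i] by (simp add: N1_def)
    then have "(\<Prod>i<7. d i * a (i + 2)) < (\<Prod>i<7. a i * a (i + 3))" using p by (intro mono) auto
    moreover have "(\<Prod>i<7. d i * a (i + 2)) = PD * PA" "(\<Prod>i<7. a i * a (i + 3)) = PA * PA"
      by (simp_all only: PA_def PD_def prod.distrib shift)
    ultimately show False using AD P by simp
  qed
  show "\<exists>i. \<not> N2 (rot i v)"
  proof (rule ccontr)
    assume "\<not> ?thesis"
    then have "g (i + 6) * a (i + 3) < a (i + 5) * a (i + 2)" for i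
      unfolding s by (simp add: N2_def)
    then have "(\<Prod>i<7. g (i + 6) * a (i + 3)) < (\<Prod>i<7. a (i + 5) * a (i + 2))" using p by (intro mono) auto
    moreover have "(\<Prod>i<7. g (i + 6) * a (i + 3)) = PG * PA" "(\<Prod>i<7. a (i + 5) * a (i + 2)) = PA * PA"
      by (simp_all only: PA_def PG_def prod.distrib shift)
    ultimately show False using AG P by simp
  qed
qed

text \<open>If every rotation failed, \<open>N1\<close> at \<open>n\<close> would exclude
  \<open>N2\<close> and force \<open>N1\<close> at \<open>n + 4\<close>, hence at
  \<open>n + 8\<close>, which is \<open>n + 1\<close> modulo 7. So \<open>N1\<close> would hold
  everywhere or nowhere, and in the latter case \<open>N2\<close> everywhere; \<open>not_all\<close>
  refutes both.\<close>

lemma good_rotation: "\<exists>n. \<not> N1 (rot n v) \<and> \<not> N2 (rot n v)"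
proof (rule ccontr)
  assume "\<not> ?thesis"
  then have bad: "N1 (rot n v) \<or> N2 (rot n v)" for n by blast
  have step: "N1 (rot (4 + n) v)" if "N1 (rot n v)" for n
    using oriented_heptagon.N1_not_N2_rot[OF oriented_rot that] bad[of "4 + n"] by (simp add: rot_rot)
  have one: "N1 (rot (Suc n) v)" if "N1 (rot n v)" for n
    using step[OF step[OF that]] rot_period[of "Suc n" v] by (simp add: add.commute)
  have all: "N1 (rot (k + n) v)" if "N1 (rot n v)" for k n
    by (induction k) (use that one in auto)
  obtain m where "\<not> N2 (rot m v)" using not_all(2) by blast
  then have m: "N1 (rot m v)" using bad by blast
  have per: "rot (7 * j + n) v = rot n v" for j n
  proof (induction j)
    case (Suc j)
    have "7 * Suc j + n = (7 * j + n) + 7" by simp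
    then show ?case using rot_period[of "7 * j + n" v] Suc by metis
  qed simp
  obtain i where i: "\<not> N1 (rot i v)" using not_all(1) by blast
  \<comment> \<open>Adding \<open>7 * m\<close> keeps the natural subtraction of \<open>m\<close>
    exact.\<close>
  have "N1 (rot (7 * m + i - m + m) v)" by (rule all[OF m])
  moreover have "7 * m + i - m + m = 7 * m + i" by simp
  ultimately show False using i per[of m i] by simp
qed

end

text \<open>A smallest subfamily that cuts out the same set within the affine hull is irredundant,
  and each facet is tight for one of its members.\<close>

lemma card_facets_le:
  fixes H :: "'a::euclidean_space set set"
  assumes H: "finite H" and halfspace: "\<And>h. h \<in> H \<Longrightarrow> \<exists>a b. a \<noteq> 0 \<and> h = {x. a \<bullet> x \<le> b}"
  shows "finite {C. C facet_of \<Inter>H} \<and> card {C. C facet_of \<Inter>H} \<le> card H"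
proof -
  let ?S = "\<Inter>H"
  define good where "good F \<longleftrightarrow> F \<subseteq> H \<and> ?S = affine hull ?S \<inter> \<Inter>F" for F
  have "good H" using hull_subset[of ?S affine] by (auto simp: good_def)
  then obtain F where F: "good F" "\<And>F'. good F' \<Longrightarrow> card F \<le> card F'"
    using exists_least_iff[of "\<lambda>k. \<exists>F. good F \<and> card F = k"] by (metis leI)
  have fin: "finite F" using F(1) H by (auto simp: good_def intro: finite_subset)
  obtain a b where ab: "\<And>h. h \<in> F \<Longrightarrow> a h \<noteq> 0 \<and> h = {x. a h \<bullet> x \<le> b h}"
    using halfspace F(1) unfolding good_def by (metis subsetD)
  have psub: "?S \<subset> affine hull ?S \<inter> \<Inter>F'" if F': "F' \<subset> F" for F'
  proof -
    have "?S \<subseteq> \<Inter>F'" using F' F(1) unfolding good_def by (metis Inter_anti_mono psubset_imp_subset subset_trans)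
    then have "?S \<subseteq> affine hull ?S \<inter> \<Inter>F'" using hull_subset[of ?S affine] by (rule Int_greatest[rotated])
    moreover have "\<not> good F'" using F(2)[of F'] psubset_card_mono[OF fin F'] by auto
    then have "?S \<noteq> affine hull ?S \<inter> \<Inter>F'" using F' F(1) unfolding good_def by (metis psubset_imp_subset subset_trans)
    ultimately show ?thesis by (rule psubsetI)
  qed
  have facets: "C facet_of ?S \<longleftrightarrow> (\<exists>h. h \<in> F \<and> C = ?S \<inter> {x. a h \<bullet> x = b h})" for C
    by (rule facet_of_polyhedron_explicit[OF fin _ ab psub]) (use F(1) in \<open>simp_all add: good_def\<close>)
  have eq: "{C. C facet_of ?S} = (\<lambda>h. ?S \<inter> {x. a h \<bullet> x = b h}) ` F" unfolding facets by (rule Collect_cong[THEN trans[OF _ image_def[symmetric]]]) blast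
  have "card F \<le> card H" using F(1) H by (auto simp: good_def intro: card_mono)
  then show ?thesis unfolding eq using fin card_image_le[OF fin] by (meson finite_imageI order_trans)
qed

text \<open>An affine basis of the image pulls back to one of \<open>S\<close>, so facets of the
  embedded body correspond to facets in Euclidean space.\<close>

lemma has_aff_dim_injective_image:
  fixes f :: "'a::real_normed_vector \<Rightarrow> 'b::real_normed_vector"
  assumes f: "bounded_linear f" "inj f" and d: "has_aff_dim (f ` S) k"
  shows "has_aff_dim S k"
proof -
  obtain B where B: "finite B" "affine hull B = affine hull (f ` S)" "\<not> affine_dependent B" "int (card B) = k + 1"
    using d unfolding has_aff_dim_def by blast
  have im: "affine hull (f ` T) = f ` (affine hull T)" for T using affine_hull_linear_image[OF f(1)] by metis
  have "B \<subseteq> range f" using hull_subset[of B affine] B(2) im[of S] by blast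
  then obtain C where C: "B = f ` C" by (metis subset_imageE)
  have "finite C" using B(1) C f(2) by (metis finite_imageD inj_on_subset subset_UNIV)
  moreover have "affine hull C = affine hull S" using B(2) unfolding C im using f(2) by (simp add: inj_image_eq_iff)
  moreover have "\<not> affine_dependent C"
  proof
    assume "affine_dependent C"
    then obtain x where x: "x \<in> C" "x \<in> affine hull (C - {x})" unfolding affine_dependent_def by blast
    have "f ` (C - {x}) = B - {f x}" unfolding C using f(2) by (auto simp: inj_eq)
    then have "f x \<in> affine hull (B - {f x})" using x(2) im[of "C - {x}"] by auto
    then have "affine_dependent B" using x(1) unfolding C affine_dependent_def by blast
    then show False using B(3) by simp
  qed
  moreover have "int (card C) = k + 1" using B(4) C f(2) by (metis card_image inj_on_subset subset_UNIV)
  ultimately show ?thesis unfolding has_aff_dim_def by blast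
qed

lemma polytope_size_injective_image_le:
  fixes f :: "'a::euclidean_space \<Rightarrow> 'b::real_normed_vector"
  assumes f: "bounded_linear f" "inj f" and fin: "finite {C. C facet_of S}"
  shows "polytope_size (f ` S) \<le> card {C. C facet_of S}"
proof -
  have lin: "linear f" using f(1) by (rule bounded_linear.linear)
  have "{F. is_facet F (f ` S)} \<subseteq> (`) f ` {C. C facet_of S}"
  proof
    fix F assume "F \<in> {F. is_facet F (f ` S)}"
    then obtain k where F: "F face_of f ` S" "F \<noteq> {}" "has_aff_dim (f ` S) k" "has_aff_dim F (k - 1)"
      unfolding is_facet_def by blast
    obtain C where C: "F = f ` C" using face_of_imp_subset[OF F(1)] by (metis subset_imageE)
    have "C face_of S" using F(1) unfolding C by (simp add: face_of_linear_image[OF lin f(2)])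
    moreover have "C \<noteq> {}" using F(2) C by simp
    ultimately have "is_facet C S"
      using has_aff_dim_injective_image[OF f F(3)] has_aff_dim_injective_image[OF f F(4)[unfolded C]]
      unfolding is_facet_def by blast
    then show "F \<in> (`) f ` {C. C facet_of S}" using C by (simp add: is_facet_iff_facet_of)
  qed
  then have "polytope_size (f ` S) \<le> card ((`) f ` {C. C facet_of S})"
    unfolding polytope_size_def by (rule card_mono[rotated]) (simp add: fin)
  also have "\<dots> \<le> card {C. C facet_of S}" by (rule card_image_le[OF fin])
  finally show ?thesis .
qed

text \<open>Six affine inequalities in the plane point \<open>h\<close> and a height \<open>z\<close>. The planes through the lifted
  vertices (height \<open>[234]\<close> at vertex 2, \<open>[345]\<close> at vertex 5, height 0 elsewhere) that bound the
  extension from below are \<open>z = 0\<close> and one plane hinged on each of the lines 13 and 46; those that bound it from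
  above are hinged on the sides 34, 01 and 60.\<close>

definition cap :: "(nat \<Rightarrow> real^3) \<Rightarrow> ((real^3) \<times> real) list" where
  "cap v = [(0, 1),
     (brk (v 2) (v 3) (v 4) *\<^sub>R cross3 (v 1) (v 3), brk (v 1) (v 2) (v 3)),
     (brk (v 3) (v 4) (v 5) *\<^sub>R cross3 (v 4) (v 6), brk (v 4) (v 5) (v 6)),
     (cross3 (v 3) (v 4), -1),
     (brk (v 2) (v 3) (v 4) *\<^sub>R cross3 (v 0) (v 1), - brk (v 0) (v 1) (v 2)),
     (brk (v 3) (v 4) (v 5) *\<^sub>R cross3 (v 6) (v 0), - brk (v 0) (v 5) (v 6))]"

definition in_cap :: "(nat \<Rightarrow> real^3) \<Rightarrow> real^3 \<Rightarrow> real \<Rightarrow> bool" where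
  "in_cap v h z \<longleftrightarrow> (\<forall>(l, s) \<in> set (cap v). 0 \<le> l \<bullet> h + s * z)"

lemma in_cap_iff: "in_cap v h z \<longleftrightarrow> 0 \<le> z \<and>
    0 \<le> brk (v 2) (v 3) (v 4) * brk (v 1) (v 3) h + brk (v 1) (v 2) (v 3) * z \<and>
    0 \<le> brk (v 3) (v 4) (v 5) * brk (v 4) (v 6) h + brk (v 4) (v 5) (v 6) * z \<and>
    z \<le> brk (v 3) (v 4) h \<and>
    brk (v 0) (v 1) (v 2) * z \<le> brk (v 2) (v 3) (v 4) * brk (v 0) (v 1) h \<and>
    brk (v 0) (v 5) (v 6) * z \<le> brk (v 3) (v 4) (v 5) * brk (v 6) (v 0) h"
  by (simp add: in_cap_def cap_def brk_def)

text \<open>The two nonzero heights are the values of \<open>[34x]\<close> at vertices 2 and 5, so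
  the upper plane hinged on the side 34 contains both lifted vertices.\<close>

definition height :: "(nat \<Rightarrow> real^3) \<Rightarrow> nat \<Rightarrow> real" where
  "height v k = (if k = 2 then brk (v 2) (v 3) (v 4) else if k = 5 then brk (v 3) (v 4) (v 5) else 0)"

text \<open>Three lines through the common point \<open>b\<close> are linearly dependent, with
  brackets of the four points as coefficients.\<close>

lemma brk_pencil_second: "brk a b d * brk b c x = brk b c d * brk a b x + brk a b c * brk b d x"
  by (simp add: brk_def cross3_simps)

lemma brk_pencil_third: "brk a c d * brk b c x = brk a b c * brk c d x + brk b c d * brk a c x"
  by (simp add: brk_def cross3_simps)

context oriented_heptagon
begin

lemma vertex_in_cap:
  assumes "\<not> N1 v" "\<not> N2 v" "k < 7"
  shows "in_cap v (v k) (height v k)"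
proof -
  let ?b = "\<lambda>i j k. brk (v i) (v j) (v k)"
  have pos: "0 \<le> ?b i j k" if "i < j" "j < k" "k < 7" for i j k using orient[OF that] by simp
  have turn: "?b 1 3 0 = ?b 0 1 3" "?b 4 6 0 = ?b 0 4 6" "?b 3 4 0 = ?b 0 3 4" "?b 4 6 1 = ?b 1 4 6" "?b 3 4 1 = ?b 1 3 4"
    "?b 6 0 1 = ?b 0 1 6" "?b 4 6 2 = ?b 2 4 6" "?b 3 4 2 = ?b 2 3 4" "?b 6 0 2 = ?b 0 2 6" "?b 4 6 3 = ?b 3 4 6"
    "?b 6 0 3 = ?b 0 3 6" "?b 6 0 4 = ?b 0 4 6" "?b 6 0 5 = ?b 0 5 6"
    by (rule brk_rotate[symmetric] brk_rotate)+
  have swap: "?b 1 3 2 = - ?b 1 2 3" "?b 4 6 5 = - ?b 4 5 6"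
    by (rule brk_swap(2))+
  have c: "?b 0 1 2 * ?b 3 4 5 \<le> ?b 0 1 5 * ?b 2 3 4" "?b 0 5 6 * ?b 2 3 4 \<le> ?b 0 2 6 * ?b 3 4 5"
    using assms by (simp_all add: N1_def N2_def)
  have "k \<in> {0, 1, 2, 3, 4, 5, 6}" using assms(3) by auto
  then consider "k = 0" | "k = 1" | "k = 2" | "k = 3" | "k = 4" | "k = 5" | "k = 6" by blast
  then show ?thesis
    by cases (use c in \<open>simp_all add: in_cap_iff height_def turn[unfolded One_nat_def] swap[unfolded One_nat_def] brk_refl pos mult.commute\<close>)
qed

text \<open>With nonnegative height, the upper planes give the sides 34, 01 and 60. Eliminating the
  height between a lower and an upper plane gives the rest: 13 with 34 and with 01 yields 23 and 12,
  while 46 with 34 and with 60 yields 45 and 56.\<close>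

lemma in_cap_side:
  assumes "in_cap v h z" "i < 7"
  shows "0 \<le> side i h"
proof -
  let ?b = "\<lambda>i j k. brk (v i) (v j) (v k)" and ?h = "\<lambda>i j. brk (v i) (v j) h"
  have o: "0 < ?b i j k" if "i < j" "j < k" "k < 7" for i j k using orient[OF that] .
  have z: "0 \<le> z" "0 \<le> ?b 2 3 4 * ?h 1 3 + ?b 1 2 3 * z" "0 \<le> ?b 3 4 5 * ?h 4 6 + ?b 4 5 6 * z" "z \<le> ?h 3 4"
    "?b 0 1 2 * z \<le> ?b 2 3 4 * ?h 0 1" "?b 0 5 6 * z \<le> ?b 3 4 5 * ?h 6 0"
    using assms(1) by (simp_all add: in_cap_iff)
  have s34: "0 \<le> ?h 3 4" using z by simp
  have "0 \<le> ?b 0 1 2 * z" using z(1) o[of 0 1 2] by simp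
  then have "0 \<le> ?b 2 3 4 * ?h 0 1" using z(5) by linarith
  then have s01: "0 \<le> ?h 0 1" using o[of 2 3 4] by (simp add: zero_le_mult_iff)
  have "0 \<le> ?b 0 5 6 * z" using z(1) o[of 0 5 6] by simp
  then have "0 \<le> ?b 3 4 5 * ?h 6 0" using z(6) by linarith
  then have s60: "0 \<le> ?h 6 0" using o[of 3 4 5] by (simp add: zero_le_mult_iff)
  have ids: "?b 0 1 3 * ?h 1 2 = ?b 1 2 3 * ?h 0 1 + ?b 0 1 2 * ?h 1 3" "?b 1 3 4 * ?h 2 3 = ?b 1 2 3 * ?h 3 4 + ?b 2 3 4 * ?h 1 3"
    "?b 3 4 6 * ?h 4 5 = ?b 4 5 6 * ?h 3 4 + ?b 3 4 5 * ?h 4 6" "?b 4 6 0 * ?h 5 6 = ?b 4 5 6 * ?h 6 0 + ?b 5 6 0 * ?h 4 6"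
    by (rule brk_pencil_second brk_pencil_third)+
  have turn: "?b 4 6 0 = ?b 0 4 6" "?b 5 6 0 = ?b 0 5 6" by (rule brk_rotate[symmetric] brk_rotate)+
  have s23: "0 \<le> ?h 2 3"
  proof -
    have "0 \<le> ?b 1 2 3 * (?h 3 4 - z)" using z o[of 1 2 3] by simp
    then have "0 \<le> ?b 1 3 4 * ?h 2 3" using z(2) unfolding ids by (simp add: algebra_simps)
    then show ?thesis using o[of 1 3 4] by (simp add: zero_le_mult_iff)
  qed
  have s45: "0 \<le> ?h 4 5"
  proof -
    have "0 \<le> ?b 4 5 6 * (?h 3 4 - z)" using z o[of 4 5 6] by simp
    then have "0 \<le> ?b 3 4 6 * ?h 4 5" using z(3) unfolding ids by (simp add: algebra_simps)
    then show ?thesis using o[of 3 4 6] by (simp add: zero_le_mult_iff)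
  qed
  have s12: "0 \<le> ?h 1 2"
  proof -
    have "0 \<le> ?b 0 1 2 * (?b 2 3 4 * ?h 1 3 + ?b 1 2 3 * z) + ?b 1 2 3 * (?b 2 3 4 * ?h 0 1 - ?b 0 1 2 * z)"
      using z o[of 0 1 2] o[of 1 2 3] by simp
    also have "\<dots> = ?b 2 3 4 * (?b 0 1 3 * ?h 1 2)" unfolding ids by (simp add: algebra_simps)
    finally show ?thesis using o[of 0 1 3] o[of 2 3 4] by (simp add: zero_le_mult_iff)
  qed
  have s56: "0 \<le> ?h 5 6"
  proof -
    have "0 \<le> ?b 0 5 6 * (?b 3 4 5 * ?h 4 6 + ?b 4 5 6 * z) + ?b 4 5 6 * (?b 3 4 5 * ?h 6 0 - ?b 0 5 6 * z)"
      using z o[of 0 5 6] o[of 4 5 6] by simp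
    also have "\<dots> = ?b 3 4 5 * (?b 0 4 6 * ?h 5 6)" unfolding ids[unfolded turn] by (simp add: algebra_simps)
    finally show ?thesis using o[of 0 4 6] o[of 3 4 5] by (simp add: zero_le_mult_iff)
  qed
  have "i \<in> {0, 1, 2, 3, 4, 5, 6}" using assms(2) by auto
  then show ?thesis using s01 s12 s23 s34 s45 s56 s60 by (auto simp: side_def next7_def eval_nat_numeral)
qed

lemma sides_imp_hull:
  assumes h: "\<And>i. i < 7 \<Longrightarrow> 0 \<le> side i h" and one: "h $ 1 = 1" "\<And>i. i < 7 \<Longrightarrow> v i $ 1 = 1"
  shows "h \<in> convex hull (v ` {..<7})"
proof -
  have ends: "0 \<le> brk (v 0) (v 1) h" "brk (v 0) (v 6) h \<le> 0"
    using h[of 0] h[of 6] brk_swap(1)[of "v 6" "v 0" h] by (simp_all add: side_def next7_def)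
  \<comment> \<open>The diagonals from vertex 0 triangulate the heptagon; a sign change of
    \<open>[0jh]\<close> locates the triangle containing \<open>h\<close>.\<close>
  obtain j where j: "1 \<le> j" "j \<le> 5" "0 \<le> brk (v 0) (v j) h" "brk (v 0) (v (j + 1)) h \<le> 0"
  proof (rule ccontr)
    assume "\<not> thesis"
    then have step: "0 < brk (v 0) (v (j + 1)) h" if "1 \<le> j" "j \<le> 5" "0 \<le> brk (v 0) (v j) h" for j
      using that \<open>\<And>j. \<lbrakk>1 \<le> j; j \<le> 5; 0 \<le> brk (v 0) (v j) h; brk (v 0) (v (j + 1)) h \<le> 0\<rbrakk> \<Longrightarrow> thesis\<close> not_le by blast
    have "0 < brk (v 0) (v 2) h" using step[of 1] ends(1) by (simp add: numeral_2_eq_2)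
    then have "0 < brk (v 0) (v 3) h" using step[of 2] by simp
    then have "0 < brk (v 0) (v 4) h" using step[of 3] by simp
    then have "0 < brk (v 0) (v 5) h" using step[of 4] by simp
    then have "0 < brk (v 0) (v 6) h" using step[of 5] by simp
    then show False using ends(2) by simp
  qed
  let ?d = "brk (v 0) (v j) (v (j + 1))" and ?a = "brk h (v j) (v (j + 1))" and ?b = "brk (v 0) h (v (j + 1))"
    and ?c = "brk (v 0) (v j) h"
  have d: "0 < ?d" using j by (intro orient) auto
  have "side j h = brk (v j) (v (j + 1)) h" using j by (simp add: side_def next7_def)
  then have a: "0 \<le> ?a" using h[of j] j brk_rotate[of "v j" "v (j + 1)" h] by simp
  have b: "0 \<le> ?b" using j brk_swap(2)[of "v 0" "v (j + 1)" h] by simp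
  have comb: "?d *\<^sub>R h = ?a *\<^sub>R v 0 + ?b *\<^sub>R v j + ?c *\<^sub>R v (j + 1)" by (rule brk_cramer)
  then have "(?d *\<^sub>R h) $ 1 = (?a *\<^sub>R v 0 + ?b *\<^sub>R v j + ?c *\<^sub>R v (j + 1)) $ 1" by simp
  then have sum: "?d = ?a + ?b + ?c" using one j by simp
  have "h = (1 / ?d) *\<^sub>R (?d *\<^sub>R h)" using d by simp
  also have "\<dots> = (?a / ?d) *\<^sub>R v 0 + (?b / ?d) *\<^sub>R v j + (?c / ?d) *\<^sub>R v (j + 1)"
    unfolding comb by (simp add: scaleR_add_right)
  finally have eq: "h = (?a / ?d) *\<^sub>R v 0 + (?b / ?d) *\<^sub>R v j + (?c / ?d) *\<^sub>R v (j + 1)" .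
  have "?a / ?d + ?b / ?d + ?c / ?d = 1" using sum d by (simp add: add_divide_distrib[symmetric])
  then have "(?a / ?d) *\<^sub>R v 0 + (?b / ?d) *\<^sub>R v j + (?c / ?d) *\<^sub>R v (j + 1) \<in> convex hull {v 0, v j, v (j + 1)}"
    unfolding convex_hull_3 using a b j(3) d by (intro CollectI exI conjI refl) auto
  moreover have "convex hull {v 0, v j, v (j + 1)} \<subseteq> convex hull (v ` {..<7})"
    using j by (intro hull_mono) auto
  ultimately show ?thesis using eq by auto
qed

end

definition cap_body :: "(nat \<Rightarrow> real^3) \<Rightarrow> (real^3) set" where
  "cap_body v = {X. in_cap v (vector [1, X $ 1, X $ 2]) (X $ 3)}"

definition embed3 :: "real^3 \<Rightarrow> point" where
  "embed3 X = Poly_Mapping.single 0 (X $ 1) + Poly_Mapping.single 1 (X $ 2) + Poly_Mapping.single 2 (X $ 3)"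

definition chart :: "real^3 \<Rightarrow> point" where
  "chart t = Poly_Mapping.single 0 (t $ 2) + Poly_Mapping.single 1 (t $ 3)"

lemma lookup_embed3: "Poly_Mapping.lookup (embed3 X) i =
    (if i = 0 then X $ 1 else if i = 1 then X $ 2 else if i = 2 then X $ 3 else 0)"
  by (auto simp: embed3_def lookup_add lookup_single)

lemma bounded_linear_embed3: "bounded_linear embed3"
proof -
  have "linear embed3"
    by (rule linearI; rule poly_mapping_eqI) (simp_all add: lookup_embed3 lookup_add)
  then show ?thesis by (simp add: linear_conv_bounded_linear)
qed

lemma inj_embed3: "inj embed3"
proof (rule injI)
  fix X Y assume "embed3 X = embed3 Y"
  then have "Poly_Mapping.lookup (embed3 X) i = Poly_Mapping.lookup (embed3 Y) i" for i by simp
  from this[of 0] this[of 1] this[of 2] show "X = Y" by (simp add: lookup_embed3 vec_eq_iff forall_3)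
qed

lemma linear_chart: "linear chart"
  by (rule linearI; rule poly_mapping_eqI) (simp_all add: chart_def lookup_add lookup_single when_def distrib_left)

lemma chart_hom: "x \<in> Rn 2 \<Longrightarrow> chart (hom (x, 1)) = x"
  by (rule Rn2_eqI) (auto simp: chart_def Rn_iff lookup_add lookup_single)

lemma proj_embed3: "proj 2 (embed3 X) = chart (vector [1, X $ 1, X $ 2])"
  by (rule poly_mapping_eqI) (auto simp: lookup_proj lookup_embed3 chart_def lookup_add lookup_single when_def)

context oriented_heptagon
begin

lemma cap_body_halfspaces:
  "\<exists>H. finite H \<and> card H \<le> 6 \<and> cap_body v = \<Inter>H \<and> (\<forall>h\<in>H. \<exists>a b. a \<noteq> 0 \<and> h = {x. a \<bullet> x \<le> b})"
proof -
  define a :: "(real^3) \<times> real \<Rightarrow> real^3" where "a c = vector [- fst c $ 2, - fst c $ 3, - snd c]" for c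
  let ?H = "(\<lambda>c. {x. a c \<bullet> x \<le> fst c $ 1}) ` set (cap v)"
  have "length (cap v) = 6" by (simp add: cap_def)
  then have "card (set (cap v)) \<le> 6" using card_length[of "cap v"] by simp
  then have card: "card ?H \<le> 6" using card_image_le[of "set (cap v)"] order_trans by blast
  have "a c \<bullet> x \<le> fst c $ 1 \<longleftrightarrow> 0 \<le> fst c \<bullet> vector [1, x $ 1, x $ 2] + snd c * x $ 3" for c x
    by (simp add: a_def inner_vec_def sum_3 algebra_simps) linarith
  then have eq: "cap_body v = \<Inter>?H" by (simp add: cap_body_def in_cap_def case_prod_beta set_eq_iff)
  \<comment> \<open>No bounding plane is vertical, so every inequality defines a genuine
    half-space.\<close>
  have "snd c \<noteq> 0" if "c \<in> set (cap v)" for c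
    using that orient[of 1 2 3] orient[of 4 5 6] orient[of 0 1 2] orient[of 0 5 6] by (auto simp: cap_def)
  then have "a c \<noteq> 0" if "c \<in> set (cap v)" for c using that by (auto simp: a_def vec_eq_iff forall_3)
  then have "\<forall>h\<in>?H. \<exists>b d. b \<noteq> 0 \<and> h = {x. b \<bullet> x \<le> d}" by blast
  with card eq show ?thesis by (intro exI[of _ ?H]) simp
qed

lemma cap_body_base:
  assumes "X \<in> cap_body v" "\<And>i. i < 7 \<Longrightarrow> v i $ 1 = 1"
  shows "vector [1, X $ 1, X $ 2] \<in> convex hull (v ` {..<7})"
  by (rule sides_imp_hull) (use assms in_cap_side in \<open>auto simp: cap_body_def\<close>)

lemma bounded_cap_body:
  assumes one: "\<And>i. i < 7 \<Longrightarrow> v i $ 1 = 1"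
  shows "bounded (cap_body v)"
proof -
  have "bounded (convex hull (v ` {..<7}))" by (intro compact_imp_bounded finite_imp_compact_convex_hull) simp
  then obtain B where B: "\<And>h. h \<in> convex hull (v ` {..<7}) \<Longrightarrow> norm h \<le> B" unfolding bounded_iff by blast
  have "norm X \<le> B + B + norm (cross3 (v 3) (v 4)) * B" if X: "X \<in> cap_body v" for X
  proof -
    let ?h = "vector [1, X $ 1, X $ 2] :: real^3"
    have h: "norm ?h \<le> B" using B cap_body_base[OF X one] by blast
    have c: "\<bar>X $ 1\<bar> \<le> B" "\<bar>X $ 2\<bar> \<le> B"
      using component_le_norm_cart[of ?h 2] component_le_norm_cart[of ?h 3] h by simp_all
    have "0 \<le> X $ 3" "X $ 3 \<le> cross3 (v 3) (v 4) \<bullet> ?h" using X by (simp_all add: cap_body_def in_cap_iff brk_def)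
    moreover have "cross3 (v 3) (v 4) \<bullet> ?h \<le> norm (cross3 (v 3) (v 4)) * B"
      using norm_cauchy_schwarz[of "cross3 (v 3) (v 4)" ?h] mult_left_mono[OF h norm_ge_zero[of "cross3 (v 3) (v 4)"]]
      by linarith
    ultimately have "\<bar>X $ 3\<bar> \<le> norm (cross3 (v 3) (v 4)) * B" by simp
    moreover have "norm X \<le> \<bar>X $ 1\<bar> + \<bar>X $ 2\<bar> + \<bar>X $ 3\<bar>" using norm_le_l1_cart[of X] by (simp add: sum_3)
    ultimately show ?thesis using c by linarith
  qed
  then show ?thesis unfolding bounded_iff by blast
qed

end

lemma heptagon_extension_six:
  fixes p :: "nat \<Rightarrow> point"
  assumes R: "\<And>i. i < 7 \<Longrightarrow> p i \<in> Rn 2"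
    and orient: "\<And>i j k. i < j \<Longrightarrow> j < k \<Longrightarrow> k < 7 \<Longrightarrow> 0 < brk (hom (p i, 1)) (hom (p j, 1)) (hom (p k, 1))"
  obtains Q where "polytope_in 3 Q" "proj 2 ` Q = convex hull (p ` {..<7})" "polytope_size Q \<le> 6"
proof -
  define v where "v i = hom (p i, 1)" for i
  interpret v: oriented_heptagon v by unfold_locales (simp add: v_def orient)
  obtain n where n: "\<not> N1 (rot n v)" "\<not> N2 (rot n v)" using v.good_rotation by blast
  define w where "w = rot n v"
  interpret w: oriented_heptagon w unfolding w_def by (rule v.oriented_rot)
  have one: "w i $ 1 = 1" for i by (simp add: w_def rot_def v_def)
  let ?S = "cap_body w"
  obtain H where H0: "finite H \<and> card H \<le> 6 \<and> ?S = \<Inter>H \<and> (\<forall>h\<in>H. \<exists>a b. a \<noteq> 0 \<and> h = {x. a \<bullet> x \<le> b})"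
    using w.cap_body_halfspaces by (rule exE)
  then have H: "finite H" "card H \<le> 6" "?S = \<Inter>H" "\<And>h. h \<in> H \<Longrightarrow> \<exists>a b. a \<noteq> 0 \<and> h = {x. a \<bullet> x \<le> b}"
    by (simp_all only:)
  have "polyhedron ?S" unfolding polyhedron_def by (rule exI[of _ H]) (use H(1,3,4) in \<open>simp\<close>)
  then have S: "polytope ?S" using w.bounded_cap_body[OF one] by (simp add: polytope_eq_bounded_polyhedron)
  show thesis
  proof (rule that[of "embed3 ` ?S"])
    have "polytope (embed3 ` ?S)" using S bounded_linear_embed3 by (intro polytope_linear_image bounded_linear.linear)
    then show "polytope_in 3 (embed3 ` ?S)" by (auto simp: polytope_in_def Rn_iff lookup_embed3)
    have "finite {C. C facet_of ?S}" "card {C. C facet_of ?S} \<le> 6"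
      using card_facets_le[OF H(1) H(4)] H(2,3) by simp_all
    then show "polytope_size (embed3 ` ?S) \<le> 6"
      using polytope_size_injective_image_le[OF bounded_linear_embed3 inj_embed3] order_trans by blast
    have vw: "chart ` v ` {..<7} = p ` {..<7}" using R by (auto simp: v_def chart_hom image_image intro!: image_cong)
    show "proj 2 ` embed3 ` ?S = convex hull (p ` {..<7})"
    proof
      show "proj 2 ` embed3 ` ?S \<subseteq> convex hull (p ` {..<7})"
      proof clarify
        fix X assume X: "X \<in> ?S"
        have "w ` {..<7} \<subseteq> v ` {..<7}" by (auto simp: w_def rot_def)
        then have "vector [1, X $ 1, X $ 2] \<in> convex hull (v ` {..<7})"
          using w.cap_body_base[OF X one] hull_mono by blast
        then show "proj 2 (embed3 X) \<in> convex hull (p ` {..<7})"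
          unfolding proj_embed3 using in_convex_hull_linear_image[OF linear_chart] vw by metis
      qed
      have "linear (\<lambda>X. proj 2 (embed3 X))"
        by (rule linearI; rule poly_mapping_eqI) (simp_all add: lookup_proj lookup_embed3 lookup_add)
      then have cvx: "convex (proj 2 ` embed3 ` ?S)"
        using polytope_imp_convex[OF S] by (simp add: image_image convex_linear_image)
      have "p k \<in> proj 2 ` embed3 ` ?S" if k: "k < 7" for k
      proof -
        \<comment> \<open>The multiplier 6 is -1 modulo 7, so \<open>j\<close> undoes the rotation
          by \<open>n\<close>.\<close>
        define j where "j = (k + 6 * n) mod 7"
        have "(j + n) mod 7 = (k + 7 * n) mod 7" unfolding j_def by presburger
        then have wj: "w j = hom (p k, 1)" using k by (simp add: w_def rot_def v_def)
        let ?X = "vector [Poly_Mapping.lookup (p k) 0, Poly_Mapping.lookup (p k) 1, height w j] :: real^3"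
        have h: "vector [1, ?X $ 1, ?X $ 2] = w j" by (simp add: wj vec_eq_iff forall_3)
        have "in_cap w (w j) (height w j)" using n by (intro w.vertex_in_cap) (simp_all add: w_def j_def)
        then have "?X \<in> ?S" unfolding cap_body_def mem_Collect_eq h by simp
        moreover have "proj 2 (embed3 ?X) = p k" unfolding proj_embed3 h using R[OF k] by (simp add: wj chart_hom)
        ultimately show ?thesis by (metis imageI)
      qed
      then show "convex hull (p ` {..<7}) \<subseteq> proj 2 ` embed3 ` ?S" by (intro hull_minimal cvx) auto
    qed
  qed
qed

theorem theorem2:
  fixes P Q :: "point set" and n :: nat
  assumes "convex_heptagon P"
    and "general_position P"
    and "min_size_extension 2 P n Q"
  shows "\<exists>v \<in> vertices Q. proj 2 v \<notin> vertices P"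
proof -
  have P: "polytope_in 2 P" "card (vertices P) = 7" using assms(1) by (simp_all add: convex_heptagon_def)
  obtain p :: "nat \<Rightarrow> point" where p: "vertices P = p ` {..<7}" "inj_on p {..<7}"
    "\<And>i j k. i < j \<Longrightarrow> j < k \<Longrightarrow> k < 7 \<Longrightarrow> 0 < brk (hom (p i, 1)) (hom (p j, 1)) (hom (p k, 1))"
    using heptagon_labelling[OF P] by blast
  have hull: "P = convex hull (p ` {..<7})" using polytope_hull_vertices[of P] P(1) p(1) by (simp add: polytope_in_def)
  have "vertices P \<subseteq> P" by (auto simp: vertices_def extreme_point_of_def)
  then have R: "vertices P \<subseteq> Rn 2" using P(1) by (auto simp: polytope_in_def)
  obtain E where E: "polytope_in 3 E" "proj 2 ` E = P" "polytope_size E \<le> 6"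
    using heptagon_extension_six[of p] R p(1,3) hull by (metis imageI lessThan_iff subsetD)
  have "is_extension 2 P 3 E" using E P(1) by (simp add: is_extension_def)
  then have "extension_complexity 2 P \<le> polytope_size E" unfolding extension_complexity_def by (intro Least_le) blast
  moreover have Q: "is_extension 2 P n Q" "polytope_size Q = extension_complexity 2 P"
    using assms(3) by (simp_all add: min_size_extension_def)
  ultimately have size: "polytope_size Q \<le> 6" using E(3) by simp
  have inV: "set (map p is) \<subseteq> vertices P" if "set is \<subseteq> {..<7}" for "is" using that p(1) by auto
  have dist: "distinct (map p is)" if "set is \<subseteq> {..<7}" "distinct is" for "is"
    using that p(2) by (auto simp: distinct_map intro: inj_on_subset)
  have "\<exists>x\<in>vertices Q. proj 2 x \<notin> p ` {..<7}"
  proof (rule extension_has_hidden_vertex[OF _ size _ p(3)])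
    show "polytope_in n Q" "proj 2 ` Q = convex hull (p ` {..<7})" using Q(1) hull by (simp_all add: is_extension_def)
    show "brk (cross3 (hom (p i1, 1)) (hom (p i2, 1))) (cross3 (hom (p i3, 1)) (hom (p i4, 1)))
          (cross3 (hom (p i5, 1)) (hom (p i6, 1))) \<noteq> 0"
      if "{i1, i2, i3, i4, i5, i6} \<subseteq> {..<7}" "distinct [i1, i2, i3, i4, i5, i6]" for i1 i2 i3 i4 i5 i6
      using inV[of "[i1, i2, i3, i4, i5, i6]"] dist[of "[i1, i2, i3, i4, i5, i6]"] that
      by (intro gp_no_concurrent[OF assms(2) R]) simp_all
    show "brk (cross3 (cross3 (hom (p u1, 1)) (hom (p u2, 1))) (cross3 (hom (p u3, 1)) (hom (p u4, 1))))
            (cross3 (cross3 (hom (p u2, 1)) (hom (p u5, 1))) (cross3 (hom (p u4, 1)) (hom (p u6, 1))))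
            (cross3 (cross3 (hom (p u3, 1)) (hom (p u7, 1))) (cross3 (hom (p u1, 1)) (hom (p u5, 1)))) \<noteq> 0"
      if "{u1, u2, u3, u4, u5, u6, u7} \<subseteq> {..<7}" "distinct [u1, u2, u3, u4, u5, u6, u7]" for u1 u2 u3 u4 u5 u6 u7
      using inV[of "[u1, u2, u3, u4, u5, u6, u7]"] dist[of "[u1, u2, u3, u4, u5, u6, u7]"] that
      by (intro gp_no_collinear[OF assms(2) R]) simp_all
  qed
  then show ?thesis using p(1) by simp
qed

end
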